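(* Let $(A,N)$ be a Nijenhuis algebra. Then $$U_N(A)=A\oplus\Big(\bigoplus_{i=1}^{\infty}AQ^iA\Big),$$ where, for arbitrary $a\in A$, $a_1Q^na_2\in AQ^nA$ and $a_3Q^ma_4\in AQ^mA$ (with $a_1,a_2,a_3,a_4\in A$ and $n,m\geq 1$), the multiplication is given by $a\cdot(a_1Q^na_2)=aa_1Q^na_2$, $(a_1Q^na_2)\cdot a=a_1Q^na_2a$ and $$(a_1Q^na_2)\cdot(a_3Q^ma_4)=a_1N^n(a_2a_3)Q^ma_4-a_1Q^mN^n(a_2a_3)a_4+a_1Q^{m+n}a_2a_3a_4.$$
   Context: Throughout, $\mathbf{k}$ is a commutative ring with unit; all modules, algebras and linear maps are over $\mathbf{k}$; algebras are associative with unit. A Nijenhuis algebra $(A,N)$ is an algebra $A$ with a linear map $N:A\to A$ such that $N(a)N(b)=N\big(N(a)b+aN(b)-N(ab)\big)$ for all $a,b\in A$. $N^n$ denotes the $n$-fold composite of $N$. The ring of Nijenhuis operators on $(A,N)$ is $U_N(A):=\mathbf{k}\langle A,\mathbf{k}[Q]\rangle/I_{A,Q}$, where $\mathbf{k}\langle A,\mathbf{k}[Q]\rangle$ is the free product (coproduct) of the algebra $A$ and the polynomial algebra $\mathbf{k}[Q]$, and $I_{A,Q}$ is the two-sided ideal generated by the elements $QaQ-N(a)Q+QN(a)-Q^2a$, $a\in A$. The natural map $A\to U_N(A)$ is injective and $A$ is identified with its image; $Q$ also denotes the image of $Q$ in $U_N(A)$. $AQ^iA$ denotes the $A$-sub-bimodule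 of $U_N(A)$ generated by $Q^i$ (the span of the elements $aQ^ib$, $a,b\in A$). The direct sum is an (internal) direct sum of $A$-bimodules. *)

theory Defs
  imports "HOL-Algebra.QuotRing" "HOL-Algebra.UnivPoly"
begin

section \<open>Unital associative algebras and Nijenhuis operators\<close>

text \<open>The library locale \<^locale>\<open>algebra\<close> is about commutative algebras, hence the following variant.\<close>

locale unital_algebra = module + ring M +
  assumes smult_mult_left:
      "\<lbrakk>c \<in> carrier R; x \<in> carrier M; y \<in> carrier M\<rbrakk> \<Longrightarrow>
        (c \<odot>\<^bsub>M\<^esub> x) \<otimes>\<^bsub>M\<^esub> y = c \<odot>\<^bsub>M\<^esub> (x \<otimes>\<^bsub>M\<^esub> y)"
    and smult_mult_right:
      "\<lbrakk>c \<in> carrier R; x \<in> carrier M; y \<in> carrier M\<rbrakk> \<Longrightarrow>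
        x \<otimes>\<^bsub>M\<^esub> (c \<odot>\<^bsub>M\<^esub> y) = c \<odot>\<^bsub>M\<^esub> (x \<otimes>\<^bsub>M\<^esub> y)"

definition linear_endo :: "('k, 'r) ring_scheme \<Rightarrow> ('k, 'a, 'm) module_scheme \<Rightarrow> ('a \<Rightarrow> 'a) \<Rightarrow> bool"
  where "linear_endo K A N \<longleftrightarrow>
    N \<in> carrier A \<rightarrow> carrier A \<and>
    (\<forall>a\<in>carrier A. \<forall>b\<in>carrier A. N (a \<oplus>\<^bsub>A\<^esub> b) = N a \<oplus>\<^bsub>A\<^esub> N b) \<and>
    (\<forall>c\<in>carrier K. \<forall>a\<in>carrier A. N (c \<odot>\<^bsub>A\<^esub> a) = c \<odot>\<^bsub>A\<^esub> N a)"

definition nijenhuis_algebra ::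
    "('k, 'r) ring_scheme \<Rightarrow> ('k, 'a, 'm) module_scheme \<Rightarrow> ('a \<Rightarrow> 'a) \<Rightarrow> bool"
  where "nijenhuis_algebra K A N \<longleftrightarrow>
    unital_algebra K A \<and> linear_endo K A N \<and>
    (\<forall>a\<in>carrier A. \<forall>b\<in>carrier A.
      N a \<otimes>\<^bsub>A\<^esub> N b = N ((N a \<otimes>\<^bsub>A\<^esub> b \<oplus>\<^bsub>A\<^esub> a \<otimes>\<^bsub>A\<^esub> N b) \<ominus>\<^bsub>A\<^esub> N (a \<otimes>\<^bsub>A\<^esub> b)))"


section \<open>Free algebras and quotients\<close>

text \<open>
  The free algebra on a set \<open>S\<close>: finitely supported \<open>K\<close>-valued functions on words over \<open>S\<close>,
  multiplied by convolution over the factorisations \<open>w = u @ v\<close>.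
\<close>

definition free_algebra :: "('k, 'r) ring_scheme \<Rightarrow> 'x set \<Rightarrow> ('k, 'x list \<Rightarrow> 'k) module"
  where "free_algebra K S = \<lparr>
    carrier = {f. (\<forall>w. f w \<in> carrier K) \<and> finite {w. f w \<noteq> \<zero>\<^bsub>K\<^esub>} \<and>
      (\<forall>w. f w \<noteq> \<zero>\<^bsub>K\<^esub> \<longrightarrow> set w \<subseteq> S)},
    mult = (\<lambda>f g w. \<Oplus>\<^bsub>K\<^esub>i\<in>{..length w}. f (take i w) \<otimes>\<^bsub>K\<^esub> g (drop i w)),
    one = (\<lambda>w. if w = [] then \<one>\<^bsub>K\<^esub> else \<zero>\<^bsub>K\<^esub>),
    zero = (\<lambda>w. \<zero>\<^bsub>K\<^esub>),
    add = (\<lambda>f g w. f w \<oplus>\<^bsub>K\<^esub> g w),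
    smult = (\<lambda>c f w. c \<otimes>\<^bsub>K\<^esub> f w)\<rparr>"

definition free_gen :: "('k, 'r) ring_scheme \<Rightarrow> 'x \<Rightarrow> 'x list \<Rightarrow> 'k"
  where "free_gen K x = (\<lambda>w. if w = [x] then \<one>\<^bsub>K\<^esub> else \<zero>\<^bsub>K\<^esub>)"

text \<open>
  The library quotient \<^const>\<open>FactRing\<close> together with the induced scalar multiplication
  \<open>c \<odot> (I + x) = I + c \<odot> x\<close>.
\<close>

definition quotient_algebra :: "('k, 'a, 'm) module_scheme \<Rightarrow> 'a set \<Rightarrow> ('k, 'a set) module"
  where "quotient_algebra A I = \<lparr>
    carrier = carrier (A Quot I),
    mult = mult (A Quot I),
    one = one (A Quot I),
    zero = zero (A Quot I),
    add = add (A Quot I),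
    smult = (\<lambda>c C. \<Union>x\<in>C. I +>\<^bsub>A\<^esub> (c \<odot>\<^bsub>A\<^esub> x))\<rparr>"


section \<open>The free product of two algebras\<close>

text \<open>
  \<open>hom_relations K B F j\<close> are the elements of \<open>F\<close> that have to vanish for the map
  \<open>j\<close> from \<open>B\<close> to \<open>F\<close> to become a homomorphism of unital \<open>K\<close>-algebras.
\<close>

definition hom_relations ::
    "('k, 'r) ring_scheme \<Rightarrow> ('k, 'b, 'm) module_scheme \<Rightarrow> ('k, 'f, 'n) module_scheme \<Rightarrow>
      ('b \<Rightarrow> 'f) \<Rightarrow> 'f set"
  where "hom_relations K B F j =
    {j (x \<oplus>\<^bsub>B\<^esub> y) \<ominus>\<^bsub>F\<^esub> (j x \<oplus>\<^bsub>F\<^esub> j y) | x y. x \<in> carrier B \<and> y \<in> carrier B} \<union>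
    {j (c \<odot>\<^bsub>B\<^esub> x) \<ominus>\<^bsub>F\<^esub> (c \<odot>\<^bsub>F\<^esub> j x) | c x. c \<in> carrier K \<and> x \<in> carrier B} \<union>
    {j (x \<otimes>\<^bsub>B\<^esub> y) \<ominus>\<^bsub>F\<^esub> (j x \<otimes>\<^bsub>F\<^esub> j y) | x y. x \<in> carrier B \<and> y \<in> carrier B} \<union>
    {j \<one>\<^bsub>B\<^esub> \<ominus>\<^bsub>F\<^esub> \<one>\<^bsub>F\<^esub>}"

definition free_product_ideal ::
    "('k, 'r) ring_scheme \<Rightarrow> ('k, 'a, 'm) module_scheme \<Rightarrow> ('k, 'b, 'n) module_scheme \<Rightarrow>
      (('a + 'b) list \<Rightarrow> 'k) set"
  where "free_product_ideal K A B =
    (let F = free_algebra K (Inl ` carrier A \<union> Inr ` carrier B) in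
      Idl\<^bsub>F\<^esub> (hom_relations K A F (\<lambda>a. free_gen K (Inl a)) \<union>
            hom_relations K B F (\<lambda>b. free_gen K (Inr b))))"

definition free_product ::
    "('k, 'r) ring_scheme \<Rightarrow> ('k, 'a, 'm) module_scheme \<Rightarrow> ('k, 'b, 'n) module_scheme \<Rightarrow>
      ('k, (('a + 'b) list \<Rightarrow> 'k) set) module"
  where "free_product K A B =
    quotient_algebra (free_algebra K (Inl ` carrier A \<union> Inr ` carrier B)) (free_product_ideal K A B)"

definition free_product_inl ::
    "('k, 'r) ring_scheme \<Rightarrow> ('k, 'a, 'm) module_scheme \<Rightarrow> ('k, 'b, 'n) module_scheme \<Rightarrow>
      'a \<Rightarrow> (('a + 'b) list \<Rightarrow> 'k) set"
  where "free_product_inl K A B a =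
    free_product_ideal K A B +>\<^bsub>free_algebra K (Inl ` carrier A \<union> Inr ` carrier B)\<^esub> free_gen K (Inl a)"

definition free_product_inr ::
    "('k, 'r) ring_scheme \<Rightarrow> ('k, 'a, 'm) module_scheme \<Rightarrow> ('k, 'b, 'n) module_scheme \<Rightarrow>
      'b \<Rightarrow> (('a + 'b) list \<Rightarrow> 'k) set"
  where "free_product_inr K A B b =
    free_product_ideal K A B +>\<^bsub>free_algebra K (Inl ` carrier A \<union> Inr ` carrier B)\<^esub> free_gen K (Inr b)"


section \<open>The ring of Nijenhuis operators\<close>

type_synonym ('k, 'a) nij_free = "(('a + (nat \<Rightarrow> 'k)) list \<Rightarrow> 'k) set"

text \<open>The free product \<open>K\<langle>A, K[Q]\<rangle>\<close>, where \<open>K[Q]\<close> is \<^term>\<open>UP K\<close>.\<close>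

definition nij_free :: "('k, 'r) ring_scheme \<Rightarrow> ('k, 'a, 'm) module_scheme \<Rightarrow>
    ('k, ('k, 'a) nij_free) module"
  where "nij_free K A = free_product K A (UP K)"

definition nij_free_emb :: "('k, 'r) ring_scheme \<Rightarrow> ('k, 'a, 'm) module_scheme \<Rightarrow>
    'a \<Rightarrow> ('k, 'a) nij_free"
  where "nij_free_emb K A a = free_product_inl K A (UP K) a"

definition nij_free_Q :: "('k, 'r) ring_scheme \<Rightarrow> ('k, 'a, 'm) module_scheme \<Rightarrow> ('k, 'a) nij_free"
  where "nij_free_Q K A = free_product_inr K A (UP K) (monom (UP K) \<one>\<^bsub>K\<^esub> 1)"

definition nij_ideal :: "('k, 'r) ring_scheme \<Rightarrow> ('k, 'a, 'm) module_scheme \<Rightarrow> ('a \<Rightarrow> 'a) \<Rightarrow>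
    ('k, 'a) nij_free set"
  where "nij_ideal K A N =
    (let P = nij_free K A; \<iota> = nij_free_emb K A; Q = nij_free_Q K A in
      Idl\<^bsub>P\<^esub> {((Q \<otimes>\<^bsub>P\<^esub> \<iota> a \<otimes>\<^bsub>P\<^esub> Q \<ominus>\<^bsub>P\<^esub> \<iota> (N a) \<otimes>\<^bsub>P\<^esub> Q) \<oplus>\<^bsub>P\<^esub> Q \<otimes>\<^bsub>P\<^esub> \<iota> (N a))
                \<ominus>\<^bsub>P\<^esub> (Q \<otimes>\<^bsub>P\<^esub> Q) \<otimes>\<^bsub>P\<^esub> \<iota> a | a. a \<in> carrier A})"

definition nij_operators :: "('k, 'r) ring_scheme \<Rightarrow> ('k, 'a, 'm) module_scheme \<Rightarrow> ('a \<Rightarrow> 'a) \<Rightarrow>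
    ('k, ('k, 'a) nij_free set) module"
  where "nij_operators K A N = quotient_algebra (nij_free K A) (nij_ideal K A N)"

definition nij_emb :: "('k, 'r) ring_scheme \<Rightarrow> ('k, 'a, 'm) module_scheme \<Rightarrow> ('a \<Rightarrow> 'a) \<Rightarrow>
    'a \<Rightarrow> ('k, 'a) nij_free set"
  where "nij_emb K A N a = nij_ideal K A N +>\<^bsub>nij_free K A\<^esub> nij_free_emb K A a"

definition nij_Q :: "('k, 'r) ring_scheme \<Rightarrow> ('k, 'a, 'm) module_scheme \<Rightarrow> ('a \<Rightarrow> 'a) \<Rightarrow>
    ('k, 'a) nij_free set"
  where "nij_Q K A N = nij_ideal K A N +>\<^bsub>nij_free K A\<^esub> nij_free_Q K A"


section \<open>Sub-bimodules and internal direct sums\<close>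

text \<open>
  An algebra \<open>U\<close> is a bimodule over \<open>A\<close> via a homomorphism \<open>\<iota>\<close> from \<open>A\<close> to \<open>U\<close>.
\<close>

definition sub_bimodule :: "('k, 'r) ring_scheme \<Rightarrow> ('k, 'a, 'm) module_scheme \<Rightarrow>
    ('k, 'u, 'n) module_scheme \<Rightarrow> ('a \<Rightarrow> 'u) \<Rightarrow> 'u set \<Rightarrow> bool"
  where "sub_bimodule K A U \<iota> H \<longleftrightarrow>
    submodule H K U \<and>
    (\<forall>a\<in>carrier A. \<forall>h\<in>H. \<iota> a \<otimes>\<^bsub>U\<^esub> h \<in> H \<and> h \<otimes>\<^bsub>U\<^esub> \<iota> a \<in> H)"

definition generated_bimodule :: "('k, 'r) ring_scheme \<Rightarrow> ('k, 'a, 'm) module_scheme \<Rightarrow>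
    ('k, 'u, 'n) module_scheme \<Rightarrow> ('a \<Rightarrow> 'u) \<Rightarrow> 'u \<Rightarrow> 'u set"
  where "generated_bimodule K A U \<iota> u = \<Inter>{H. sub_bimodule K A U \<iota> H \<and> u \<in> H}"

definition bimodule_direct_sum :: "('k, 'r) ring_scheme \<Rightarrow> ('k, 'a, 'm) module_scheme \<Rightarrow>
    ('k, 'u, 'n) module_scheme \<Rightarrow> ('a \<Rightarrow> 'u) \<Rightarrow> ('i \<Rightarrow> 'u set) \<Rightarrow> bool"
  where "bimodule_direct_sum K A U \<iota> M \<longleftrightarrow>
    (\<forall>i. sub_bimodule K A U \<iota> (M i)) \<and>
    (\<forall>u\<in>carrier U. \<exists>!x. (\<forall>i. x i \<in> M i) \<and> finite {i. x i \<noteq> \<zero>\<^bsub>U\<^esub>} \<and>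
        u = (\<Oplus>\<^bsub>U\<^esub>i\<in>{i. x i \<noteq> \<zero>\<^bsub>U\<^esub>}. x i))"

text \<open>The summand \<open>A\<close> has index \<open>0\<close>, the summand \<open>A Q\<^sup>i A\<close> has index \<open>i \<ge> 1\<close>.\<close>

definition nij_summand :: "('k, 'r) ring_scheme \<Rightarrow> ('k, 'a, 'm) module_scheme \<Rightarrow> ('a \<Rightarrow> 'a) \<Rightarrow>
    nat \<Rightarrow> ('k, 'a) nij_free set set"
  where "nij_summand K A N i =
    (let U = nij_operators K A N; \<iota> = nij_emb K A N; Q = nij_Q K A N in
      if i = 0 then \<iota> ` carrier A
      else generated_bimodule K A U \<iota> (Q [^]\<^bsub>U\<^esub> i))"

section \<open>Well-definedness of the constructions\<close>

lemma (in abelian_monoid) finsum_triangle: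
  assumes T: "\<And>i j. T i j \<in> carrier G"
  shows "(\<Oplus>i\<in>{..k::nat}. \<Oplus>j\<in>{..i}. T j i) = (\<Oplus>j\<in>{..k}. \<Oplus>i\<in>{..k-j}. T j (i+j))"
proof (induction k)
  case 0
  then show ?case by (simp add: T)
next
  case (Suc k)
  have "(\<Oplus>j\<in>{..Suc k}. \<Oplus>i\<in>{..Suc k-j}. T j (i+j))
      = T (Suc k) (Suc k) \<oplus> (\<Oplus>j\<in>{..k}. \<Oplus>i\<in>{..Suc k-j}. T j (i+j))"
    by (simp add: T)
  also have "(\<Oplus>j\<in>{..k}. \<Oplus>i\<in>{..Suc k-j}. T j (i+j)) = (\<Oplus>j\<in>{..k}. T j (Suc k) \<oplus> (\<Oplus>i\<in>{..k-j}. T j (i+j)))"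
    by (rule finsum_cong') (auto simp: T Suc_diff_le)
  also have "\<dots> = (\<Oplus>j\<in>{..k}. T j (Suc k)) \<oplus> (\<Oplus>j\<in>{..k}. \<Oplus>i\<in>{..k-j}. T j (i+j))"
    by (rule finsum_addf) (auto simp: T)
  finally show ?case using Suc by (simp add: T a_ac)
qed

lemma free_algebra_simps:
  "carrier (free_algebra K S) = {f. (\<forall>w. f w \<in> carrier K) \<and> finite {w. f w \<noteq> \<zero>\<^bsub>K\<^esub>} \<and>
      (\<forall>w. f w \<noteq> \<zero>\<^bsub>K\<^esub> \<longrightarrow> set w \<subseteq> S)}"
  "f \<otimes>\<^bsub>free_algebra K S\<^esub> g = (\<lambda>w. \<Oplus>\<^bsub>K\<^esub>i\<in>{..length w}. f (take i w) \<otimes>\<^bsub>K\<^esub> g (drop i w))"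
  "\<one>\<^bsub>free_algebra K S\<^esub> = (\<lambda>w. if w = [] then \<one>\<^bsub>K\<^esub> else \<zero>\<^bsub>K\<^esub>)"
  "\<zero>\<^bsub>free_algebra K S\<^esub> = (\<lambda>w. \<zero>\<^bsub>K\<^esub>)"
  "f \<oplus>\<^bsub>free_algebra K S\<^esub> g = (\<lambda>w. f w \<oplus>\<^bsub>K\<^esub> g w)"
  "c \<odot>\<^bsub>free_algebra K S\<^esub> f = (\<lambda>w. c \<otimes>\<^bsub>K\<^esub> f w)"
  by (simp_all add: free_algebra_def)

lemma (in cring) free_algebra_mult_closed:
  assumes f: "f \<in> carrier (free_algebra R S)" and g: "g \<in> carrier (free_algebra R S)"
  shows "f \<otimes>\<^bsub>free_algebra R S\<^esub> g \<in> carrier (free_algebra R S)"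
proof -
  let ?h = "\<lambda>w. \<Oplus>i\<in>{..length w}. f (take i w) \<otimes> g (drop i w)"
  let ?F = "{w. f w \<noteq> \<zero>}" and ?G = "{w. g w \<noteq> \<zero>}"
  have c: "f w \<in> carrier R" "g w \<in> carrier R" for w
    using f g by (auto simp: free_algebra_simps)
  have nz: "\<exists>i. f (take i w) \<noteq> \<zero> \<and> g (drop i w) \<noteq> \<zero>" if "?h w \<noteq> \<zero>" for w
  proof (rule ccontr)
    assume "\<nexists>i. f (take i w) \<noteq> \<zero> \<and> g (drop i w) \<noteq> \<zero>"
    then have "f (take i w) \<otimes> g (drop i w) = \<zero>" for i
      using c by (metis l_null r_null)
    then have "?h w = \<zero>" by (simp add: finsum_zero)
    with that show False by blast
  qed
  have "{w. ?h w \<noteq> \<zero>} \<subseteq> (\<lambda>(u,v). u @ v) ` (?F \<times> ?G)"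
  proof
    fix w assume "w \<in> {w. ?h w \<noteq> \<zero>}"
    then obtain i where "f (take i w) \<noteq> \<zero>" "g (drop i w) \<noteq> \<zero>" using nz by blast
    then show "w \<in> (\<lambda>(u,v). u @ v) ` (?F \<times> ?G)"
      by (intro image_eqI[of _ _ "(take i w, drop i w)"]) auto
  qed
  moreover have "finite (?F \<times> ?G)" using f g by (auto simp: free_algebra_simps)
  ultimately have "finite {w. ?h w \<noteq> \<zero>}" by (meson finite_imageI finite_subset)
  moreover have "set w \<subseteq> S" if nzw: "?h w \<noteq> \<zero>" for w
  proof -
    obtain i where "f (take i w) \<noteq> \<zero>" "g (drop i w) \<noteq> \<zero>" using nz[OF nzw] by blast
    then have "set (take i w) \<subseteq> S" "set (drop i w) \<subseteq> S" 
      using f g by (auto simp: free_algebra_simps)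
    then show ?thesis by (metis Un_least append_take_drop_id set_append)
  qed
  ultimately show ?thesis using c by (simp add: free_algebra_simps)
qed

lemma (in cring) free_algebra_unital_algebra:
  fixes S :: "'x set"
  shows "unital_algebra R (free_algebra R S)"
proof -
  let ?A = "free_algebra R S"
  have ag: "abelian_group ?A"
  proof (rule abelian_groupI)
    fix f g assume fg: "f \<in> carrier ?A" "g \<in> carrier ?A"
    have "{w. f w \<oplus> g w \<noteq> \<zero>} \<subseteq> {w. f w \<noteq> \<zero>} \<union> {w. g w \<noteq> \<zero>}" by auto
    then show "f \<oplus>\<^bsub>?A\<^esub> g \<in> carrier ?A" 
      using fg by (auto simp: free_algebra_simps elim: finite_subset) (metis l_zero subsetD zero_closed)
  next
    fix f assume f: "f \<in> carrier ?A"
    have "{w. \<ominus> f w \<noteq> \<zero>} \<subseteq> {w. f w \<noteq> \<zero>}" by auto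
    then have "(\<lambda>w. \<ominus> f w) \<in> carrier ?A" "(\<lambda>w. \<ominus> f w) \<oplus>\<^bsub>?A\<^esub> f = \<zero>\<^bsub>?A\<^esub>"
      using f by (auto simp: free_algebra_simps l_neg elim: finite_subset)
    then show "\<exists>g\<in>carrier ?A. g \<oplus>\<^bsub>?A\<^esub> f = \<zero>\<^bsub>?A\<^esub>" by blast
  qed (auto simp: free_algebra_simps a_assoc intro: a_comm)
  have mon: "Group.monoid ?A"
  proof
    show "\<one>\<^bsub>?A\<^esub> \<in> carrier ?A" 
      by (auto simp: free_algebra_simps intro: finite_subset[of _ "{[]}"])
  next
    fix f g assume "f \<in> carrier ?A" "g \<in> carrier ?A"
    then show "f \<otimes>\<^bsub>?A\<^esub> g \<in> carrier ?A" by (rule free_algebra_mult_closed)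
  next
    fix f assume f: "f \<in> carrier ?A"
    then have c: "f w \<in> carrier R" for w by (auto simp: free_algebra_simps)
    show "\<one>\<^bsub>?A\<^esub> \<otimes>\<^bsub>?A\<^esub> f = f"
    proof
      fix w
      have "(\<Oplus>i\<in>{..length w}. (if take i w = [] then \<one> else \<zero>) \<otimes> f (drop i w))
         = (\<Oplus>i\<in>{..length w}. if i = 0 then f w else \<zero>)"
        by (rule finsum_cong') (auto simp: c)
      also have "\<dots> = f w" using finsum_singleton[of 0 "{..length w}" "\<lambda>_. f w"] c
        by (simp add: Pi_def eq_commute)
      finally show "(\<one>\<^bsub>?A\<^esub> \<otimes>\<^bsub>?A\<^esub> f) w = f w" by (simp add: free_algebra_simps)
    qed
    show "f \<otimes>\<^bsub>?A\<^esub> \<one>\<^bsub>?A\<^esub> = f"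
    proof
      fix w
      have "(\<Oplus>i\<in>{..length w}. f (take i w) \<otimes> (if drop i w = [] then \<one> else \<zero>))
         = (\<Oplus>i\<in>{..length w}. if i = length w then f w else \<zero>)"
        by (rule finsum_cong') (auto simp: c)
      also have "\<dots> = f w" using finsum_singleton[of "length w" "{..length w}" "\<lambda>_. f w"] c
        by (simp add: Pi_def eq_commute)
      finally show "(f \<otimes>\<^bsub>?A\<^esub> \<one>\<^bsub>?A\<^esub>) w = f w" by (simp only: free_algebra_simps)
    qed
  next
    fix f g h assume fgh: "f \<in> carrier ?A" "g \<in> carrier ?A" "h \<in> carrier ?A"
    then have c: "f w \<in> carrier R" "g w \<in> carrier R" "h w \<in> carrier R" for w 
      by (auto simp: free_algebra_simps)
    show "f \<otimes>\<^bsub>?A\<^esub> g \<otimes>\<^bsub>?A\<^esub> h = f \<otimes>\<^bsub>?A\<^esub> (g \<otimes>\<^bsub>?A\<^esub> h)"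
    proof
      fix w :: "'x list"
      let ?n = "length w"
      let ?T = "\<lambda>j i. f (take j w) \<otimes> g (drop j (take i w)) \<otimes> h (drop i w)"
      have "(f \<otimes>\<^bsub>?A\<^esub> g \<otimes>\<^bsub>?A\<^esub> h) w = (\<Oplus>i\<in>{..?n}. \<Oplus>j\<in>{..i}. ?T j i)"
        unfolding free_algebra_simps
        by (rule finsum_cong') (auto simp: c finsum_ldistr min_def intro!: finsum_cong')
      also have "\<dots> = (\<Oplus>j\<in>{..?n}. \<Oplus>i\<in>{..?n-j}. ?T j (i+j))"
        by (rule finsum_triangle) (simp add: c)
      also have "\<dots> = (f \<otimes>\<^bsub>?A\<^esub> (g \<otimes>\<^bsub>?A\<^esub> h)) w"
        unfolding free_algebra_simps
        by (rule finsum_cong') 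
          (auto simp: c finsum_rdistr m_assoc drop_take add.commute intro!: finsum_cong')
      finally show "(f \<otimes>\<^bsub>?A\<^esub> g \<otimes>\<^bsub>?A\<^esub> h) w = (f \<otimes>\<^bsub>?A\<^esub> (g \<otimes>\<^bsub>?A\<^esub> h)) w" .
    qed
  qed
  have ring: "ring ?A"
  proof (rule ringI[OF ag mon])
    fix f g h assume fgh: "f \<in> carrier ?A" "g \<in> carrier ?A" "h \<in> carrier ?A"
    then have c: "f w \<in> carrier R" "g w \<in> carrier R" "h w \<in> carrier R" for w 
      by (auto simp: free_algebra_simps)
    show "(f \<oplus>\<^bsub>?A\<^esub> g) \<otimes>\<^bsub>?A\<^esub> h = f \<otimes>\<^bsub>?A\<^esub> h \<oplus>\<^bsub>?A\<^esub> g \<otimes>\<^bsub>?A\<^esub> h"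
      unfolding free_algebra_simps
      by (simp add: c l_distr finsum_addf Pi_def)
    show "h \<otimes>\<^bsub>?A\<^esub> (f \<oplus>\<^bsub>?A\<^esub> g) = h \<otimes>\<^bsub>?A\<^esub> f \<oplus>\<^bsub>?A\<^esub> h \<otimes>\<^bsub>?A\<^esub> g"
      unfolding free_algebra_simps
      by (simp add: c r_distr finsum_addf Pi_def)
  qed
  have module: "module R ?A"
  proof (rule moduleI)
    show "cring R" by (rule is_cring)
    show "abelian_group ?A" by (rule ag)
    fix a f assume af: "a \<in> carrier R" "f \<in> carrier ?A"
    have "{w. a \<otimes> f w \<noteq> \<zero>} \<subseteq> {w. f w \<noteq> \<zero>}" using af by auto
    then show "a \<odot>\<^bsub>?A\<^esub> f \<in> carrier ?A"
      using af by (auto simp: free_algebra_simps elim: finite_subset)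
  qed (auto simp: free_algebra_simps l_distr r_distr m_assoc)
  show ?thesis
  proof (intro unital_algebra.intro unital_algebra_axioms.intro module ring)
    fix a f g assume a: "a \<in> carrier R" and "f \<in> carrier ?A" "g \<in> carrier ?A"
    then have c: "f w \<in> carrier R" "g w \<in> carrier R" for w 
      by (auto simp: free_algebra_simps)
    show "a \<odot>\<^bsub>?A\<^esub> f \<otimes>\<^bsub>?A\<^esub> g = a \<odot>\<^bsub>?A\<^esub> (f \<otimes>\<^bsub>?A\<^esub> g)"
      unfolding free_algebra_simps by (simp add: a c m_assoc finsum_rdistr Pi_def)
    show "f \<otimes>\<^bsub>?A\<^esub> (a \<odot>\<^bsub>?A\<^esub> g) = a \<odot>\<^bsub>?A\<^esub> (f \<otimes>\<^bsub>?A\<^esub> g)"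
      unfolding free_algebra_simps by (simp add: a c m_lcomm finsum_rdistr Pi_def)
  qed
qed


definition algebra_hom ::
    "('k, 'r) ring_scheme \<Rightarrow> ('k, 'a, 'm) module_scheme \<Rightarrow> ('k, 'b, 'n) module_scheme \<Rightarrow> ('a \<Rightarrow> 'b) set"
  where "algebra_hom K A B =
    {h \<in> ring_hom A B. \<forall>c\<in>carrier K. \<forall>x\<in>carrier A. h (c \<odot>\<^bsub>A\<^esub> x) = c \<odot>\<^bsub>B\<^esub> h x}"

lemma quotient_algebra_simps:
  "carrier (quotient_algebra A I) = carrier (A Quot I)"
  "X \<otimes>\<^bsub>quotient_algebra A I\<^esub> Y = X \<otimes>\<^bsub>A Quot I\<^esub> Y"
  "\<one>\<^bsub>quotient_algebra A I\<^esub> = \<one>\<^bsub>A Quot I\<^esub>"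
  "\<zero>\<^bsub>quotient_algebra A I\<^esub> = \<zero>\<^bsub>A Quot I\<^esub>"
  "X \<oplus>\<^bsub>quotient_algebra A I\<^esub> Y = X \<oplus>\<^bsub>A Quot I\<^esub> Y"
  by (simp_all add: quotient_algebra_def)

lemma (in unital_algebra) ideal_smult_closed:
  assumes "ideal I M" "c \<in> carrier R" "x \<in> I"
  shows "c \<odot>\<^bsub>M\<^esub> x \<in> I"
proof -
  have x: "x \<in> carrier M" using ideal.Icarr[OF assms(1,3)] .
  then have "(c \<odot>\<^bsub>M\<^esub> \<one>\<^bsub>M\<^esub>) \<otimes>\<^bsub>M\<^esub> x = c \<odot>\<^bsub>M\<^esub> x"
    using assms(2) by (simp add: smult_mult_left)
  then show ?thesis using ideal.I_l_closed[OF assms(1,3)] assms(2) by (metis one_closed smult_closed)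
qed

lemma (in unital_algebra) quotient_smult:
  assumes I: "ideal I M" and c: "c \<in> carrier R" and x: "x \<in> carrier M"
  shows "c \<odot>\<^bsub>quotient_algebra M I\<^esub> (I +>\<^bsub>M\<^esub> x) = I +>\<^bsub>M\<^esub> (c \<odot>\<^bsub>M\<^esub> x)"
proof -
  interpret I: ideal I M by (rule I)
  have eq: "I +>\<^bsub>M\<^esub> (c \<odot>\<^bsub>M\<^esub> y) = I +>\<^bsub>M\<^esub> (c \<odot>\<^bsub>M\<^esub> x)" if y: "y \<in> I +>\<^bsub>M\<^esub> x" for y
  proof -
    obtain i where i: "i \<in> I" "y = i \<oplus>\<^bsub>M\<^esub> x" using y unfolding a_r_coset_def' by blast
    then have "c \<odot>\<^bsub>M\<^esub> y = c \<odot>\<^bsub>M\<^esub> i \<oplus>\<^bsub>M\<^esub> c \<odot>\<^bsub>M\<^esub> x" using c x I.Icarr by (simp add: smult_r_distr)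
    then have "c \<odot>\<^bsub>M\<^esub> y \<in> I +>\<^bsub>M\<^esub> (c \<odot>\<^bsub>M\<^esub> x)"
      using ideal_smult_closed[OF I c i(1)] unfolding a_r_coset_def' by blast
    then show ?thesis using M.a_repr_independence[OF _ smult_closed[OF c x] I.a_subgroup] by simp
  qed
  have "x \<in> I +>\<^bsub>M\<^esub> x" using x I.a_rcos_self by blast
  then have "(\<Union>y\<in>I +>\<^bsub>M\<^esub> x. I +>\<^bsub>M\<^esub> (c \<odot>\<^bsub>M\<^esub> y)) = I +>\<^bsub>M\<^esub> (c \<odot>\<^bsub>M\<^esub> x)"
    using eq by blast
  then show ?thesis by (simp add: quotient_algebra_def)
qed

lemma quotient_algebra_carrier:
  "carrier (quotient_algebra M I) = (\<lambda>x. I +>\<^bsub>M\<^esub> x) ` carrier M"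
  by (auto simp: quotient_algebra_def FactRing_def A_RCOSETS_def')

lemma (in unital_algebra) quotient_unital_algebra:
  assumes I: "ideal I M"
  shows "unital_algebra R (quotient_algebra M I)"
    and "(\<lambda>x. I +>\<^bsub>M\<^esub> x) \<in> algebra_hom R M (quotient_algebra M I)"
proof -
  let ?Q = "quotient_algebra M I"
  interpret I: ideal I M by (rule I)
  interpret Q: ring "M Quot I" by (rule I.quotient_is_ring)
  have hom: "(\<lambda>x. I +>\<^bsub>M\<^esub> x) \<in> ring_hom M (M Quot I)" by (rule I.rcos_ring_hom)
  then have homQ: "(\<lambda>x. I +>\<^bsub>M\<^esub> x) \<in> ring_hom M ?Q"
    unfolding ring_hom_def by (simp add: quotient_algebra_simps)
  then show "(\<lambda>x. I +>\<^bsub>M\<^esub> x) \<in> algebra_hom R M ?Q"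
    by (simp add: algebra_hom_def quotient_smult[OF I])
  have ag: "abelian_group ?Q"
  proof (rule abelian_groupI)
    fix x assume x: "x \<in> carrier ?Q"
    then show "\<exists>y\<in>carrier ?Q. y \<oplus>\<^bsub>?Q\<^esub> x = \<zero>\<^bsub>?Q\<^esub>"
      by (intro bexI[of _ "\<ominus>\<^bsub>M Quot I\<^esub> x"]) (simp_all add: quotient_algebra_simps Q.l_neg)
    fix y assume y: "y \<in> carrier ?Q"
    show "x \<oplus>\<^bsub>?Q\<^esub> y = y \<oplus>\<^bsub>?Q\<^esub> x"
      using x y Q.a_comm by (simp add: quotient_algebra_simps)
  qed (simp_all add: quotient_algebra_simps Q.a_assoc)
  have ring: "ring ?Q"
    by (rule ringI[OF ag], unfold_locales)
      (auto simp: quotient_algebra_simps Q.m_assoc Q.l_distr Q.r_distr)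
  note hs = ring_hom_closed[OF homQ] ring_hom_mult[OF homQ, symmetric] ring_hom_add[OF homQ, symmetric]
    quotient_smult[OF I]
  have mod: "module R ?Q"
    by (rule moduleI[OF R.is_cring ag])
      (auto simp: quotient_algebra_carrier[of M I] hs smult_l_distr smult_r_distr smult_assoc1)
  show "unital_algebra R ?Q"
    by (intro unital_algebra.intro unital_algebra_axioms.intro mod ring)
      (auto simp: quotient_algebra_carrier[of M I] hs smult_mult_left smult_mult_right)
qed

lemma hom_relationsI:
  "\<lbrakk>x \<in> carrier B; y \<in> carrier B\<rbrakk> \<Longrightarrow> j (x \<oplus>\<^bsub>B\<^esub> y) \<ominus>\<^bsub>F\<^esub> (j x \<oplus>\<^bsub>F\<^esub> j y) \<in> hom_relations K B F j"
  "\<lbrakk>c \<in> carrier K; x \<in> carrier B\<rbrakk> \<Longrightarrow> j (c \<odot>\<^bsub>B\<^esub> x) \<ominus>\<^bsub>F\<^esub> (c \<odot>\<^bsub>F\<^esub> j x) \<in> hom_relations K B F j"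
  "\<lbrakk>x \<in> carrier B; y \<in> carrier B\<rbrakk> \<Longrightarrow> j (x \<otimes>\<^bsub>B\<^esub> y) \<ominus>\<^bsub>F\<^esub> (j x \<otimes>\<^bsub>F\<^esub> j y) \<in> hom_relations K B F j"
  "j \<one>\<^bsub>B\<^esub> \<ominus>\<^bsub>F\<^esub> \<one>\<^bsub>F\<^esub> \<in> hom_relations K B F j"
  unfolding hom_relations_def by blast+

lemma (in unital_algebra) hom_relations_subset:
  assumes "unital_algebra R B" "j \<in> carrier B \<rightarrow> carrier M"
  shows "hom_relations R B M j \<subseteq> carrier M"
proof -
  interpret B: unital_algebra R B by fact
  show ?thesis using assms(2) by (auto simp: hom_relations_def Pi_def)
qed

lemma (in unital_algebra) algebra_hom_quotient:
  assumes B: "unital_algebra R B" and j: "j \<in> carrier B \<rightarrow> carrier M"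
    and I: "ideal I M" and rel: "hom_relations R B M j \<subseteq> I"
  shows "(\<lambda>x. I +>\<^bsub>M\<^esub> j x) \<in> algebra_hom R B (quotient_algebra M I)"
proof -
  interpret B: unital_algebra R B by fact
  interpret I: ideal I M by (rule I)
  let ?Q = "quotient_algebra M I"
  have hom: "(\<lambda>x. I +>\<^bsub>M\<^esub> x) \<in> ring_hom M ?Q"
    using quotient_unital_algebra(2)[OF I] by (simp add: algebra_hom_def)
  note hs = ring_hom_closed[OF hom] ring_hom_mult[OF hom, symmetric] ring_hom_add[OF hom, symmetric]
    ring_hom_one[OF hom, symmetric] quotient_smult[OF I]
  have eq: "I +>\<^bsub>M\<^esub> x = I +>\<^bsub>M\<^esub> y" if "x \<ominus>\<^bsub>M\<^esub> y \<in> I" "x \<in> carrier M" "y \<in> carrier M" for x y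
    using that quotient_eq_iff_same_a_r_cos[OF I] by blast
  have jc: "j x \<in> carrier M" if "x \<in> carrier B" for x using j that by blast
  show ?thesis
    unfolding algebra_hom_def
  proof (intro CollectI conjI ballI ring_hom_memI)
    fix x assume x: "x \<in> carrier B"
    show "I +>\<^bsub>M\<^esub> j x \<in> carrier ?Q" using x jc hs by blast
    { fix c assume c: "c \<in> carrier R"
      have "j (c \<odot>\<^bsub>B\<^esub> x) \<ominus>\<^bsub>M\<^esub> (c \<odot>\<^bsub>M\<^esub> j x) \<in> I" by (rule subsetD[OF rel hom_relationsI(2)[OF c x]])
      then show "I +>\<^bsub>M\<^esub> j (c \<odot>\<^bsub>B\<^esub> x) = c \<odot>\<^bsub>?Q\<^esub> (I +>\<^bsub>M\<^esub> j x)"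
        using x c jc eq[of "j (c \<odot>\<^bsub>B\<^esub> x)" "c \<odot>\<^bsub>M\<^esub> j x"] by (simp add: hs) }
    fix y assume y: "y \<in> carrier B"
    have "j (x \<otimes>\<^bsub>B\<^esub> y) \<ominus>\<^bsub>M\<^esub> (j x \<otimes>\<^bsub>M\<^esub> j y) \<in> I" "j (x \<oplus>\<^bsub>B\<^esub> y) \<ominus>\<^bsub>M\<^esub> (j x \<oplus>\<^bsub>M\<^esub> j y) \<in> I"
      by (rule subsetD[OF rel hom_relationsI(3)[OF x y]], rule subsetD[OF rel hom_relationsI(1)[OF x y]])
    then show "I +>\<^bsub>M\<^esub> j (x \<otimes>\<^bsub>B\<^esub> y) = (I +>\<^bsub>M\<^esub> j x) \<otimes>\<^bsub>?Q\<^esub> (I +>\<^bsub>M\<^esub> j y)"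
      "I +>\<^bsub>M\<^esub> j (x \<oplus>\<^bsub>B\<^esub> y) = (I +>\<^bsub>M\<^esub> j x) \<oplus>\<^bsub>?Q\<^esub> (I +>\<^bsub>M\<^esub> j y)"
      using x y jc eq[of "j (x \<otimes>\<^bsub>B\<^esub> y)" "j x \<otimes>\<^bsub>M\<^esub> j y"]
        eq[of "j (x \<oplus>\<^bsub>B\<^esub> y)" "j x \<oplus>\<^bsub>M\<^esub> j y"] by (simp_all add: hs)
  next
    have "j \<one>\<^bsub>B\<^esub> \<ominus>\<^bsub>M\<^esub> \<one>\<^bsub>M\<^esub> \<in> I" by (rule subsetD[OF rel hom_relationsI(4)])
    then show "I +>\<^bsub>M\<^esub> j \<one>\<^bsub>B\<^esub> = \<one>\<^bsub>?Q\<^esub>" using jc eq[of "j \<one>\<^bsub>B\<^esub>" "\<one>\<^bsub>M\<^esub>"] by (simp add: hs)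
  qed
qed

lemma (in cring) free_gen_closed: "x \<in> S \<Longrightarrow> free_gen R x \<in> carrier (free_algebra R S)"
  by (auto simp: free_gen_def free_algebra_simps intro: finite_subset[of _ "{[x]}"])

lemma free_product_unital_algebra:
  assumes A: "unital_algebra K A" and B: "unital_algebra K B"
  shows "unital_algebra K (free_product K A B)"
    and "free_product_inl K A B \<in> algebra_hom K A (free_product K A B)"
    and "free_product_inr K A B \<in> algebra_hom K B (free_product K A B)"
proof -
  interpret A: unital_algebra K A by fact
  let ?F = "free_algebra K (Inl ` carrier A \<union> Inr ` carrier B)"
  let ?I = "free_product_ideal K A B"
  interpret F: unital_algebra K ?F by (rule A.free_algebra_unital_algebra)
  have jl: "(\<lambda>a. free_gen K (Inl a)) \<in> carrier A \<rightarrow> carrier ?F"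
    and jr: "(\<lambda>a. free_gen K (Inr a)) \<in> carrier B \<rightarrow> carrier ?F"
    by (auto intro!: A.free_gen_closed)
  let ?R = "hom_relations K A ?F (\<lambda>a. free_gen K (Inl a)) \<union> hom_relations K B ?F (\<lambda>b. free_gen K (Inr b))"
  have sub: "?R \<subseteq> carrier ?F"
    using F.hom_relations_subset[OF A jl] F.hom_relations_subset[OF B jr] by blast
  have I: "ideal ?I ?F" and RI: "?R \<subseteq> ?I"
    using F.genideal_ideal[OF sub] F.genideal_self[OF sub] by (simp_all add: free_product_ideal_def Let_def)
  show "unital_algebra K (free_product K A B)"
    unfolding free_product_def by (rule F.quotient_unital_algebra[OF I])
  show "free_product_inl K A B \<in> algebra_hom K A (free_product K A B)"
    using F.algebra_hom_quotient[OF A jl I] RI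
    unfolding free_product_def free_product_inl_def[abs_def] by blast
  show "free_product_inr K A B \<in> algebra_hom K B (free_product K A B)"
    using F.algebra_hom_quotient[OF B jr I] RI
    unfolding free_product_def free_product_inr_def[abs_def] by blast
qed

lemma (in cring) UP_unital_algebra: "unital_algebra R (UP R)"
proof -
  interpret P: UP_cring R "UP R" by unfold_locales simp
  have alg: "algebra R (UP R)" by (rule P.UP_algebra)
    note mc = comm_monoid.m_comm[OF cring.axioms(2)[OF algebra.M_cring[OF alg]]]
  show ?thesis
  proof (intro unital_algebra.intro unital_algebra_axioms.intro)
    fix c x y assume c: "c \<in> carrier R" and x: "x \<in> carrier (UP R)" and y: "y \<in> carrier (UP R)"
    show l: "c \<odot>\<^bsub>UP R\<^esub> x \<otimes>\<^bsub>UP R\<^esub> y = c \<odot>\<^bsub>UP R\<^esub> (x \<otimes>\<^bsub>UP R\<^esub> y)"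
      by (rule algebra.smult_assoc2[OF alg c x y])
    have "x \<otimes>\<^bsub>UP R\<^esub> (c \<odot>\<^bsub>UP R\<^esub> y) = c \<odot>\<^bsub>UP R\<^esub> y \<otimes>\<^bsub>UP R\<^esub> x"
      using c x y by (simp add: mc)
    also have "\<dots> = c \<odot>\<^bsub>UP R\<^esub> (y \<otimes>\<^bsub>UP R\<^esub> x)"
      by (rule algebra.smult_assoc2[OF alg c y x])
    finally show "x \<otimes>\<^bsub>UP R\<^esub> (c \<odot>\<^bsub>UP R\<^esub> y) = c \<odot>\<^bsub>UP R\<^esub> (x \<otimes>\<^bsub>UP R\<^esub> y)"
      using x y by (simp add: mc)
  qed (rule algebra.module[OF alg] cring.axioms(1)[OF algebra.M_cring[OF alg]])+
qed

lemma nij_operators_unital_algebra: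
  assumes "nijenhuis_algebra K A N"
  shows "unital_algebra K (nij_operators K A N)"
    and "nij_emb K A N \<in> algebra_hom K A (nij_operators K A N)"
    and "nij_Q K A N \<in> carrier (nij_operators K A N)"
    and "a \<in> carrier A \<Longrightarrow>
      nij_Q K A N \<otimes>\<^bsub>nij_operators K A N\<^esub> nij_emb K A N a \<otimes>\<^bsub>nij_operators K A N\<^esub> nij_Q K A N =
      (nij_emb K A N (N a) \<otimes>\<^bsub>nij_operators K A N\<^esub> nij_Q K A N
        \<ominus>\<^bsub>nij_operators K A N\<^esub> nij_Q K A N \<otimes>\<^bsub>nij_operators K A N\<^esub> nij_emb K A N (N a))
      \<oplus>\<^bsub>nij_operators K A N\<^esub> (nij_Q K A N \<otimes>\<^bsub>nij_operators K A N\<^esub> nij_Q K A N) \<otimes>\<^bsub>nij_operators K A N\<^esub> nij_emb K A N a"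
proof -
  have A: "unital_algebra K A" and Nc: "\<And>a. a \<in> carrier A \<Longrightarrow> N a \<in> carrier A"
    using assms by (auto simp: nijenhuis_algebra_def linear_endo_def)
  interpret A: unital_algebra K A by fact
  interpret UPK: UP_cring K "UP K" by unfold_locales simp
  note fp = free_product_unital_algebra[OF A A.UP_unital_algebra]
  let ?P = "nij_free K A" and ?i = "nij_free_emb K A" and ?q = "nij_free_Q K A"
  let ?I = "nij_ideal K A N" and ?U = "nij_operators K A N" and ?e = "nij_emb K A N" and ?Q = "nij_Q K A N"
  interpret P: unital_algebra K ?P using fp(1) by (simp add: nij_free_def)
  have i: "?i \<in> algebra_hom K A ?P"
    using fp(2) by (simp add: nij_free_def nij_free_emb_def[abs_def])
  have ic: "?i a \<in> carrier ?P" if "a \<in> carrier A" for a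
    using i that by (auto simp: algebra_hom_def ring_hom_def)
  have q: "?q \<in> carrier ?P"
    using fp(3) by (auto simp: nij_free_def nij_free_Q_def algebra_hom_def ring_hom_def)
  let ?f = "\<lambda>a. ((?q \<otimes>\<^bsub>?P\<^esub> ?i a \<otimes>\<^bsub>?P\<^esub> ?q \<ominus>\<^bsub>?P\<^esub> ?i (N a) \<otimes>\<^bsub>?P\<^esub> ?q) \<oplus>\<^bsub>?P\<^esub> ?q \<otimes>\<^bsub>?P\<^esub> ?i (N a))
                \<ominus>\<^bsub>?P\<^esub> (?q \<otimes>\<^bsub>?P\<^esub> ?q) \<otimes>\<^bsub>?P\<^esub> ?i a"
  have sub: "{?f a | a. a \<in> carrier A} \<subseteq> carrier ?P"
    using ic q Nc by auto
  have I: "ideal ?I ?P" and RI: "{?f a | a. a \<in> carrier A} \<subseteq> ?I"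
    using P.genideal_ideal[OF sub] P.genideal_self[OF sub] by (simp_all add: nij_ideal_def Let_def)
  have pi: "(\<lambda>x. ?I +>\<^bsub>?P\<^esub> x) \<in> algebra_hom K ?P ?U" 
    and U: "unital_algebra K ?U"
    using P.quotient_unital_algebra[OF I] by (simp_all add: nij_operators_def)
  then have pir: "(\<lambda>x. ?I +>\<^bsub>?P\<^esub> x) \<in> ring_hom ?P ?U" by (simp add: algebra_hom_def)
  interpret U: unital_algebra K ?U by (rule U)
  show "unital_algebra K ?U" by (rule U)
  show "?Q \<in> carrier ?U" using ring_hom_closed[OF pir q] by (simp add: nij_Q_def)
  show "?e \<in> algebra_hom K A ?U"
    using i pi ic unfolding algebra_hom_def ring_hom_def nij_emb_def[abs_def] by (auto simp: Pi_def)
  assume a: "a \<in> carrier A"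
  have Qc: "?Q \<in> carrier ?U" and ec: "?e a \<in> carrier ?U" "?e (N a) \<in> carrier ?U"
    using ring_hom_closed[OF pir] q ic[OF a] ic[OF Nc[OF a]] by (simp_all add: nij_Q_def nij_emb_def)
  have "?q \<otimes>\<^bsub>?P\<^esub> ?i a \<otimes>\<^bsub>?P\<^esub> ?q \<ominus>\<^bsub>?P\<^esub> 
     ((?i (N a) \<otimes>\<^bsub>?P\<^esub> ?q \<ominus>\<^bsub>?P\<^esub> ?q \<otimes>\<^bsub>?P\<^esub> ?i (N a)) \<oplus>\<^bsub>?P\<^esub> (?q \<otimes>\<^bsub>?P\<^esub> ?q) \<otimes>\<^bsub>?P\<^esub> ?i a) = ?f a"
    using q ic[OF a] ic[OF Nc[OF a]] 
    by (simp add: a_minus_def P.minus_add P.a_ac)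
  then have "?q \<otimes>\<^bsub>?P\<^esub> ?i a \<otimes>\<^bsub>?P\<^esub> ?q \<ominus>\<^bsub>?P\<^esub> 
     ((?i (N a) \<otimes>\<^bsub>?P\<^esub> ?q \<ominus>\<^bsub>?P\<^esub> ?q \<otimes>\<^bsub>?P\<^esub> ?i (N a)) \<oplus>\<^bsub>?P\<^esub> (?q \<otimes>\<^bsub>?P\<^esub> ?q) \<otimes>\<^bsub>?P\<^esub> ?i a) \<in> ?I"
    using RI a by auto
  then have eq: "?I +>\<^bsub>?P\<^esub> (?q \<otimes>\<^bsub>?P\<^esub> ?i a \<otimes>\<^bsub>?P\<^esub> ?q) = ?I +>\<^bsub>?P\<^esub>
     ((?i (N a) \<otimes>\<^bsub>?P\<^esub> ?q \<ominus>\<^bsub>?P\<^esub> ?q \<otimes>\<^bsub>?P\<^esub> ?i (N a)) \<oplus>\<^bsub>?P\<^esub> (?q \<otimes>\<^bsub>?P\<^esub> ?q) \<otimes>\<^bsub>?P\<^esub> ?i a)"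
    using q ic[OF a] ic[OF Nc[OF a]] P.quotient_eq_iff_same_a_r_cos[OF I] by auto
  interpret h: ring_hom_ring ?P ?U "\<lambda>x. ?I +>\<^bsub>?P\<^esub> x"
    by (rule ring_hom_ringI2[OF P.ring_axioms U.ring_axioms pir])
  show "?Q \<otimes>\<^bsub>?U\<^esub> ?e a \<otimes>\<^bsub>?U\<^esub> ?Q = (?e (N a) \<otimes>\<^bsub>?U\<^esub> ?Q \<ominus>\<^bsub>?U\<^esub> ?Q \<otimes>\<^bsub>?U\<^esub> ?e (N a))
      \<oplus>\<^bsub>?U\<^esub> (?Q \<otimes>\<^bsub>?U\<^esub> ?Q) \<otimes>\<^bsub>?U\<^esub> ?e a"
    using eq q ic[OF a] ic[OF Nc[OF a]] by (simp add: nij_Q_def nij_emb_def a_minus_def)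
qed

end

theory Submission
  imports Defs
begin

text \<open>
  Write \<open>U\<close> for the ring of Nijenhuis operators and suppress the embedding of \<open>A\<close>. Induction on the
  defining relation gives
    \<open>Q\<^sup>n a Q\<^sup>m = N\<^sup>n(a) Q\<^sup>m - Q\<^sup>m N\<^sup>n(a) + Q\<^sup>m\<^sup>+\<^sup>n a\<close>
  (\<open>Q_pow_emb_Q_pow\<close>), hence the multiplication rule. The case \<open>n = 1\<close> also shows that the sum of
  all \<open>A Q\<^sup>i A\<close> is stable under left multiplication by \<open>A\<close> and \<open>Q\<close>, which generate \<open>U\<close>; as it
  contains \<open>1\<close>, it is all of \<open>U\<close> (\<open>S_sums_eq\<close>).

  The substance is that the sum is direct: one has to know that the defining ideals are not too large.
  The classical way is to build the expected algebra on a normal form, a tensor product for each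
  power of \<open>Q\<close>. The relation for \<open>a = 1\<close> says that \<open>N(1)\<close> commutes with \<open>Q\<close>, so the
  normal form of \<open>A Q\<^sup>i A\<close> is the tensor product of \<open>A\<close> with itself over \<open>K[N(1)]\<close>. Tensor
  products are avoided here by passing to the dual picture. For a \<open>K\<close>-module \<open>W\<close> let \<open>G\<close> be the
  module of families \<open>f i a b\<close>, the values on \<open>a Q\<^sup>i b\<close> of a linear map from the normal forms
  to \<open>W\<close>: they are bilinear in \<open>a, b\<close>, balanced over \<open>N(1)\<close>, and \<open>f 0 a b\<close> depends on the product
  \<open>a b\<close> only. The algebra \<open>U\<close> has to act on \<open>G\<close> from the right by \<open>(f \<cdot> u)(x) = f(u x)\<close>, and the
  commutation rule dictates the formulas for the action of \<open>A\<close> and of \<open>Q\<close>. That these operators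
  satisfy the defining relation is the Nijenhuis identity (\<open>fQ_relation\<close>), so the universal property
  of \<open>U\<close> (\<open>nij_operators_lift\<close>) turns them into a representation. Evaluating \<open>f \<cdot> u\<close> at the unit
  yields a linear map on \<open>U\<close> that takes the value \<open>f n a b\<close> at \<open>a Q\<^sup>n b\<close> (\<open>functional_evaluation\<close>):
  every family in \<open>G\<close> is realised by a linear map on \<open>U\<close>.

  With \<open>W = U\<close> and the family \<open>f n a b = a Q\<^sup>n b\<close> for \<open>n = i\<close>, zero otherwise, this linear map is the
  identity on \<open>A Q\<^sup>i A\<close> and kills all other summands (\<open>summand_projection\<close>), so the components
  of an element are determined by it. Finally \<open>A\<close> embeds into \<open>U\<close> because \<open>Q \<mapsto> 0\<close> defines
  a retraction.
\<close>

section \<open>Subalgebras and generation\<close>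

definition unital_subalgebra ::
    "('k, 'r) ring_scheme \<Rightarrow> ('k, 'b, 'm) module_scheme \<Rightarrow> 'b set \<Rightarrow> bool"
  where "unital_subalgebra K B H \<longleftrightarrow> H \<subseteq> carrier B \<and> \<one>\<^bsub>B\<^esub> \<in> H \<and>
    (\<forall>x\<in>H. \<forall>y\<in>H. x \<oplus>\<^bsub>B\<^esub> y \<in> H \<and> x \<otimes>\<^bsub>B\<^esub> y \<in> H) \<and> (\<forall>c\<in>carrier K. \<forall>x\<in>H. c \<odot>\<^bsub>B\<^esub> x \<in> H)"

lemma algebra_homD:
  assumes "h \<in> algebra_hom K A B"
  shows "x \<in> carrier A \<Longrightarrow> h x \<in> carrier B"
    and "\<lbrakk>x \<in> carrier A; y \<in> carrier A\<rbrakk> \<Longrightarrow> h (x \<oplus>\<^bsub>A\<^esub> y) = h x \<oplus>\<^bsub>B\<^esub> h y"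
    and "\<lbrakk>x \<in> carrier A; y \<in> carrier A\<rbrakk> \<Longrightarrow> h (x \<otimes>\<^bsub>A\<^esub> y) = h x \<otimes>\<^bsub>B\<^esub> h y"
    and "h \<one>\<^bsub>A\<^esub> = \<one>\<^bsub>B\<^esub>"
    and "\<lbrakk>c \<in> carrier K; x \<in> carrier A\<rbrakk> \<Longrightarrow> h (c \<odot>\<^bsub>A\<^esub> x) = c \<odot>\<^bsub>B\<^esub> h x"
  using assms by (auto simp: algebra_hom_def ring_hom_def)

lemma algebra_hom_ring_hom_ring:
  assumes "unital_algebra K A" "unital_algebra K B" "h \<in> algebra_hom K A B"
  shows "ring_hom_ring A B h"
  using assms by (auto intro!: ring_hom_ringI2 simp: algebra_hom_def unital_algebra_def)

lemma algebra_hom_id: "(\<lambda>x. x) \<in> algebra_hom K A A"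
  by (simp add: algebra_hom_def ring_hom_def)

lemma unital_subalgebra_vimage:
  assumes A: "unital_algebra K A" and h: "h \<in> algebra_hom K A B" and H: "unital_subalgebra K B H"
  shows "unital_subalgebra K A {x \<in> carrier A. h x \<in> H}"
proof -
  interpret A: unital_algebra K A by (rule A)
  show ?thesis using H algebra_homD[OF h] by (simp add: unital_subalgebra_def)
qed

lemma (in unital_algebra) unital_subalgebra_zero:
  assumes "unital_subalgebra R M H" shows "\<zero>\<^bsub>M\<^esub> \<in> H"
  using assms by (metis R.zero_closed one_closed smult_l_null unital_subalgebra_def)

text \<open>
  Left multiplication by a letter prepends it to every word. This is the only convolution that has
  to be computed, because multiplicativity of maps is always reduced to generators.
\<close>

lemma free_gen_mult:
  fixes K (structure)
  assumes "cring K" and g: "g \<in> carrier (free_algebra K S)"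
  shows "(free_gen K x \<otimes>\<^bsub>free_algebra K S\<^esub> g) w =
    (case w of [] \<Rightarrow> \<zero> | y # v \<Rightarrow> if y = x then g v else \<zero>)"
proof -
  interpret cring K by fact
  have c: "g w \<in> carrier K" for w using g by (simp add: free_algebra_simps)
  show ?thesis
  proof (cases w)
    case Nil
    then show ?thesis using c by (simp add: free_algebra_simps free_gen_def)
  next
    case (Cons y v)
    have "(free_gen K x \<otimes>\<^bsub>free_algebra K S\<^esub> g) w =
        (\<Oplus>i\<in>{..length w}. if i = 1 then (if y = x then g v else \<zero>) else \<zero>)"
      unfolding free_algebra_simps
      by (rule finsum_cong') (auto simp: c free_gen_def Cons take_Cons' drop_Cons')
    also have "\<dots> = (if y = x then g v else \<zero>)"
      using add.finprod_singleton_swap[of 1 "{..length w}" "\<lambda>_. if y = x then g v else \<zero>"] c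
      by (simp add: Pi_def Cons)
    finally show ?thesis using Cons by simp
  qed
qed

definition word_mon :: "('k, 'r) ring_scheme \<Rightarrow> 'x list \<Rightarrow> 'x list \<Rightarrow> 'k"
  where "word_mon K u = (\<lambda>w. if w = u then \<one>\<^bsub>K\<^esub> else \<zero>\<^bsub>K\<^esub>)"

lemma word_mon_closed:
  assumes "cring K" "set u \<subseteq> S" shows "word_mon K u \<in> carrier (free_algebra K S)"
proof -
  interpret cring K by fact
  show ?thesis using assms(2)
    by (auto simp: word_mon_def free_algebra_simps intro: finite_subset[of _ "{u}"])
qed

lemma word_mon_Cons:
  assumes "cring K" "set u \<subseteq> S"
  shows "word_mon K (x # u) = free_gen K x \<otimes>\<^bsub>free_algebra K S\<^esub> word_mon K u"
  by (rule ext) (auto simp: free_gen_mult[OF assms(1) word_mon_closed[OF assms]] split: list.split,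
      auto simp: word_mon_def)

lemma free_algebra_generated:
  fixes K (structure)
  assumes K: "cring K" and H: "unital_subalgebra K (free_algebra K S) H"
    and gen: "\<And>x. x \<in> S \<Longrightarrow> free_gen K x \<in> H"
  shows "H = carrier (free_algebra K S)"
proof
  interpret cring K by fact
  let ?F = "free_algebra K S"
  interpret F: unital_algebra K ?F by (rule free_algebra_unital_algebra)
  show "H \<subseteq> carrier ?F" using H by (simp add: unital_subalgebra_def)
  have mon: "word_mon K u \<in> H" if "set u \<subseteq> S" for u
    using that
  proof (induction u)
    case Nil
    have "word_mon K [] = \<one>\<^bsub>?F\<^esub>" by (simp add: word_mon_def free_algebra_simps)
    then show ?case using H by (simp add: unital_subalgebra_def)
  next
    case (Cons x u)
    then show ?case using H gen by (simp add: word_mon_Cons[OF K, of _ S] unital_subalgebra_def)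
  qed
  have *: "f \<in> H" if "finite T" "f \<in> carrier ?F" "{w. f w \<noteq> \<zero>} \<subseteq> T" for T f
    using that
  proof (induction T arbitrary: f rule: finite_induct)
    case empty
    then have "f = \<zero>\<^bsub>?F\<^esub>" by (auto simp: free_algebra_simps)
    then show ?case using F.unital_subalgebra_zero[OF H] by simp
  next
    case (insert u T)
    show ?case
    proof (cases "f u = \<zero>")
      case True
      then show ?thesis using insert by blast
    next
      case False
      define g where "g = f(u := \<zero>)"
      have c: "f w \<in> carrier K" for w using insert.prems by (simp add: free_algebra_simps)
      have u: "set u \<subseteq> S" using insert.prems False by (simp add: free_algebra_simps)
      have "finite {w. g w \<noteq> \<zero>}"
        using insert.prems(1) by (rule_tac finite_subset[of _ "{w. f w \<noteq> \<zero>}"]) (auto simp: free_algebra_simps g_def)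
      then have "g \<in> carrier ?F" using insert.prems(1) by (simp add: free_algebra_simps g_def)
      moreover have "{w. g w \<noteq> \<zero>} \<subseteq> T" using insert.prems(2) by (auto simp: g_def)
      ultimately have "g \<in> H" by (rule insert.IH)
      moreover have "f u \<odot>\<^bsub>?F\<^esub> word_mon K u \<in> H"
        using H mon[OF u] c by (simp add: unital_subalgebra_def)
      moreover have "f = g \<oplus>\<^bsub>?F\<^esub> (f u \<odot>\<^bsub>?F\<^esub> word_mon K u)"
        using c by (auto simp: free_algebra_simps word_mon_def g_def)
      ultimately show ?thesis using H by (metis unital_subalgebra_def)
    qed
  qed
  show "carrier ?F \<subseteq> H" using * by (auto simp: free_algebra_simps)
qed

text \<open>
  Together with \<open>free_algebra_generated\<close> this is an induction principle: a property of elements that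
  cuts out a unital subalgebra only has to be checked on generators.
\<close>

lemma UP_generated:
  fixes K (structure)
  assumes K: "cring K" and H: "unital_subalgebra K (UP K) H" and X: "monom (UP K) \<one> 1 \<in> H"
  shows "H = carrier (UP K)"
proof
  interpret cring K by fact
  interpret UPK: UP_cring K "UP K" by unfold_locales simp
  interpret P: unital_algebra K "UP K" by (rule UP_unital_algebra)
  show "H \<subseteq> carrier (UP K)" using H by (simp add: unital_subalgebra_def)
  have pow: "monom (UP K) \<one> n \<in> H" for n
  proof (induction n)
    case 0 show ?case using H by (simp add: unital_subalgebra_def)
  next
    case (Suc n)
    then show ?case using H X unfolding UPK.monom_one_Suc[of n] by (simp add: unital_subalgebra_def)
  qed
  have mon: "monom (UP K) c n \<in> H" if "c \<in> carrier K" for c n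
    using UPK.monom_mult_smult[OF that, of \<one> n] that H pow by (simp add: unital_subalgebra_def)
  show "carrier (UP K) \<subseteq> H"
  proof
    fix p assume p: "p \<in> carrier (UP K)"
    have "(\<Oplus>\<^bsub>UP K\<^esub>i\<in>{..n}. monom (UP K) (coeff (UP K) p i) i) \<in> H" for n
    proof (induction n)
      case 0 show ?case using p mon by (simp add: Pi_def)
    next
      case (Suc n)
      then show ?case using p mon H by (simp add: Pi_def unital_subalgebra_def)
    qed
    then show "p \<in> H" using UPK.up_repr[OF p] by metis
  qed
qed

section \<open>Universal properties\<close>

lemma (in module) finsum_smult_rdistr:
  "\<lbrakk>finite T; c \<in> carrier R; f \<in> T \<rightarrow> carrier M\<rbrakk> \<Longrightarrow>
    c \<odot>\<^bsub>M\<^esub> (\<Oplus>\<^bsub>M\<^esub>i\<in>T. f i) = (\<Oplus>\<^bsub>M\<^esub>i\<in>T. c \<odot>\<^bsub>M\<^esub> f i)"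
  by (induction T rule: finite_induct) (auto simp: smult_r_distr Pi_def)

text \<open>
  The linear extension \<open>\<Phi>\<close> of the evaluation of words is multiplicative because the \<open>f\<close> with
  \<open>\<Phi> (f g) = \<Phi> f \<Phi> g\<close> for all \<open>g\<close> form a unital subalgebra, which contains the letters.
\<close>

lemma free_algebra_lift:
  fixes K (structure)
  assumes E: "unital_algebra K E" and j: "j \<in> S \<rightarrow> carrier E"
  shows "\<exists>\<Phi>\<in>algebra_hom K (free_algebra K S) E. \<forall>x\<in>S. \<Phi> (free_gen K x) = j x"
proof -
  interpret E: unital_algebra K E by (rule E)
  let ?F = "free_algebra K S"
  interpret F: unital_algebra K ?F by (rule E.free_algebra_unital_algebra)
  note K = E.R.is_cring
  \<comment> \<open>Letters outside \<open>S\<close> never contribute; sending them to zero keeps all word values in \<open>E\<close>.\<close>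
  define P where "P w = foldr (\<lambda>x e. (if x \<in> S then j x else \<zero>\<^bsub>E\<^esub>) \<otimes>\<^bsub>E\<^esub> e) w \<one>\<^bsub>E\<^esub>" for w
  have P0: "P [] = \<one>\<^bsub>E\<^esub>" and P1: "x \<in> S \<Longrightarrow> P (x # w) = j x \<otimes>\<^bsub>E\<^esub> P w" for x w
    by (simp_all add: P_def)
  have Pc: "P w \<in> carrier E" for w
    unfolding P_def using j by (induction w) (auto simp: Pi_def)
  define \<Phi> where "\<Phi> f = (\<Oplus>\<^bsub>E\<^esub>w\<in>{w. f w \<noteq> \<zero>}. f w \<odot>\<^bsub>E\<^esub> P w)" for f
  have c: "f w \<in> carrier K" if "f \<in> carrier ?F" for f w using that by (simp add: free_algebra_simps)
  have fin: "finite {w. f w \<noteq> \<zero>}" if "f \<in> carrier ?F" for f using that by (simp add: free_algebra_simps)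
  have term_closed: "f w \<odot>\<^bsub>E\<^esub> P w \<in> carrier E" if "f \<in> carrier ?F" for f w using c[OF that] Pc by simp
  have \<Phi>: "\<Phi> f = (\<Oplus>\<^bsub>E\<^esub>w\<in>T. f w \<odot>\<^bsub>E\<^esub> P w)"
    if "f \<in> carrier ?F" "finite T" "{w. f w \<noteq> \<zero>} \<subseteq> T" for f T
    unfolding \<Phi>_def using that Pc c
    by (intro E.M.add.finprod_mono_neutral_cong_left) (auto simp: E.smult_l_null)
  have \<Phi>c: "\<Phi> f \<in> carrier E" if "f \<in> carrier ?F" for f
    unfolding \<Phi>_def using term_closed[OF that] by (auto intro!: E.M.finsum_closed)
  have add: "\<Phi> (f \<oplus>\<^bsub>?F\<^esub> g) = \<Phi> f \<oplus>\<^bsub>E\<^esub> \<Phi> g" if fg: "f \<in> carrier ?F" "g \<in> carrier ?F" for f g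
  proof -
    let ?T = "{w. f w \<noteq> \<zero>} \<union> {w. g w \<noteq> \<zero>}"
    have T: "finite ?T" using fin fg by blast
    have "{w. (f \<oplus>\<^bsub>?F\<^esub> g) w \<noteq> \<zero>} \<subseteq> ?T" by (auto simp: free_algebra_simps)
    then have "\<Phi> (f \<oplus>\<^bsub>?F\<^esub> g) = (\<Oplus>\<^bsub>E\<^esub>w\<in>?T. (f \<oplus>\<^bsub>?F\<^esub> g) w \<odot>\<^bsub>E\<^esub> P w)"
      by (rule \<Phi>[OF F.a_closed[OF fg] T])
    also have "\<dots> = (\<Oplus>\<^bsub>E\<^esub>w\<in>?T. f w \<odot>\<^bsub>E\<^esub> P w \<oplus>\<^bsub>E\<^esub> g w \<odot>\<^bsub>E\<^esub> P w)"
      using fg c Pc by (simp add: free_algebra_simps(5) E.smult_l_distr)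
    also have "\<dots> = \<Phi> f \<oplus>\<^bsub>E\<^esub> \<Phi> g"
      using fg T term_closed \<Phi>[of f ?T] \<Phi>[of g ?T] by (simp add: E.M.finsum_addf Pi_def)
    finally show ?thesis .
  qed
  have smult: "\<Phi> (a \<odot>\<^bsub>?F\<^esub> f) = a \<odot>\<^bsub>E\<^esub> \<Phi> f" if af: "a \<in> carrier K" "f \<in> carrier ?F" for a f
  proof -
    let ?T = "{w. f w \<noteq> \<zero>}"
    have "{w. (a \<odot>\<^bsub>?F\<^esub> f) w \<noteq> \<zero>} \<subseteq> ?T" using af by (auto simp: free_algebra_simps)
    then have "\<Phi> (a \<odot>\<^bsub>?F\<^esub> f) = (\<Oplus>\<^bsub>E\<^esub>w\<in>?T. (a \<odot>\<^bsub>?F\<^esub> f) w \<odot>\<^bsub>E\<^esub> P w)"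
      by (rule \<Phi>[OF F.smult_closed[OF af] fin[OF af(2)]])
    also have "\<dots> = (\<Oplus>\<^bsub>E\<^esub>w\<in>?T. a \<odot>\<^bsub>E\<^esub> (f w \<odot>\<^bsub>E\<^esub> P w))"
      using af c Pc by (simp add: free_algebra_simps(6) E.smult_assoc1)
    also have "\<dots> = a \<odot>\<^bsub>E\<^esub> \<Phi> f"
      unfolding \<Phi>_def using af term_closed fin by (intro E.finsum_smult_rdistr[symmetric]) auto
    finally show ?thesis .
  qed
  have one: "\<Phi> \<one>\<^bsub>?F\<^esub> = \<one>\<^bsub>E\<^esub>"
  proof -
    have "{w. \<one>\<^bsub>?F\<^esub> w \<noteq> \<zero>} \<subseteq> {[]}" by (auto simp: free_algebra_simps(3))
    then have "\<Phi> \<one>\<^bsub>?F\<^esub> = (\<Oplus>\<^bsub>E\<^esub>w\<in>{[]}. \<one>\<^bsub>?F\<^esub> w \<odot>\<^bsub>E\<^esub> P w)"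
      by (intro \<Phi>[OF F.one_closed]) auto
    then show ?thesis by (simp add: free_algebra_simps(3) P0)
  qed
  have gen: "\<Phi> (free_gen K x \<otimes>\<^bsub>?F\<^esub> g) = j x \<otimes>\<^bsub>E\<^esub> \<Phi> g" if x: "x \<in> S" and g: "g \<in> carrier ?F" for x g
  proof -
    let ?G = "{w. g w \<noteq> \<zero>}"
    have xc: "free_gen K x \<in> carrier ?F" by (rule E.R.free_gen_closed[OF x])
    have jx: "j x \<in> carrier E" using j x by blast
    note m = free_gen_mult[OF K g, of x]
    have "{w. (free_gen K x \<otimes>\<^bsub>?F\<^esub> g) w \<noteq> \<zero>} \<subseteq> Cons x ` ?G"
    proof
      fix w assume "w \<in> {w. (free_gen K x \<otimes>\<^bsub>?F\<^esub> g) w \<noteq> \<zero>}"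
      then show "w \<in> Cons x ` ?G" by (cases w) (auto simp: m split: if_splits)
    qed
    then have "\<Phi> (free_gen K x \<otimes>\<^bsub>?F\<^esub> g) =
        (\<Oplus>\<^bsub>E\<^esub>w\<in>Cons x ` ?G. (free_gen K x \<otimes>\<^bsub>?F\<^esub> g) w \<odot>\<^bsub>E\<^esub> P w)"
      using xc g fin by (intro \<Phi>) auto
    also have "\<dots> = (\<Oplus>\<^bsub>E\<^esub>v\<in>?G. (free_gen K x \<otimes>\<^bsub>?F\<^esub> g) (x # v) \<odot>\<^bsub>E\<^esub> P (x # v))"
      using term_closed[OF F.m_closed[OF xc g]] by (intro E.M.finsum_reindex) auto
    also have "\<dots> = (\<Oplus>\<^bsub>E\<^esub>v\<in>?G. j x \<otimes>\<^bsub>E\<^esub> (g v \<odot>\<^bsub>E\<^esub> P v))"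
      using jx c[OF g] Pc by (intro E.M.finsum_cong') (auto simp: m P1[OF x] E.smult_mult_right)
    also have "\<dots> = j x \<otimes>\<^bsub>E\<^esub> \<Phi> g"
      unfolding \<Phi>_def using jx term_closed[OF g] fin[OF g] by (intro E.finsum_rdistr[symmetric]) auto
    finally show ?thesis .
  qed
  have sub: "unital_subalgebra K ?F {f \<in> carrier ?F. \<forall>g\<in>carrier ?F. \<Phi> (f \<otimes>\<^bsub>?F\<^esub> g) = \<Phi> f \<otimes>\<^bsub>E\<^esub> \<Phi> g}"
    unfolding unital_subalgebra_def
    by (auto simp: one add smult \<Phi>c F.l_distr E.l_distr F.smult_mult_left E.smult_mult_left
        F.m_assoc E.m_assoc)
  have gen1: "\<Phi> (free_gen K x) = j x" if x: "x \<in> S" for x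
    using gen[OF x F.one_closed] one j x E.R.free_gen_closed[OF x] by (auto simp: Pi_def)
  have "{f \<in> carrier ?F. \<forall>g\<in>carrier ?F. \<Phi> (f \<otimes>\<^bsub>?F\<^esub> g) = \<Phi> f \<otimes>\<^bsub>E\<^esub> \<Phi> g} = carrier ?F"
    by (rule free_algebra_generated[OF K sub]) (simp add: gen gen1 E.R.free_gen_closed)
  then have "\<Phi> \<in> algebra_hom K ?F E"
    by (auto simp: algebra_hom_def ring_hom_def one add smult \<Phi>c)
  then show ?thesis using gen1 by blast
qed

text \<open>
  The target need not be commutative, so this is not an instance of the evaluation homomorphisms of
  \<^theory>\<open>HOL-Algebra.UnivPoly\<close>. The argument is the one for \<open>free_algebra_lift\<close>.
\<close>

lemma UP_lift:
  fixes K (structure)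
  assumes E: "unital_algebra K E" and q: "q \<in> carrier E"
  shows "\<exists>\<Phi>\<in>algebra_hom K (UP K) E. \<Phi> (monom (UP K) \<one> 1) = q"
proof -
  interpret E: unital_algebra K E by (rule E)
  interpret P: unital_algebra K "UP K" by (rule E.R.UP_unital_algebra)
  interpret UPK: UP_cring K "UP K" by unfold_locales simp
  note K = E.R.is_cring
  let ?c = "coeff (UP K)"
  let ?X = "monom (UP K) \<one> 1"
  define S where "S n p = (\<Oplus>\<^bsub>E\<^esub>i\<in>{..n}. ?c p i \<odot>\<^bsub>E\<^esub> q [^]\<^bsub>E\<^esub> i)" for n p
  define \<Phi> where "\<Phi> p = S (deg K p) p" for p
  have term_closed: "?c p i \<odot>\<^bsub>E\<^esub> q [^]\<^bsub>E\<^esub> (i::nat) \<in> carrier E" if "p \<in> carrier (UP K)" for p i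
    using that q by simp
  have \<Phi>: "\<Phi> p = S n p" if "p \<in> carrier (UP K)" "deg K p \<le> n" for p n
    unfolding \<Phi>_def S_def using that q term_closed
    by (intro E.M.add.finprod_mono_neutral_cong_left) (auto simp: UPK.deg_aboveD E.smult_l_null)
  have \<Phi>c: "\<Phi> p \<in> carrier E" if "p \<in> carrier (UP K)" for p
    unfolding \<Phi>_def S_def using term_closed[OF that] by (auto intro!: E.M.finsum_closed)
  have add: "\<Phi> (f \<oplus>\<^bsub>UP K\<^esub> g) = \<Phi> f \<oplus>\<^bsub>E\<^esub> \<Phi> g"
    if fg: "f \<in> carrier (UP K)" "g \<in> carrier (UP K)" for f g
  proof -
    let ?n = "max (deg K f) (deg K g)"
    have "S ?n (f \<oplus>\<^bsub>UP K\<^esub> g) = S ?n f \<oplus>\<^bsub>E\<^esub> S ?n g"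
      using fg term_closed q unfolding S_def by (simp add: E.smult_l_distr E.M.finsum_addf Pi_def)
    then show ?thesis using fg UPK.deg_add[OF fg] by (simp add: \<Phi>[of _ ?n])
  qed
  have smult: "\<Phi> (a \<odot>\<^bsub>UP K\<^esub> f) = a \<odot>\<^bsub>E\<^esub> \<Phi> f" if af: "a \<in> carrier K" "f \<in> carrier (UP K)" for a f
  proof -
    have "S (deg K f) (a \<odot>\<^bsub>UP K\<^esub> f) = a \<odot>\<^bsub>E\<^esub> S (deg K f) f"
      using af term_closed[OF af(2)] q unfolding S_def
      by (simp add: E.finsum_smult_rdistr E.smult_assoc1 Pi_def)
    then show ?thesis using af UPK.deg_smult_decr[OF af] by (simp add: \<Phi>[of _ "deg K f"])
  qed
  have one: "\<Phi> \<one>\<^bsub>UP K\<^esub> = \<one>\<^bsub>E\<^esub>"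
    using q by (simp add: \<Phi>[of _ 0] S_def)
  have coeffX: "?c (?X \<otimes>\<^bsub>UP K\<^esub> g) i = (case i of 0 \<Rightarrow> \<zero> | Suc k \<Rightarrow> ?c g k)"
    if g: "g \<in> carrier (UP K)" for g i
  proof (cases i)
    case 0
    then show ?thesis using g by simp
  next
    case (Suc k)
    then show ?thesis using UPK.coeff_monom_mult[OF E.R.one_closed g, of 1 k] g by simp
  qed
  have gen: "\<Phi> (?X \<otimes>\<^bsub>UP K\<^esub> g) = q \<otimes>\<^bsub>E\<^esub> \<Phi> g" if g: "g \<in> carrier (UP K)" for g
  proof -
    let ?n = "deg K g"
    have pow_comm: "q [^]\<^bsub>E\<^esub> (i::nat) \<otimes>\<^bsub>E\<^esub> q = q \<otimes>\<^bsub>E\<^esub> q [^]\<^bsub>E\<^esub> i" for i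
      by (metis E.nat_pow_Suc E.nat_pow_Suc2 q)
    have Xg: "?X \<otimes>\<^bsub>UP K\<^esub> g \<in> carrier (UP K)" using g by simp
    have "deg K (?X \<otimes>\<^bsub>UP K\<^esub> g) \<le> Suc ?n"
      using g by (intro UPK.deg_aboveI) (auto simp: coeffX[unfolded One_nat_def] UPK.deg_aboveD simp del: UPK.coeff_mult split: nat.split)
    then have "\<Phi> (?X \<otimes>\<^bsub>UP K\<^esub> g) = S (Suc ?n) (?X \<otimes>\<^bsub>UP K\<^esub> g)" by (rule \<Phi>[OF Xg])
    also have "\<dots> = (\<Oplus>\<^bsub>E\<^esub>i\<in>{..?n}. ?c g i \<odot>\<^bsub>E\<^esub> q [^]\<^bsub>E\<^esub> Suc i)"
      unfolding S_def using term_closed[OF Xg] g q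
      by (subst E.M.finsum_Suc2) (auto simp: coeffX[unfolded One_nat_def] E.smult_l_null Pi_def simp del: E.nat_pow_Suc UPK.coeff_mult)
    also have "\<dots> = (\<Oplus>\<^bsub>E\<^esub>i\<in>{..?n}. q \<otimes>\<^bsub>E\<^esub> (?c g i \<odot>\<^bsub>E\<^esub> q [^]\<^bsub>E\<^esub> i))"
      using g q by (intro E.M.finsum_cong') (auto simp: E.smult_mult_right pow_comm)
    also have "\<dots> = q \<otimes>\<^bsub>E\<^esub> \<Phi> g"
      unfolding \<Phi>_def S_def using q term_closed[OF g] by (intro E.finsum_rdistr[symmetric]) auto
    finally show ?thesis .
  qed
  have sub: "unital_subalgebra K (UP K)
      {f \<in> carrier (UP K). \<forall>g\<in>carrier (UP K). \<Phi> (f \<otimes>\<^bsub>UP K\<^esub> g) = \<Phi> f \<otimes>\<^bsub>E\<^esub> \<Phi> g}"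
    unfolding unital_subalgebra_def
    by (auto simp: one add smult \<Phi>c P.l_distr E.l_distr P.smult_mult_left E.smult_mult_left
        P.m_assoc E.m_assoc)
  have X: "?X \<in> carrier (UP K)" by simp
  have gen1: "\<Phi> ?X = q" using gen[OF P.one_closed] P.r_one[OF X] E.r_one[OF q] by (simp only: one)
  have "{f \<in> carrier (UP K). \<forall>g\<in>carrier (UP K). \<Phi> (f \<otimes>\<^bsub>UP K\<^esub> g) = \<Phi> f \<otimes>\<^bsub>E\<^esub> \<Phi> g} = carrier (UP K)"
    by (rule UP_generated[OF K sub]) (use X gen gen1 in blast)
  then have "\<Phi> \<in> algebra_hom K (UP K) E"
    by (auto simp: algebra_hom_def ring_hom_def one add smult \<Phi>c)
  then show ?thesis using gen1 by blast
qed

lemma quotient_algebra_lift: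
  assumes M: "unital_algebra K M" and E: "unital_algebra K E" and \<Phi>: "\<Phi> \<in> algebra_hom K M E"
    and X: "X \<subseteq> carrier M" and X0: "\<And>x. x \<in> X \<Longrightarrow> \<Phi> x = \<zero>\<^bsub>E\<^esub>"
  shows "\<exists>\<Psi>\<in>algebra_hom K (quotient_algebra M (Idl\<^bsub>M\<^esub> X)) E.
    \<forall>x\<in>carrier M. \<Psi> (Idl\<^bsub>M\<^esub> X +>\<^bsub>M\<^esub> x) = \<Phi> x"
proof -
  interpret M: unital_algebra K M by (rule M)
  interpret E: unital_algebra K E by (rule E)
  interpret h: ring_hom_ring M E \<Phi> by (rule algebra_hom_ring_hom_ring[OF M E \<Phi>])
  \<comment> \<open>The premise of this rule leaves the source ring open, so it does not terminate as a rewrite rule.\<close>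
  note h.kernel_zero [simp del]
  let ?I = "Idl\<^bsub>M\<^esub> X"
  have I: "ideal ?I M" by (rule M.genideal_ideal[OF X])
  interpret I: ideal ?I M by (rule I)
  have "X \<subseteq> a_kernel M E \<Phi>" 
    by (rule subsetI) (simp add: a_kernel_def' X0 subsetD[OF X])
  then have "?I \<subseteq> a_kernel M E \<Phi>" by (rule M.genideal_minimal[OF h.kernel_is_ideal])
  then have I0: "\<Phi> i = \<zero>\<^bsub>E\<^esub>" if "i \<in> ?I" for i
    using that by (intro h.kernel_zero) blast
  define \<Psi> where "\<Psi> C = the_elem (\<Phi> ` C)" for C
  have \<Psi>: "\<Psi> (?I +>\<^bsub>M\<^esub> x) = \<Phi> x" if x: "x \<in> carrier M" for x
  proof -
    have "\<Phi> y = \<Phi> x" if y: "y \<in> ?I +>\<^bsub>M\<^esub> x" for y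
    proof -
      obtain i where i: "i \<in> ?I" "y = i \<oplus>\<^bsub>M\<^esub> x" using y unfolding a_r_coset_def' by blast
      then show ?thesis using x I0[OF i(1)] I.Icarr[OF i(1)] by simp
    qed
    moreover have "x \<in> ?I +>\<^bsub>M\<^esub> x" using x I.a_rcos_self by blast
    ultimately have "\<Phi> ` (?I +>\<^bsub>M\<^esub> x) = {\<Phi> x}" by blast
    then show ?thesis by (simp add: \<Psi>_def)
  qed
  let ?Q = "quotient_algebra M ?I"
  note p = algebra_homD[OF M.quotient_unital_algebra(2)[OF I]]
  have "\<Psi> \<in> algebra_hom K ?Q E"
    unfolding algebra_hom_def
  proof (intro CollectI conjI ballI ring_hom_memI)
    show "\<Psi> \<one>\<^bsub>?Q\<^esub> = \<one>\<^bsub>E\<^esub>" unfolding p(4)[symmetric] by (simp add: \<Psi>)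
    fix x assume "x \<in> carrier ?Q"
    then obtain a where a: "a \<in> carrier M" "x = ?I +>\<^bsub>M\<^esub> a" by (auto simp: quotient_algebra_carrier)
    show "\<Psi> x \<in> carrier E" using a by (simp add: \<Psi>)
    show "\<Psi> (c \<odot>\<^bsub>?Q\<^esub> x) = c \<odot>\<^bsub>E\<^esub> \<Psi> x" if "c \<in> carrier K" for c
      using a that algebra_homD(5)[OF \<Phi>] by (simp add: \<Psi> p(5)[symmetric])
    fix y assume "y \<in> carrier ?Q"
    then obtain b where b: "b \<in> carrier M" "y = ?I +>\<^bsub>M\<^esub> b" by (auto simp: quotient_algebra_carrier)
    show "\<Psi> (x \<otimes>\<^bsub>?Q\<^esub> y) = \<Psi> x \<otimes>\<^bsub>E\<^esub> \<Psi> y" "\<Psi> (x \<oplus>\<^bsub>?Q\<^esub> y) = \<Psi> x \<oplus>\<^bsub>E\<^esub> \<Psi> y"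
      using a b by (simp_all add: \<Psi> p(2,3)[symmetric])
  qed
  then show ?thesis using \<Psi> by blast
qed

lemma hom_relations_vanish:
  assumes B: "unital_algebra K B" and F: "unital_algebra K F" and E: "unital_algebra K E"
    and \<Phi>: "\<Phi> \<in> algebra_hom K F E" and h: "h \<in> algebra_hom K B E"
    and j: "j \<in> carrier B \<rightarrow> carrier F" and \<Phi>j: "\<And>x. x \<in> carrier B \<Longrightarrow> \<Phi> (j x) = h x"
    and x: "x \<in> hom_relations K B F j"
  shows "\<Phi> x = \<zero>\<^bsub>E\<^esub>"
proof -
  interpret B: unital_algebra K B by (rule B)
  interpret F: unital_algebra K F by (rule F)
  interpret E: unital_algebra K E by (rule E)
  interpret \<Phi>: ring_hom_ring F E \<Phi> by (rule algebra_hom_ring_hom_ring[OF F E \<Phi>])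
  note \<Phi>.kernel_zero [simp del]
  have d: "\<Phi> (u \<ominus>\<^bsub>F\<^esub> v) = \<zero>\<^bsub>E\<^esub>" if "u \<in> carrier F" "v \<in> carrier F" "\<Phi> u = \<Phi> v" for u v
    using that by (simp add: a_minus_def E.M.r_neg)
  have jc: "j x \<in> carrier F" if "x \<in> carrier B" for x using that j by blast
  show ?thesis using x unfolding hom_relations_def
  proof (elim UnE CollectE exE conjE singletonE; hypsubst)
    note simps = jc \<Phi>j algebra_homD[OF h] algebra_homD[OF \<Phi>]
      B.a_closed B.m_closed B.smult_closed B.one_closed
      F.a_closed F.m_closed F.smult_closed F.one_closed
    fix y z assume "y \<in> carrier B" "z \<in> carrier B"
    then show "\<Phi> (j (y \<oplus>\<^bsub>B\<^esub> z) \<ominus>\<^bsub>F\<^esub> (j y \<oplus>\<^bsub>F\<^esub> j z)) = \<zero>\<^bsub>E\<^esub>"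
      "\<Phi> (j (y \<otimes>\<^bsub>B\<^esub> z) \<ominus>\<^bsub>F\<^esub> j y \<otimes>\<^bsub>F\<^esub> j z) = \<zero>\<^bsub>E\<^esub>"
      by (intro d; simp only: simps)+
  next
    fix c y assume "c \<in> carrier K" "y \<in> carrier B"
    then show "\<Phi> (j (c \<odot>\<^bsub>B\<^esub> y) \<ominus>\<^bsub>F\<^esub> c \<odot>\<^bsub>F\<^esub> j y) = \<zero>\<^bsub>E\<^esub>"
      by (intro d; simp only: jc \<Phi>j algebra_homD[OF h] algebra_homD[OF \<Phi>]
      B.smult_closed F.smult_closed)
  next
    show "\<Phi> (j \<one>\<^bsub>B\<^esub> \<ominus>\<^bsub>F\<^esub> \<one>\<^bsub>F\<^esub>) = \<zero>\<^bsub>E\<^esub>"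
      by (intro d; simp only: jc \<Phi>j algebra_homD[OF h] algebra_homD[OF \<Phi>]
      B.one_closed F.one_closed)
  qed
qed

lemma free_product_relations:
  assumes A: "unital_algebra K A" and B: "unital_algebra K B"
  defines "F \<equiv> free_algebra K (Inl ` carrier A \<union> Inr ` carrier B)"
  defines "R \<equiv> hom_relations K A F (\<lambda>a. free_gen K (Inl a)) \<union> hom_relations K B F (\<lambda>b. free_gen K (Inr b))"
  shows "unital_algebra K F" and "R \<subseteq> carrier F"
    and "(\<lambda>a. free_gen K (Inl a)) \<in> carrier A \<rightarrow> carrier F"
    and "(\<lambda>b. free_gen K (Inr b)) \<in> carrier B \<rightarrow> carrier F"
proof -
  interpret A: unital_algebra K A by (rule A)
  show F: "unital_algebra K F" unfolding F_def by (rule A.free_algebra_unital_algebra)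
  show jl: "(\<lambda>a. free_gen K (Inl a)) \<in> carrier A \<rightarrow> carrier F"
    and jr: "(\<lambda>b. free_gen K (Inr b)) \<in> carrier B \<rightarrow> carrier F"
    by (auto simp: F_def intro!: A.free_gen_closed)
  interpret F: unital_algebra K F by (rule F)
  show "R \<subseteq> carrier F"
    unfolding R_def using F.hom_relations_subset[OF A jl] F.hom_relations_subset[OF B jr] by blast
qed

lemma free_product_lift:
  assumes A: "unital_algebra K A" and B: "unital_algebra K B" and E: "unital_algebra K E"
    and f: "f \<in> algebra_hom K A E" and g: "g \<in> algebra_hom K B E"
  shows "\<exists>\<Phi>\<in>algebra_hom K (free_product K A B) E.
    (\<forall>a\<in>carrier A. \<Phi> (free_product_inl K A B a) = f a) \<and>
    (\<forall>b\<in>carrier B. \<Phi> (free_product_inr K A B b) = g b)"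
proof -
  let ?S = "Inl ` carrier A \<union> Inr ` carrier B"
  let ?F = "free_algebra K ?S"
  let ?R = "hom_relations K A ?F (\<lambda>a. free_gen K (Inl a)) \<union> hom_relations K B ?F (\<lambda>b. free_gen K (Inr b))"
  note fp = free_product_relations[OF A B]
  have "case_sum f g \<in> ?S \<rightarrow> carrier E" using algebra_homD(1)[OF f] algebra_homD(1)[OF g] by auto
  then obtain \<Phi> where \<Phi>: "\<Phi> \<in> algebra_hom K ?F E" and gen: "\<forall>x\<in>?S. \<Phi> (free_gen K x) = case_sum f g x"
    using free_algebra_lift[OF E] by metis
  have \<Phi>0: "\<Phi> x = \<zero>\<^bsub>E\<^esub>" if "x \<in> ?R" for x
    using that
  proof
    assume "x \<in> hom_relations K A ?F (\<lambda>a. free_gen K (Inl a))"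
    then show ?thesis by (rule hom_relations_vanish[OF A fp(1) E \<Phi> f fp(3), rotated]) (simp add: gen)
  next
    assume "x \<in> hom_relations K B ?F (\<lambda>b. free_gen K (Inr b))"
    then show ?thesis by (rule hom_relations_vanish[OF B fp(1) E \<Phi> g fp(4), rotated]) (simp add: gen)
  qed
  obtain \<Psi> where "\<Psi> \<in> algebra_hom K (quotient_algebra ?F (Idl\<^bsub>?F\<^esub> ?R)) E"
    "\<forall>x\<in>carrier ?F. \<Psi> (Idl\<^bsub>?F\<^esub> ?R +>\<^bsub>?F\<^esub> x) = \<Phi> x"
    by (rule bexE[OF quotient_algebra_lift[OF fp(1) E \<Phi> fp(2) \<Phi>0]])
  moreover have "free_gen K (Inl a) \<in> carrier ?F" if "a \<in> carrier A" for a using fp(3) that by (rule funcset_mem)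
  moreover have "free_gen K (Inr b) \<in> carrier ?F" if "b \<in> carrier B" for b using fp(4) that by (rule funcset_mem)
  ultimately show ?thesis using gen
    by (intro bexI[of _ \<Psi>])
      (simp_all add: free_product_def free_product_ideal_def Let_def free_product_inl_def free_product_inr_def)
qed

text \<open>
  Generation passes to quotients: pull a subalgebra of the quotient back to \<open>M\<close>.
\<close>

lemma quotient_algebra_generated:
  assumes M: "unital_algebra K M" and I: "ideal I M"
    and gen: "\<And>H'. unital_subalgebra K M H' \<Longrightarrow> (\<And>x. x \<in> G \<Longrightarrow> x \<in> H') \<Longrightarrow> H' = carrier M"
    and G: "G \<subseteq> carrier M"
    and H: "unital_subalgebra K (quotient_algebra M I) H"
    and GH: "\<And>x. x \<in> G \<Longrightarrow> I +>\<^bsub>M\<^esub> x \<in> H"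
  shows "H = carrier (quotient_algebra M I)"
proof -
  interpret M: unital_algebra K M by (rule M)
  have "{x \<in> carrier M. I +>\<^bsub>M\<^esub> x \<in> H} = carrier M"
    using unital_subalgebra_vimage[OF M M.quotient_unital_algebra(2)[OF I] H] G GH
    by (intro gen) auto
  moreover have "H \<subseteq> carrier (quotient_algebra M I)" using H by (simp add: unital_subalgebra_def)
  ultimately show ?thesis by (auto simp: quotient_algebra_carrier)
qed

lemma free_product_generated:
  assumes A: "unital_algebra K A" and B: "unital_algebra K B"
    and H: "unital_subalgebra K (free_product K A B) H"
    and inl: "\<And>a. a \<in> carrier A \<Longrightarrow> free_product_inl K A B a \<in> H"
    and inr: "\<And>b. b \<in> carrier B \<Longrightarrow> free_product_inr K A B b \<in> H"
  shows "H = carrier (free_product K A B)"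
proof -
  interpret A: unital_algebra K A by (rule A)
  let ?S = "Inl ` carrier A \<union> Inr ` carrier B"
  let ?F = "free_algebra K ?S"
  note fp = free_product_relations[OF A B]
  interpret F: unital_algebra K ?F by (rule fp(1))
  have I: "ideal (free_product_ideal K A B) ?F"
    unfolding free_product_ideal_def Let_def by (rule F.genideal_ideal[OF fp(2)])
  show ?thesis
    unfolding free_product_def
  proof (rule quotient_algebra_generated[OF fp(1) I, of "free_gen K ` ?S"])
    show "H' = carrier ?F" if "unital_subalgebra K ?F H'" "\<And>x. x \<in> free_gen K ` ?S \<Longrightarrow> x \<in> H'" for H'
      using that by (intro free_algebra_generated[OF A.R.is_cring]) auto
    show "free_gen K ` ?S \<subseteq> carrier ?F" by (auto intro!: A.free_gen_closed)
    show "unital_subalgebra K (quotient_algebra ?F (free_product_ideal K A B)) H"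
      using H by (simp add: free_product_def)
  qed (use inl inr in \<open>auto simp: free_product_inl_def free_product_inr_def\<close>)
qed

context
  fixes K :: "('k, 'r) ring_scheme" and A :: "('k, 'a, 'm) module_scheme" and N :: "'a \<Rightarrow> 'a"
  assumes nij: "nijenhuis_algebra K A N"
begin

lemma nij_algebraD:
  "unital_algebra K A" "unital_algebra K (UP K)" "unital_algebra K (nij_free K A)"
  "nij_free_emb K A \<in> algebra_hom K A (nij_free K A)"
  "free_product_inr K A (UP K) \<in> algebra_hom K (UP K) (nij_free K A)"
  "nij_free_Q K A \<in> carrier (nij_free K A)"
  "a \<in> carrier A \<Longrightarrow> N a \<in> carrier A"
proof -
  show A: "unital_algebra K A" and "a \<in> carrier A \<Longrightarrow> N a \<in> carrier A"
    using nij by (auto simp: nijenhuis_algebra_def linear_endo_def)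
  interpret A: unital_algebra K A by (rule A)
  interpret UPK: UP_cring K "UP K" by unfold_locales simp
  show U: "unital_algebra K (UP K)" by (rule A.UP_unital_algebra)
  note fp = free_product_unital_algebra[OF A U]
  show "unital_algebra K (nij_free K A)" "nij_free_emb K A \<in> algebra_hom K A (nij_free K A)"
    and inr: "free_product_inr K A (UP K) \<in> algebra_hom K (UP K) (nij_free K A)"
    using fp by (simp_all add: nij_free_def nij_free_emb_def[abs_def])
  show "nij_free_Q K A \<in> carrier (nij_free K A)"
    unfolding nij_free_Q_def using algebra_homD(1)[OF inr] by simp
qed

lemma nij_relations_subset:
  "{((nij_free_Q K A \<otimes>\<^bsub>nij_free K A\<^esub> nij_free_emb K A a \<otimes>\<^bsub>nij_free K A\<^esub> nij_free_Q K A
      \<ominus>\<^bsub>nij_free K A\<^esub> nij_free_emb K A (N a) \<otimes>\<^bsub>nij_free K A\<^esub> nij_free_Q K A)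
      \<oplus>\<^bsub>nij_free K A\<^esub> nij_free_Q K A \<otimes>\<^bsub>nij_free K A\<^esub> nij_free_emb K A (N a))
      \<ominus>\<^bsub>nij_free K A\<^esub> (nij_free_Q K A \<otimes>\<^bsub>nij_free K A\<^esub> nij_free_Q K A) \<otimes>\<^bsub>nij_free K A\<^esub> nij_free_emb K A a
    | a. a \<in> carrier A} \<subseteq> carrier (nij_free K A)"
proof -
  interpret P: unital_algebra K "nij_free K A" by (rule nij_algebraD)
  show ?thesis using nij_algebraD(6,7) algebra_homD(1)[OF nij_algebraD(4)] by auto
qed

text \<open>
  The universal property of \<open>U\<close>, assembled from those of its layers: polynomials, free product
  and quotient by the Nijenhuis relations.
\<close>

lemma nij_operators_lift:
  assumes E: "unital_algebra K E" and h: "h \<in> algebra_hom K A E" and q: "q \<in> carrier E"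
    and rel: "\<And>a. a \<in> carrier A \<Longrightarrow> q \<otimes>\<^bsub>E\<^esub> h a \<otimes>\<^bsub>E\<^esub> q =
      (h (N a) \<otimes>\<^bsub>E\<^esub> q \<ominus>\<^bsub>E\<^esub> q \<otimes>\<^bsub>E\<^esub> h (N a)) \<oplus>\<^bsub>E\<^esub> (q \<otimes>\<^bsub>E\<^esub> q) \<otimes>\<^bsub>E\<^esub> h a"
  shows "\<exists>\<Phi>\<in>algebra_hom K (nij_operators K A N) E.
    (\<forall>a\<in>carrier A. \<Phi> (nij_emb K A N a) = h a) \<and> \<Phi> (nij_Q K A N) = q"
proof -
  interpret A: unital_algebra K A by (rule nij_algebraD)
  interpret E: unital_algebra K E by (rule E)
  interpret UPK: UP_cring K "UP K" by unfold_locales simp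
  let ?P = "nij_free K A" and ?i = "nij_free_emb K A" and ?q = "nij_free_Q K A"
  note P = nij_algebraD(3)
  interpret P: unital_algebra K ?P by (rule P)
  obtain g where g: "g \<in> algebra_hom K (UP K) E" "g (monom (UP K) \<one>\<^bsub>K\<^esub> 1) = q"
    by (rule bexE[OF UP_lift[OF E q]])
  have X: "monom (UP K) \<one>\<^bsub>K\<^esub> 1 \<in> carrier (UP K)" by simp
  obtain \<Phi> where \<Phi>: "\<Phi> \<in> algebra_hom K ?P E"
    and "(\<forall>a\<in>carrier A. \<Phi> (?i a) = h a) \<and>
      (\<forall>p\<in>carrier (UP K). \<Phi> (free_product_inr K A (UP K) p) = g p)"
    unfolding nij_free_def nij_free_emb_def
    by (rule bexE[OF free_product_lift[OF nij_algebraD(1,2) E h g(1)]])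
  then have \<Phi>i: "\<And>a. a \<in> carrier A \<Longrightarrow> \<Phi> (?i a) = h a" and \<Phi>q: "\<Phi> ?q = q"
    using g(2) X by (simp_all add: nij_free_Q_def)
  interpret \<Phi>: ring_hom_ring ?P E \<Phi> by (rule algebra_hom_ring_hom_ring[OF P E \<Phi>])
  note \<Phi>.kernel_zero [simp del]
  have ic: "?i a \<in> carrier ?P" if "a \<in> carrier A" for a
    using algebra_homD(1)[OF nij_algebraD(4) that] .
  have vanish: "((q \<otimes>\<^bsub>E\<^esub> h a \<otimes>\<^bsub>E\<^esub> q \<ominus>\<^bsub>E\<^esub> h (N a) \<otimes>\<^bsub>E\<^esub> q) \<oplus>\<^bsub>E\<^esub> q \<otimes>\<^bsub>E\<^esub> h (N a))
      \<ominus>\<^bsub>E\<^esub> (q \<otimes>\<^bsub>E\<^esub> q) \<otimes>\<^bsub>E\<^esub> h a = \<zero>\<^bsub>E\<^esub>" if a: "a \<in> carrier A" for a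
  proof -
    have "((x \<ominus>\<^bsub>E\<^esub> y \<oplus>\<^bsub>E\<^esub> z) \<ominus>\<^bsub>E\<^esub> x \<oplus>\<^bsub>E\<^esub> y) \<ominus>\<^bsub>E\<^esub> z = \<zero>\<^bsub>E\<^esub>"
      if "x \<in> carrier E" "y \<in> carrier E" "z \<in> carrier E" for x y z
    proof -
      have "((x \<ominus>\<^bsub>E\<^esub> y \<oplus>\<^bsub>E\<^esub> z) \<ominus>\<^bsub>E\<^esub> x \<oplus>\<^bsub>E\<^esub> y) \<ominus>\<^bsub>E\<^esub> z
          = (x \<oplus>\<^bsub>E\<^esub> (\<ominus>\<^bsub>E\<^esub> x)) \<oplus>\<^bsub>E\<^esub> ((y \<oplus>\<^bsub>E\<^esub> (\<ominus>\<^bsub>E\<^esub> y)) \<oplus>\<^bsub>E\<^esub> (z \<oplus>\<^bsub>E\<^esub> (\<ominus>\<^bsub>E\<^esub> z)))"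
        using that unfolding a_minus_def by (simp only: E.M.a_ac E.M.a_inv_closed E.M.a_closed)
      then show ?thesis using that by (simp add: E.M.r_neg)
    qed
    then show ?thesis using a q algebra_homD(1)[OF h] nij_algebraD(7) by (simp add: rel)
  qed
  have "\<exists>\<Psi>\<in>algebra_hom K (nij_operators K A N) E. \<forall>x\<in>carrier ?P. \<Psi> (nij_ideal K A N +>\<^bsub>?P\<^esub> x) = \<Phi> x"
    unfolding nij_operators_def nij_ideal_def Let_def
  proof (rule quotient_algebra_lift[OF P E \<Phi> nij_relations_subset], elim CollectE exE conjE)
    fix x a assume "a \<in> carrier A" and x: "x = ((?q \<otimes>\<^bsub>?P\<^esub> ?i a \<otimes>\<^bsub>?P\<^esub> ?q \<ominus>\<^bsub>?P\<^esub> ?i (N a) \<otimes>\<^bsub>?P\<^esub> ?q)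
        \<oplus>\<^bsub>?P\<^esub> ?q \<otimes>\<^bsub>?P\<^esub> ?i (N a)) \<ominus>\<^bsub>?P\<^esub> (?q \<otimes>\<^bsub>?P\<^esub> ?q) \<otimes>\<^bsub>?P\<^esub> ?i a"
    then show "\<Phi> x = \<zero>\<^bsub>E\<^esub>"
      using vanish[of a] nij_algebraD(6,7) ic by (simp add: \<Phi>i \<Phi>q a_minus_def)
  qed
  then obtain \<Psi> where "\<Psi> \<in> algebra_hom K (nij_operators K A N) E"
      "\<forall>x\<in>carrier ?P. \<Psi> (nij_ideal K A N +>\<^bsub>?P\<^esub> x) = \<Phi> x" by (rule bexE)
  then show ?thesis using ic nij_algebraD(6) \<Phi>i \<Phi>q
    by (intro bexI[of _ \<Psi>]) (simp_all add: nij_emb_def nij_Q_def)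
qed

text \<open>
  The generators of the free product are \<open>A\<close> and all polynomials in \<open>Q\<close>; the polynomials are
  recovered from \<open>Q\<close> alone by pulling back along the embedding of \<open>K[Q]\<close>.
\<close>

lemma nij_operators_generated:
  assumes H: "unital_subalgebra K (nij_operators K A N) H"
    and emb: "\<And>a. a \<in> carrier A \<Longrightarrow> nij_emb K A N a \<in> H" and Q: "nij_Q K A N \<in> H"
  shows "H = carrier (nij_operators K A N)"
proof -
  interpret A: unital_algebra K A by (rule nij_algebraD)
  let ?P = "nij_free K A" and ?i = "nij_free_emb K A" and ?q = "nij_free_Q K A"
  note P = nij_algebraD(3)
  interpret P: unital_algebra K ?P by (rule P)
  have I: "ideal (nij_ideal K A N) ?P"
    unfolding nij_ideal_def Let_def by (rule P.genideal_ideal[OF nij_relations_subset])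
  show ?thesis
    unfolding nij_operators_def
  proof (rule quotient_algebra_generated[OF P I, of "insert ?q (?i ` carrier A)"])
    show "insert ?q (?i ` carrier A) \<subseteq> carrier ?P"
      using algebra_homD(1)[OF nij_algebraD(4)] nij_algebraD(6) by blast
    show "unital_subalgebra K (quotient_algebra ?P (nij_ideal K A N)) H"
      using H by (simp add: nij_operators_def)
    show "nij_ideal K A N +>\<^bsub>?P\<^esub> x \<in> H" if "x \<in> insert ?q (?i ` carrier A)" for x
      using that emb Q by (auto simp: nij_emb_def nij_Q_def)
    fix H' assume H': "unital_subalgebra K ?P H'" and gen: "\<And>x. x \<in> insert ?q (?i ` carrier A) \<Longrightarrow> x \<in> H'"
    let ?H = "{p \<in> carrier (UP K). free_product_inr K A (UP K) p \<in> H'}"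
    have "?H = carrier (UP K)"
    proof (rule UP_generated[OF A.R.is_cring])
      show "unital_subalgebra K (UP K) ?H"
        by (rule unital_subalgebra_vimage[OF nij_algebraD(2,5) H'])
      interpret UPK: UP_cring K "UP K" by unfold_locales simp
      have "monom (UP K) \<one>\<^bsub>K\<^esub> 1 \<in> carrier (UP K)" by simp
      then show "monom (UP K) \<one>\<^bsub>K\<^esub> 1 \<in> ?H" using gen[of ?q] by (simp add: nij_free_Q_def)
    qed
    then show "H' = carrier ?P"
      using gen H' unfolding nij_free_def
      by (intro free_product_generated[OF nij_algebraD(1,2)]) (auto simp: nij_free_emb_def)
  qed
qed

end

section \<open>Operators written on the right\<close>

text \<open>
  The product \<open>\<phi> \<otimes> \<psi>\<close> applies \<open>\<phi>\<close> first, so homomorphisms into this algebra are right modules.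
  Endomorphisms are extensional, which makes equality in the algebra equality of functions.
\<close>

definition right_endo_algebra :: "('k, 'r) ring_scheme \<Rightarrow> ('k, 'g, 'm) module_scheme \<Rightarrow> ('k, 'g \<Rightarrow> 'g) module"
  where "right_endo_algebra K G = \<lparr>
    carrier = {\<phi> \<in> extensional (carrier G). linear_endo K G \<phi>},
    mult = (\<lambda>\<phi> \<psi>. restrict (\<lambda>f. \<psi> (\<phi> f)) (carrier G)),
    one = restrict (\<lambda>f. f) (carrier G),
    zero = restrict (\<lambda>f. \<zero>\<^bsub>G\<^esub>) (carrier G),
    add = (\<lambda>\<phi> \<psi>. restrict (\<lambda>f. \<phi> f \<oplus>\<^bsub>G\<^esub> \<psi> f) (carrier G)),
    smult = (\<lambda>c \<phi>. restrict (\<lambda>f. c \<odot>\<^bsub>G\<^esub> \<phi> f) (carrier G))\<rparr>"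

lemma right_endo_algebra_simps:
  "carrier (right_endo_algebra K G) = {\<phi> \<in> extensional (carrier G). linear_endo K G \<phi>}"
  "\<phi> \<otimes>\<^bsub>right_endo_algebra K G\<^esub> \<psi> = restrict (\<lambda>f. \<psi> (\<phi> f)) (carrier G)"
  "\<one>\<^bsub>right_endo_algebra K G\<^esub> = restrict (\<lambda>f. f) (carrier G)"
  "\<zero>\<^bsub>right_endo_algebra K G\<^esub> = restrict (\<lambda>f. \<zero>\<^bsub>G\<^esub>) (carrier G)"
  "\<phi> \<oplus>\<^bsub>right_endo_algebra K G\<^esub> \<psi> = restrict (\<lambda>f. \<phi> f \<oplus>\<^bsub>G\<^esub> \<psi> f) (carrier G)"
  "c \<odot>\<^bsub>right_endo_algebra K G\<^esub> \<phi> = restrict (\<lambda>f. c \<odot>\<^bsub>G\<^esub> \<phi> f) (carrier G)"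
  by (simp_all add: right_endo_algebra_def)

lemma (in module) right_endo_algebra_unital_algebra:
  "unital_algebra R (right_endo_algebra R M)"
proof -
  let ?E = "right_endo_algebra R M"
  have lin: "\<phi> f \<in> carrier M" "\<phi> (f \<oplus>\<^bsub>M\<^esub> g) = \<phi> f \<oplus>\<^bsub>M\<^esub> \<phi> g"
    "c \<in> carrier R \<Longrightarrow> \<phi> (c \<odot>\<^bsub>M\<^esub> f) = c \<odot>\<^bsub>M\<^esub> \<phi> f"
    if "\<phi> \<in> carrier ?E" "f \<in> carrier M" "g \<in> carrier M" for \<phi> f g c
    using that by (auto simp: right_endo_algebra_simps linear_endo_def)
  have ext: "\<phi> = \<psi>" if "\<phi> \<in> carrier ?E" "\<psi> \<in> carrier ?E" "\<And>f. f \<in> carrier M \<Longrightarrow> \<phi> f = \<psi> f" for \<phi> \<psi>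
    using that by (auto simp: right_endo_algebra_simps intro: extensionalityI)
  have add: "\<phi> \<oplus>\<^bsub>?E\<^esub> \<psi> \<in> carrier ?E" and mult: "\<phi> \<otimes>\<^bsub>?E\<^esub> \<psi> \<in> carrier ?E"
    if "\<phi> \<in> carrier ?E" "\<psi> \<in> carrier ?E" for \<phi> \<psi>
    using lin[OF that(1)] lin[OF that(2)]
    by (auto simp: right_endo_algebra_simps linear_endo_def M.a_ac smult_r_distr)
  have smult: "c \<odot>\<^bsub>?E\<^esub> \<phi> \<in> carrier ?E" if "c \<in> carrier R" "\<phi> \<in> carrier ?E" for c \<phi>
    using that(1) lin[OF that(2)]
    by (auto simp: right_endo_algebra_simps linear_endo_def smult_r_distr smult_assoc1[symmetric] R.m_comm)
  have zero: "\<zero>\<^bsub>?E\<^esub> \<in> carrier ?E" and one: "\<one>\<^bsub>?E\<^esub> \<in> carrier ?E"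
    by (auto simp: right_endo_algebra_simps linear_endo_def)
  note closed = add mult smult zero one
  have ev: "f \<in> carrier M \<Longrightarrow> (\<phi> \<oplus>\<^bsub>?E\<^esub> \<psi>) f = \<phi> f \<oplus>\<^bsub>M\<^esub> \<psi> f"
    "f \<in> carrier M \<Longrightarrow> (\<phi> \<otimes>\<^bsub>?E\<^esub> \<psi>) f = \<psi> (\<phi> f)"
    "f \<in> carrier M \<Longrightarrow> (c \<odot>\<^bsub>?E\<^esub> \<phi>) f = c \<odot>\<^bsub>M\<^esub> \<phi> f"
    "f \<in> carrier M \<Longrightarrow> \<zero>\<^bsub>?E\<^esub> f = \<zero>\<^bsub>M\<^esub>" "f \<in> carrier M \<Longrightarrow> \<one>\<^bsub>?E\<^esub> f = f" for \<phi> \<psi> c f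
    by (simp_all add: right_endo_algebra_simps)
  have ag: "abelian_group ?E"
  proof (rule abelian_groupI)
    fix \<phi> assume \<phi>: "\<phi> \<in> carrier ?E"
    have "(\<ominus>\<^bsub>R\<^esub> \<one>\<^bsub>R\<^esub>) \<odot>\<^bsub>?E\<^esub> \<phi> \<oplus>\<^bsub>?E\<^esub> \<phi> = \<zero>\<^bsub>?E\<^esub>"
      using \<phi> lin(1)[OF \<phi>] by (intro ext) (auto simp: closed ev smult_l_minus M.l_neg)
    then show "\<exists>\<psi>\<in>carrier ?E. \<psi> \<oplus>\<^bsub>?E\<^esub> \<phi> = \<zero>\<^bsub>?E\<^esub>" using closed(3)[OF _ \<phi>] by blast
  qed (auto intro!: ext simp: closed ev lin(1) M.a_ac)
  have ring: "ring ?E"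
    by (rule ringI[OF ag], unfold_locales) (auto intro!: ext simp: closed ev lin)
  have mod: "module R ?E"
    by (rule moduleI[OF R.is_cring ag])
      (auto intro!: ext simp: closed ev lin smult_l_distr smult_r_distr smult_assoc1)
  show ?thesis
    by (intro unital_algebra.intro unital_algebra_axioms.intro mod ring)
      (auto intro!: ext simp: closed ev lin)
qed

section \<open>Functionals on the normal forms\<close>

text \<open>
  The families \<open>f i a b\<close> of values at \<open>a Q\<^sup>i b\<close> of a linear map on the normal forms. The conditions are,
  in this order: values in \<open>W\<close>, the default value zero outside \<open>A\<close>, additivity and homogeneity in
  both arguments, balancedness over \<open>N(1)\<close>, and for \<open>i = 0\<close> dependence on the product \<open>a b\<close> alone.
  The record type of modules extends that of rings, hence the dummy ring operations.
\<close>

definition nij_functionals ::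
    "('k, 'r) ring_scheme \<Rightarrow> ('k, 'a, 'm) module_scheme \<Rightarrow> ('a \<Rightarrow> 'a) \<Rightarrow> ('k, 'w, 'n) module_scheme \<Rightarrow>
      ('k, nat \<Rightarrow> 'a \<Rightarrow> 'a \<Rightarrow> 'w) module"
  where "nij_functionals K A N W = \<lparr>
    carrier = {f. (\<forall>i. \<forall>a\<in>carrier A. \<forall>b\<in>carrier A. f i a b \<in> carrier W) \<and>
      (\<forall>i a b. a \<notin> carrier A \<or> b \<notin> carrier A \<longrightarrow> f i a b = \<zero>\<^bsub>W\<^esub>) \<and>
      (\<forall>i. \<forall>a\<in>carrier A. \<forall>b\<in>carrier A. \<forall>c\<in>carrier A.
        f i (a \<oplus>\<^bsub>A\<^esub> b) c = f i a c \<oplus>\<^bsub>W\<^esub> f i b c \<and> f i a (b \<oplus>\<^bsub>A\<^esub> c) = f i a b \<oplus>\<^bsub>W\<^esub> f i a c) \<and>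
      (\<forall>i. \<forall>k\<in>carrier K. \<forall>a\<in>carrier A. \<forall>b\<in>carrier A.
        f i (k \<odot>\<^bsub>A\<^esub> a) b = k \<odot>\<^bsub>W\<^esub> f i a b \<and> f i a (k \<odot>\<^bsub>A\<^esub> b) = k \<odot>\<^bsub>W\<^esub> f i a b) \<and>
      (\<forall>i. \<forall>a\<in>carrier A. \<forall>b\<in>carrier A. f i (a \<otimes>\<^bsub>A\<^esub> N \<one>\<^bsub>A\<^esub>) b = f i a (N \<one>\<^bsub>A\<^esub> \<otimes>\<^bsub>A\<^esub> b)) \<and>
      (\<forall>a\<in>carrier A. \<forall>b\<in>carrier A. f 0 a b = f 0 \<one>\<^bsub>A\<^esub> (a \<otimes>\<^bsub>A\<^esub> b))},
    mult = undefined,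
    one = undefined,
    zero = (\<lambda>i a b. \<zero>\<^bsub>W\<^esub>),
    add = (\<lambda>f g i a b. f i a b \<oplus>\<^bsub>W\<^esub> g i a b),
    smult = (\<lambda>k f i a b. k \<odot>\<^bsub>W\<^esub> f i a b)\<rparr>"

text \<open>
  The values of \<open>x \<mapsto> f (c x)\<close>.
\<close>

definition functional_left ::
    "('k, 'a, 'm) module_scheme \<Rightarrow> ('k, 'w, 'n) module_scheme \<Rightarrow> 'a \<Rightarrow>
      (nat \<Rightarrow> 'a \<Rightarrow> 'a \<Rightarrow> 'w) \<Rightarrow> nat \<Rightarrow> 'a \<Rightarrow> 'a \<Rightarrow> 'w"
  where "functional_left A W c f = (\<lambda>i a b.
    if a \<in> carrier A \<and> b \<in> carrier A then f i (c \<otimes>\<^bsub>A\<^esub> a) b else \<zero>\<^bsub>W\<^esub>)"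

text \<open>
  The values of \<open>x \<mapsto> f (Q x)\<close>, read off from
  \<open>Q (a Q\<^sup>i b) = N(a) Q\<^sup>i b - Q\<^sup>i N(a) b + Q\<^sup>i\<^sup>+\<^sup>1 a b\<close>. At \<open>i = 0\<close> the first two values cancel, since there
  \<open>f\<close> only sees the product of its arguments.
\<close>

definition functional_Q ::
    "('k, 'a, 'm) module_scheme \<Rightarrow> ('a \<Rightarrow> 'a) \<Rightarrow> ('k, 'w, 'n) module_scheme \<Rightarrow>
      (nat \<Rightarrow> 'a \<Rightarrow> 'a \<Rightarrow> 'w) \<Rightarrow> nat \<Rightarrow> 'a \<Rightarrow> 'a \<Rightarrow> 'w"
  where "functional_Q A N W f = (\<lambda>i a b.
    if a \<in> carrier A \<and> b \<in> carrier A
    then (f i (N a) b \<ominus>\<^bsub>W\<^esub> f i \<one>\<^bsub>A\<^esub> (N a \<otimes>\<^bsub>A\<^esub> b)) \<oplus>\<^bsub>W\<^esub> f (Suc i) \<one>\<^bsub>A\<^esub> (a \<otimes>\<^bsub>A\<^esub> b)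
    else \<zero>\<^bsub>W\<^esub>)"

lemma (in abelian_group) add_eq_iff_eq_minus:
  assumes "x \<in> carrier G" "y \<in> carrier G" "z \<in> carrier G"
  shows "x \<oplus> z = y \<longleftrightarrow> x = y \<ominus> z"
  using assms by (auto simp: a_minus_def a_assoc r_neg l_neg)

text \<open>
  These equations collect an expression into one difference of sums; together with
  \<open>minus_eq_minusI\<close> they reduce the linear identities below to rearranging sums.
\<close>

lemma (in abelian_group) minus_simps:
  assumes "x \<in> carrier G" "y \<in> carrier G" "z \<in> carrier G"
  shows "(x \<ominus> y) \<oplus> z = (x \<oplus> z) \<ominus> y" "(x \<ominus> y) \<ominus> z = x \<ominus> (y \<oplus> z)"
    "x \<ominus> (y \<ominus> z) = (x \<oplus> z) \<ominus> y" "x \<oplus> (y \<ominus> z) = (x \<oplus> y) \<ominus> z"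
  using assms by (simp_all add: a_minus_def minus_add a_ac)

lemma (in abelian_group) minus_eq_minusI:
  assumes c: "x \<in> carrier G" "y \<in> carrier G" "z \<in> carrier G" "w \<in> carrier G" and e: "x \<oplus> w = z \<oplus> y"
  shows "x \<ominus> y = z \<ominus> w"
proof -
  have "x \<ominus> y = ((x \<oplus> w) \<ominus> w) \<ominus> y" using c by (simp add: a_minus_def a_assoc r_neg)
  also have "\<dots> = ((z \<oplus> y) \<ominus> y) \<ominus> w" unfolding e using c by (simp add: a_minus_def a_ac)
  also have "\<dots> = z \<ominus> w" using c by (simp add: a_minus_def a_assoc r_neg)
  finally show ?thesis .
qed

locale nijenhuis =
  A: unital_algebra K A for K :: "('k, 'r) ring_scheme" and A :: "('k, 'a, 'm) module_scheme" +
  fixes N :: "'a \<Rightarrow> 'a"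
  assumes nijenhuis: "nijenhuis_algebra K A N"
begin

lemma N_linear:
  "a \<in> carrier A \<Longrightarrow> N a \<in> carrier A"
  "\<lbrakk>a \<in> carrier A; b \<in> carrier A\<rbrakk> \<Longrightarrow> N (a \<oplus>\<^bsub>A\<^esub> b) = N a \<oplus>\<^bsub>A\<^esub> N b"
  "\<lbrakk>k \<in> carrier K; a \<in> carrier A\<rbrakk> \<Longrightarrow> N (k \<odot>\<^bsub>A\<^esub> a) = k \<odot>\<^bsub>A\<^esub> N a"
  using nijenhuis by (auto simp: nijenhuis_algebra_def linear_endo_def)

text \<open>
  In this form the Nijenhuis identity is an equation between sums, which additive maps preserve.
\<close>

lemma N_mult:
  assumes "a \<in> carrier A" "b \<in> carrier A"
  shows "N a \<otimes>\<^bsub>A\<^esub> N b \<oplus>\<^bsub>A\<^esub> N (N (a \<otimes>\<^bsub>A\<^esub> b)) = N (N a \<otimes>\<^bsub>A\<^esub> b) \<oplus>\<^bsub>A\<^esub> N (a \<otimes>\<^bsub>A\<^esub> N b)"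
proof -
  let ?x = "N a \<otimes>\<^bsub>A\<^esub> b \<oplus>\<^bsub>A\<^esub> a \<otimes>\<^bsub>A\<^esub> N b" and ?y = "N (a \<otimes>\<^bsub>A\<^esub> b)"
  have c: "?x \<in> carrier A" "?y \<in> carrier A" using assms by (simp_all add: N_linear)
  have "N a \<otimes>\<^bsub>A\<^esub> N b \<oplus>\<^bsub>A\<^esub> N ?y = N (?x \<ominus>\<^bsub>A\<^esub> ?y) \<oplus>\<^bsub>A\<^esub> N ?y"
    using assms nijenhuis by (simp add: nijenhuis_algebra_def)
  also have "\<dots> = N ((?x \<ominus>\<^bsub>A\<^esub> ?y) \<oplus>\<^bsub>A\<^esub> ?y)" using c by (simp add: N_linear)
  also have "(?x \<ominus>\<^bsub>A\<^esub> ?y) \<oplus>\<^bsub>A\<^esub> ?y = ?x" using c by (simp add: a_minus_def A.M.a_assoc A.M.l_neg)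
  finally show ?thesis using assms by (simp add: N_linear)
qed

text \<open>
  The instance \<open>b = 1\<close> of the Nijenhuis identity. It is what keeps balancedness over \<open>N(1)\<close>
  intact when \<open>Q\<close> acts.
\<close>

lemma N_mult_N_one:
  assumes "a \<in> carrier A"
  shows "N (a \<otimes>\<^bsub>A\<^esub> N \<one>\<^bsub>A\<^esub>) = N a \<otimes>\<^bsub>A\<^esub> N \<one>\<^bsub>A\<^esub>"
  using N_mult[OF assms A.one_closed] assms
    A.M.add.right_cancel[of "N (N a)" "N a \<otimes>\<^bsub>A\<^esub> N \<one>\<^bsub>A\<^esub>" "N (a \<otimes>\<^bsub>A\<^esub> N \<one>\<^bsub>A\<^esub>)"]
  by (simp add: N_linear A.M.a_comm)

end

locale nijenhuis_module = nijenhuis K A N + W: module K W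
  for K :: "('k, 'r) ring_scheme" and A :: "('k, 'a, 'm) module_scheme" and N
    and W :: "('k, 'w, 'n) module_scheme"
begin

abbreviation "G \<equiv> nij_functionals K A N W"
abbreviation "E \<equiv> right_endo_algebra K G"
abbreviation "fl \<equiv> functional_left A W"
abbreviation "fQ \<equiv> functional_Q A N W"

lemma G_simps:
  "\<zero>\<^bsub>G\<^esub> = (\<lambda>i a b. \<zero>\<^bsub>W\<^esub>)" "f \<oplus>\<^bsub>G\<^esub> g = (\<lambda>i a b. f i a b \<oplus>\<^bsub>W\<^esub> g i a b)"
  "k \<odot>\<^bsub>G\<^esub> f = (\<lambda>i a b. k \<odot>\<^bsub>W\<^esub> f i a b)"
  by (simp_all add: nij_functionals_def)

lemma G_memI:
  assumes "\<And>i a b. \<lbrakk>a \<in> carrier A; b \<in> carrier A\<rbrakk> \<Longrightarrow> f i a b \<in> carrier W"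
    and "\<And>i a b. a \<notin> carrier A \<or> b \<notin> carrier A \<Longrightarrow> f i a b = \<zero>\<^bsub>W\<^esub>"
    and "\<And>i a b c. \<lbrakk>a \<in> carrier A; b \<in> carrier A; c \<in> carrier A\<rbrakk> \<Longrightarrow> f i (a \<oplus>\<^bsub>A\<^esub> b) c = f i a c \<oplus>\<^bsub>W\<^esub> f i b c"
    and "\<And>i a b c. \<lbrakk>a \<in> carrier A; b \<in> carrier A; c \<in> carrier A\<rbrakk> \<Longrightarrow> f i a (b \<oplus>\<^bsub>A\<^esub> c) = f i a b \<oplus>\<^bsub>W\<^esub> f i a c"
    and "\<And>i k a b. \<lbrakk>k \<in> carrier K; a \<in> carrier A; b \<in> carrier A\<rbrakk> \<Longrightarrow> f i (k \<odot>\<^bsub>A\<^esub> a) b = k \<odot>\<^bsub>W\<^esub> f i a b"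
    and "\<And>i k a b. \<lbrakk>k \<in> carrier K; a \<in> carrier A; b \<in> carrier A\<rbrakk> \<Longrightarrow> f i a (k \<odot>\<^bsub>A\<^esub> b) = k \<odot>\<^bsub>W\<^esub> f i a b"
    and "\<And>i a b. \<lbrakk>a \<in> carrier A; b \<in> carrier A\<rbrakk> \<Longrightarrow> f i (a \<otimes>\<^bsub>A\<^esub> N \<one>\<^bsub>A\<^esub>) b = f i a (N \<one>\<^bsub>A\<^esub> \<otimes>\<^bsub>A\<^esub> b)"
    and "\<And>a b. \<lbrakk>a \<in> carrier A; b \<in> carrier A\<rbrakk> \<Longrightarrow> f 0 a b = f 0 \<one>\<^bsub>A\<^esub> (a \<otimes>\<^bsub>A\<^esub> b)"
  shows "f \<in> carrier G"
  unfolding nij_functionals_def partial_object.simps mem_Collect_eq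
  by (intro conjI allI ballI impI) (fact assms | rule assms; assumption)+

lemma G_memD:
  assumes "f \<in> carrier G"
  shows "f i a b \<in> carrier W"
    and "a \<notin> carrier A \<or> b \<notin> carrier A \<Longrightarrow> f i a b = \<zero>\<^bsub>W\<^esub>"
    and "\<lbrakk>a \<in> carrier A; b \<in> carrier A; c \<in> carrier A\<rbrakk> \<Longrightarrow> f i (a \<oplus>\<^bsub>A\<^esub> b) c = f i a c \<oplus>\<^bsub>W\<^esub> f i b c"
    and "\<lbrakk>a \<in> carrier A; b \<in> carrier A; c \<in> carrier A\<rbrakk> \<Longrightarrow> f i a (b \<oplus>\<^bsub>A\<^esub> c) = f i a b \<oplus>\<^bsub>W\<^esub> f i a c"
    and "\<lbrakk>k \<in> carrier K; a \<in> carrier A; b \<in> carrier A\<rbrakk> \<Longrightarrow> f i (k \<odot>\<^bsub>A\<^esub> a) b = k \<odot>\<^bsub>W\<^esub> f i a b"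
    and "\<lbrakk>k \<in> carrier K; a \<in> carrier A; b \<in> carrier A\<rbrakk> \<Longrightarrow> f i a (k \<odot>\<^bsub>A\<^esub> b) = k \<odot>\<^bsub>W\<^esub> f i a b"
    and "\<lbrakk>a \<in> carrier A; b \<in> carrier A\<rbrakk> \<Longrightarrow> f i (a \<otimes>\<^bsub>A\<^esub> N \<one>\<^bsub>A\<^esub>) b = f i a (N \<one>\<^bsub>A\<^esub> \<otimes>\<^bsub>A\<^esub> b)"
    and "\<lbrakk>a \<in> carrier A; b \<in> carrier A\<rbrakk> \<Longrightarrow> f 0 a b = f 0 \<one>\<^bsub>A\<^esub> (a \<otimes>\<^bsub>A\<^esub> b)"
proof -
  note f = assms[unfolded nij_functionals_def partial_object.simps mem_Collect_eq]
  show "f i a b \<in> carrier W"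
    by (cases "a \<in> carrier A \<and> b \<in> carrier A") (use f in \<open>blast, metis W.M.zero_closed\<close>)
qed (use assms[unfolded nij_functionals_def partial_object.simps mem_Collect_eq] in blast)+

lemma G_module: "module K G"
proof -
  have add: "f \<oplus>\<^bsub>G\<^esub> g \<in> carrier G" if f: "f \<in> carrier G" and g: "g \<in> carrier G" for f g
    by (rule G_memI; unfold G_simps)
      (simp_all add: G_memD(1-6)[OF f] G_memD(1-6)[OF g] W.M.a_ac W.smult_r_distr
        G_memD(7)[OF f] G_memD(7)[OF g],
       simp only: G_memD(8)[OF f, symmetric] G_memD(8)[OF g, symmetric])
  have smult: "k \<odot>\<^bsub>G\<^esub> f \<in> carrier G" if k: "k \<in> carrier K" and f: "f \<in> carrier G" for k f
    by (rule G_memI; unfold G_simps)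
      (simp_all add: k G_memD(1-6)[OF f] W.smult_r_distr W.smult_assoc1[symmetric] A.R.m_comm[OF k]
        G_memD(7)[OF f],
       simp only: G_memD(8)[OF f, symmetric])
  have zero: "\<zero>\<^bsub>G\<^esub> \<in> carrier G" by (rule G_memI; unfold G_simps) simp_all
  have ag: "abelian_group G"
  proof (rule abelian_groupI)
    fix f assume f: "f \<in> carrier G"
    have "(\<ominus>\<^bsub>K\<^esub> \<one>\<^bsub>K\<^esub>) \<odot>\<^bsub>G\<^esub> f \<oplus>\<^bsub>G\<^esub> f = \<zero>\<^bsub>G\<^esub>"
      by (simp add: G_simps G_memD(1)[OF f] W.smult_l_minus W.M.l_neg)
    then show "\<exists>g\<in>carrier G. g \<oplus>\<^bsub>G\<^esub> f = \<zero>\<^bsub>G\<^esub>" using smult[OF _ f] by blast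
    show "\<zero>\<^bsub>G\<^esub> \<oplus>\<^bsub>G\<^esub> f = f" by (simp add: G_simps G_memD(1)[OF f])
    fix g assume g: "g \<in> carrier G"
    show "f \<oplus>\<^bsub>G\<^esub> g \<in> carrier G" by (rule add[OF f g])
    show "f \<oplus>\<^bsub>G\<^esub> g = g \<oplus>\<^bsub>G\<^esub> f" by (simp add: G_simps G_memD(1)[OF f] G_memD(1)[OF g] W.M.a_comm)
    fix h assume h: "h \<in> carrier G"
    show "f \<oplus>\<^bsub>G\<^esub> g \<oplus>\<^bsub>G\<^esub> h = f \<oplus>\<^bsub>G\<^esub> (g \<oplus>\<^bsub>G\<^esub> h)"
      by (simp add: G_simps G_memD(1)[OF f] G_memD(1)[OF g] G_memD(1)[OF h] W.M.a_assoc)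
  qed (rule zero)
  show ?thesis
    by (rule moduleI[OF A.R.is_cring ag smult])
      (simp_all add: G_simps G_memD(1) W.smult_l_distr W.smult_r_distr W.smult_assoc1)
qed


lemma fl_ev: "\<lbrakk>a \<in> carrier A; b \<in> carrier A\<rbrakk> \<Longrightarrow> fl c f i a b = f i (c \<otimes>\<^bsub>A\<^esub> a) b"
  by (simp add: functional_left_def)

lemma fQ_ev: "\<lbrakk>a \<in> carrier A; b \<in> carrier A\<rbrakk> \<Longrightarrow> fQ f i a b =
    (f i (N a) b \<ominus>\<^bsub>W\<^esub> f i \<one>\<^bsub>A\<^esub> (N a \<otimes>\<^bsub>A\<^esub> b)) \<oplus>\<^bsub>W\<^esub> f (Suc i) \<one>\<^bsub>A\<^esub> (a \<otimes>\<^bsub>A\<^esub> b)"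
  by (simp add: functional_Q_def)

lemma functional_eqI:
  assumes "\<And>i a b. \<lbrakk>a \<in> carrier A; b \<in> carrier A\<rbrakk> \<Longrightarrow> f i a b = g i a b"
    and "\<And>i a b. a \<notin> carrier A \<or> b \<notin> carrier A \<Longrightarrow> f i a b = \<zero>\<^bsub>W\<^esub>"
    and "\<And>i a b. a \<notin> carrier A \<or> b \<notin> carrier A \<Longrightarrow> g i a b = \<zero>\<^bsub>W\<^esub>"
  shows "f = g"
  by (intro ext) (metis assms)

lemma fl_outside: "a \<notin> carrier A \<or> b \<notin> carrier A \<Longrightarrow> fl c f i a b = \<zero>\<^bsub>W\<^esub>"
  and fQ_outside: "a \<notin> carrier A \<or> b \<notin> carrier A \<Longrightarrow> fQ f i a b = \<zero>\<^bsub>W\<^esub>"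
  by (auto simp: functional_left_def functional_Q_def)

text \<open>
  This expresses \<open>Q \<cdot> Q\<^sup>i y = Q\<^sup>i\<^sup>+\<^sup>1 y\<close>. The remaining terms \<open>N(1) Q\<^sup>i y - Q\<^sup>i N(1) y\<close> vanish exactly because
  the families are balanced over \<open>N(1)\<close>.
\<close>

lemma fQ_one_left:
  assumes f: "f \<in> carrier G" and y: "y \<in> carrier A"
  shows "fQ f i \<one>\<^bsub>A\<^esub> y = f (Suc i) \<one>\<^bsub>A\<^esub> y"
proof -
  have "f i (N \<one>\<^bsub>A\<^esub>) y = f i \<one>\<^bsub>A\<^esub> (N \<one>\<^bsub>A\<^esub> \<otimes>\<^bsub>A\<^esub> y)"
    using G_memD(7)[OF f A.one_closed y, of i] by (simp add: N_linear)
  then show ?thesis using y by (simp add: fQ_ev G_memD(1)[OF f] a_minus_def W.M.r_neg)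
qed

lemma fl_closed:
  assumes f: "f \<in> carrier G" and c: "c \<in> carrier A"
  shows "fl c f \<in> carrier G"
proof (rule G_memI)
  fix a b assume a: "a \<in> carrier A" and b: "b \<in> carrier A"
  show "fl c f 0 a b = fl c f 0 \<one>\<^bsub>A\<^esub> (a \<otimes>\<^bsub>A\<^esub> b)"
    using a b c G_memD(8)[OF f, of "c \<otimes>\<^bsub>A\<^esub> a" b] G_memD(8)[OF f, of c "a \<otimes>\<^bsub>A\<^esub> b"]
    by (simp add: fl_ev A.m_assoc)
  fix i
  show "fl c f i (a \<otimes>\<^bsub>A\<^esub> N \<one>\<^bsub>A\<^esub>) b = fl c f i a (N \<one>\<^bsub>A\<^esub> \<otimes>\<^bsub>A\<^esub> b)"
    using a b c G_memD(7)[OF f, of "c \<otimes>\<^bsub>A\<^esub> a" b i]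
    by (simp add: fl_ev A.m_assoc N_linear)
qed (simp_all add: fl_outside fl_ev G_memD(1-6)[OF f] A.r_distr A.smult_mult_right c)

lemma fl_linear:
  assumes c: "c \<in> carrier A"
  shows "linear_endo K G (fl c)"
  unfolding linear_endo_def
  by (auto intro!: fl_closed[OF _ c] ext simp: G_simps functional_left_def)

lemma fQ_closed:
  assumes f: "f \<in> carrier G"
  shows "fQ f \<in> carrier G"
proof (rule G_memI)
  note fc = G_memD(1)[OF f]
  fix i a b assume a: "a \<in> carrier A" and b: "b \<in> carrier A"
  show "fQ f i a b \<in> carrier W" using a b by (simp add: fQ_ev fc)
  show "fQ f 0 a b = fQ f 0 \<one>\<^bsub>A\<^esub> (a \<otimes>\<^bsub>A\<^esub> b)"
    using a b G_memD(8)[OF f, of "N a" b]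
    by (simp add: fQ_one_left[OF f]) (simp add: fQ_ev fc N_linear a_minus_def W.M.r_neg)
  show "fQ f i (a \<otimes>\<^bsub>A\<^esub> N \<one>\<^bsub>A\<^esub>) b = fQ f i a (N \<one>\<^bsub>A\<^esub> \<otimes>\<^bsub>A\<^esub> b)"
    using a b G_memD(7)[OF f, of "N a" b i]
    by (simp add: fQ_ev N_mult_N_one N_linear A.m_assoc)
  fix k assume k: "k \<in> carrier K"
  show "fQ f i (k \<odot>\<^bsub>A\<^esub> a) b = k \<odot>\<^bsub>W\<^esub> fQ f i a b" "fQ f i a (k \<odot>\<^bsub>A\<^esub> b) = k \<odot>\<^bsub>W\<^esub> fQ f i a b"
    using a b k
    by (simp_all add: fQ_ev fc N_linear A.smult_mult_left A.smult_mult_right G_memD(5,6)[OF f]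
        a_minus_def W.smult_r_distr W.smult_r_minus)
next
  note fc = G_memD(1)[OF f]
  fix i a b c assume a: "a \<in> carrier A" and b: "b \<in> carrier A" and c: "c \<in> carrier A"
  show "fQ f i (a \<oplus>\<^bsub>A\<^esub> b) c = fQ f i a c \<oplus>\<^bsub>W\<^esub> fQ f i b c" "fQ f i a (b \<oplus>\<^bsub>A\<^esub> c) = fQ f i a b \<oplus>\<^bsub>W\<^esub> fQ f i a c"
    using a b c
    by (simp_all add: fQ_ev fc N_linear A.l_distr A.r_distr G_memD(3,4)[OF f]
        a_minus_def W.M.minus_add W.M.a_ac)
qed (rule fQ_outside)

lemma fQ_linear: "linear_endo K G fQ"
  unfolding linear_endo_def
proof (intro conjI ballI)
  show "fQ \<in> carrier G \<rightarrow> carrier G" using fQ_closed by blast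
next
  fix f g assume f: "f \<in> carrier G" and g: "g \<in> carrier G"
  show "fQ (f \<oplus>\<^bsub>G\<^esub> g) = fQ f \<oplus>\<^bsub>G\<^esub> fQ g"
    by (intro ext) (simp add: functional_Q_def G_simps G_memD(1)[OF f] G_memD(1)[OF g]
        a_minus_def W.M.minus_add W.M.a_ac)
next
  fix k f assume k: "k \<in> carrier K" and f: "f \<in> carrier G"
  show "fQ (k \<odot>\<^bsub>G\<^esub> f) = k \<odot>\<^bsub>G\<^esub> fQ f"
    by (intro ext) (simp add: functional_Q_def G_simps G_memD(1)[OF f] k
        a_minus_def W.smult_r_distr W.smult_r_minus)
qed

text \<open>
  The two images of the Nijenhuis identity that occur in the next proof: under \<open>f i\<close> in the
  first argument, and under \<open>f i 1\<close> after multiplication by \<open>b\<close>.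
\<close>

lemma N_mult_bilinear:
  assumes f: "f \<in> carrier G" and c: "c \<in> carrier A" and a: "a \<in> carrier A" and b: "b \<in> carrier A"
  shows "f i (N c \<otimes>\<^bsub>A\<^esub> N a) b \<oplus>\<^bsub>W\<^esub> f i (N (N (c \<otimes>\<^bsub>A\<^esub> a))) b =
      f i (N (N c \<otimes>\<^bsub>A\<^esub> a)) b \<oplus>\<^bsub>W\<^esub> f i (N (c \<otimes>\<^bsub>A\<^esub> N a)) b"
    and "f i \<one>\<^bsub>A\<^esub> (N c \<otimes>\<^bsub>A\<^esub> N a \<otimes>\<^bsub>A\<^esub> b) \<oplus>\<^bsub>W\<^esub> f i \<one>\<^bsub>A\<^esub> (N (N (c \<otimes>\<^bsub>A\<^esub> a)) \<otimes>\<^bsub>A\<^esub> b) =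
      f i \<one>\<^bsub>A\<^esub> (N (N c \<otimes>\<^bsub>A\<^esub> a) \<otimes>\<^bsub>A\<^esub> b) \<oplus>\<^bsub>W\<^esub> f i \<one>\<^bsub>A\<^esub> (N (c \<otimes>\<^bsub>A\<^esub> N a) \<otimes>\<^bsub>A\<^esub> b)"
proof -
  show "f i (N c \<otimes>\<^bsub>A\<^esub> N a) b \<oplus>\<^bsub>W\<^esub> f i (N (N (c \<otimes>\<^bsub>A\<^esub> a))) b =
      f i (N (N c \<otimes>\<^bsub>A\<^esub> a)) b \<oplus>\<^bsub>W\<^esub> f i (N (c \<otimes>\<^bsub>A\<^esub> N a)) b"
    using N_mult[OF c a] a b c by (simp add: G_memD(3)[OF f, symmetric] N_linear(1))
  have "f i \<one>\<^bsub>A\<^esub> ((N c \<otimes>\<^bsub>A\<^esub> N a \<oplus>\<^bsub>A\<^esub> N (N (c \<otimes>\<^bsub>A\<^esub> a))) \<otimes>\<^bsub>A\<^esub> b) =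
      f i \<one>\<^bsub>A\<^esub> ((N (N c \<otimes>\<^bsub>A\<^esub> a) \<oplus>\<^bsub>A\<^esub> N (c \<otimes>\<^bsub>A\<^esub> N a)) \<otimes>\<^bsub>A\<^esub> b)"
    using N_mult[OF c a] by simp
  then show "f i \<one>\<^bsub>A\<^esub> (N c \<otimes>\<^bsub>A\<^esub> N a \<otimes>\<^bsub>A\<^esub> b) \<oplus>\<^bsub>W\<^esub> f i \<one>\<^bsub>A\<^esub> (N (N (c \<otimes>\<^bsub>A\<^esub> a)) \<otimes>\<^bsub>A\<^esub> b) =
      f i \<one>\<^bsub>A\<^esub> (N (N c \<otimes>\<^bsub>A\<^esub> a) \<otimes>\<^bsub>A\<^esub> b) \<oplus>\<^bsub>W\<^esub> f i \<one>\<^bsub>A\<^esub> (N (c \<otimes>\<^bsub>A\<^esub> N a) \<otimes>\<^bsub>A\<^esub> b)"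
    using a b c by (simp add: G_memD(4)[OF f] N_linear(1) A.l_distr)
qed

text \<open>
  Both sides expand by the definition of the action into values of \<open>f\<close> in the degrees \<open>i\<close>,
  \<open>i + 1\<close> and \<open>i + 2\<close>. The terms of degree above \<open>i\<close> agree up to cancellation, and those of degree
  \<open>i\<close> differ by the two equations of \<open>N_mult_bilinear\<close>.
\<close>

lemma fQ_relation:
  assumes f: "f \<in> carrier G" and c: "c \<in> carrier A" and a: "a \<in> carrier A" and b: "b \<in> carrier A"
  shows "fQ (fl c (fQ f)) i a b =
    (fQ (fl (N c) f) i a b \<ominus>\<^bsub>W\<^esub> fl (N c) (fQ f) i a b) \<oplus>\<^bsub>W\<^esub> fl c (fQ (fQ f)) i a b"
proof -
  note [simp] = G_memD(1)[OF f] N_linear(1) a b c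
  \<comment> \<open>\<open>P\<close> and \<open>R\<close>: the two families of degree \<open>i\<close> related by the Nijenhuis identity; all other terms match or cancel.\<close>
  define P1 P2 P3 P4 where P: "P1 = f i (N (c \<otimes>\<^bsub>A\<^esub> N a)) b" "P2 = f i (N (N c \<otimes>\<^bsub>A\<^esub> a)) b"
    "P3 = f i (N c \<otimes>\<^bsub>A\<^esub> N a) b" "P4 = f i (N (N (c \<otimes>\<^bsub>A\<^esub> a))) b"
  define R1 R2 R3 R4 where R: "R1 = f i \<one>\<^bsub>A\<^esub> (N (c \<otimes>\<^bsub>A\<^esub> N a) \<otimes>\<^bsub>A\<^esub> b)" "R2 = f i \<one>\<^bsub>A\<^esub> (N (N c \<otimes>\<^bsub>A\<^esub> a) \<otimes>\<^bsub>A\<^esub> b)"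
    "R3 = f i \<one>\<^bsub>A\<^esub> (N c \<otimes>\<^bsub>A\<^esub> N a \<otimes>\<^bsub>A\<^esub> b)" "R4 = f i \<one>\<^bsub>A\<^esub> (N (N (c \<otimes>\<^bsub>A\<^esub> a)) \<otimes>\<^bsub>A\<^esub> b)"
  define D E1 X1 X2 X3 Y where D: "D = f i (N c) (N a \<otimes>\<^bsub>A\<^esub> b)" "E1 = f (Suc i) (N c) (a \<otimes>\<^bsub>A\<^esub> b)"
    "X1 = f (Suc i) \<one>\<^bsub>A\<^esub> (c \<otimes>\<^bsub>A\<^esub> N a \<otimes>\<^bsub>A\<^esub> b)" "X2 = f (Suc i) \<one>\<^bsub>A\<^esub> (N c \<otimes>\<^bsub>A\<^esub> a \<otimes>\<^bsub>A\<^esub> b)"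
    "X3 = f (Suc i) \<one>\<^bsub>A\<^esub> (N (c \<otimes>\<^bsub>A\<^esub> a) \<otimes>\<^bsub>A\<^esub> b)" "Y = f (Suc (Suc i)) \<one>\<^bsub>A\<^esub> (c \<otimes>\<^bsub>A\<^esub> a \<otimes>\<^bsub>A\<^esub> b)"
  have Wc: "P1 \<in> carrier W" "P2 \<in> carrier W" "P3 \<in> carrier W" "P4 \<in> carrier W"
    "R1 \<in> carrier W" "R2 \<in> carrier W" "R3 \<in> carrier W" "R4 \<in> carrier W"
    "D \<in> carrier W" "E1 \<in> carrier W" "X1 \<in> carrier W" "X2 \<in> carrier W" "X3 \<in> carrier W" "Y \<in> carrier W"
    by (simp_all add: P R D)
  have eq: "P3 \<oplus>\<^bsub>W\<^esub> P4 = P2 \<oplus>\<^bsub>W\<^esub> P1" "R3 \<oplus>\<^bsub>W\<^esub> R4 = R2 \<oplus>\<^bsub>W\<^esub> R1"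
    unfolding P R using N_mult_bilinear[OF f c a b] by auto
  have L: "fQ (fl c (fQ f)) i a b =
      (((P1 \<ominus>\<^bsub>W\<^esub> R1) \<oplus>\<^bsub>W\<^esub> X1) \<ominus>\<^bsub>W\<^esub> ((D \<ominus>\<^bsub>W\<^esub> R3) \<oplus>\<^bsub>W\<^esub> X1)) \<oplus>\<^bsub>W\<^esub> ((E1 \<ominus>\<^bsub>W\<^esub> X2) \<oplus>\<^bsub>W\<^esub> Y)"
    by (simp add: fQ_ev fl_ev P R D A.m_assoc)
  have M1: "fQ (fl (N c) f) i a b = (P3 \<ominus>\<^bsub>W\<^esub> D) \<oplus>\<^bsub>W\<^esub> E1"
    and M2: "fl (N c) (fQ f) i a b = (P2 \<ominus>\<^bsub>W\<^esub> R2) \<oplus>\<^bsub>W\<^esub> X2"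
    by (simp_all add: fQ_ev fl_ev P R D)
  have M3: "fl c (fQ (fQ f)) i a b = (((P4 \<ominus>\<^bsub>W\<^esub> R4) \<oplus>\<^bsub>W\<^esub> X3) \<ominus>\<^bsub>W\<^esub> X3) \<oplus>\<^bsub>W\<^esub> Y"
  proof -
    have "fl c (fQ (fQ f)) i a b = (fQ f i (N (c \<otimes>\<^bsub>A\<^esub> a)) b \<ominus>\<^bsub>W\<^esub> X3) \<oplus>\<^bsub>W\<^esub> Y"
      by (simp add: fl_ev fQ_ev[of "c \<otimes>\<^bsub>A\<^esub> a" b "fQ f"] fQ_one_left[OF f] D)
    then show ?thesis by (simp add: fQ_ev P R D)
  qed
  have "(P1 \<oplus>\<^bsub>W\<^esub> X1 \<oplus>\<^bsub>W\<^esub> R3 \<oplus>\<^bsub>W\<^esub> E1 \<oplus>\<^bsub>W\<^esub> Y) \<oplus>\<^bsub>W\<^esub> (D \<oplus>\<^bsub>W\<^esub> P2 \<oplus>\<^bsub>W\<^esub> X2 \<oplus>\<^bsub>W\<^esub> R4 \<oplus>\<^bsub>W\<^esub> X3) =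
      (P2 \<oplus>\<^bsub>W\<^esub> P1) \<oplus>\<^bsub>W\<^esub> ((R3 \<oplus>\<^bsub>W\<^esub> R4) \<oplus>\<^bsub>W\<^esub> (X1 \<oplus>\<^bsub>W\<^esub> E1 \<oplus>\<^bsub>W\<^esub> Y \<oplus>\<^bsub>W\<^esub> D \<oplus>\<^bsub>W\<^esub> X2 \<oplus>\<^bsub>W\<^esub> X3))"
    using Wc by (simp add: W.M.a_ac)
  also have "\<dots> = (P3 \<oplus>\<^bsub>W\<^esub> E1 \<oplus>\<^bsub>W\<^esub> R2 \<oplus>\<^bsub>W\<^esub> P4 \<oplus>\<^bsub>W\<^esub> X3 \<oplus>\<^bsub>W\<^esub> Y) \<oplus>\<^bsub>W\<^esub> (R1 \<oplus>\<^bsub>W\<^esub> D \<oplus>\<^bsub>W\<^esub> X1 \<oplus>\<^bsub>W\<^esub> X2)"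
    unfolding eq(2) unfolding eq(1)[symmetric] using Wc by (simp add: W.M.a_ac)
  finally have pos: "(P1 \<oplus>\<^bsub>W\<^esub> X1 \<oplus>\<^bsub>W\<^esub> R3 \<oplus>\<^bsub>W\<^esub> E1 \<oplus>\<^bsub>W\<^esub> Y) \<ominus>\<^bsub>W\<^esub> (R1 \<oplus>\<^bsub>W\<^esub> D \<oplus>\<^bsub>W\<^esub> X1 \<oplus>\<^bsub>W\<^esub> X2) =
      (P3 \<oplus>\<^bsub>W\<^esub> E1 \<oplus>\<^bsub>W\<^esub> R2 \<oplus>\<^bsub>W\<^esub> P4 \<oplus>\<^bsub>W\<^esub> X3 \<oplus>\<^bsub>W\<^esub> Y) \<ominus>\<^bsub>W\<^esub> (D \<oplus>\<^bsub>W\<^esub> P2 \<oplus>\<^bsub>W\<^esub> X2 \<oplus>\<^bsub>W\<^esub> R4 \<oplus>\<^bsub>W\<^esub> X3)"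
    using Wc by (intro W.M.minus_eq_minusI) simp_all
  have "fQ (fl c (fQ f)) i a b = (P1 \<oplus>\<^bsub>W\<^esub> X1 \<oplus>\<^bsub>W\<^esub> R3 \<oplus>\<^bsub>W\<^esub> E1 \<oplus>\<^bsub>W\<^esub> Y) \<ominus>\<^bsub>W\<^esub> (R1 \<oplus>\<^bsub>W\<^esub> D \<oplus>\<^bsub>W\<^esub> X1 \<oplus>\<^bsub>W\<^esub> X2)"
    unfolding L using Wc by (simp add: W.M.minus_simps W.M.a_ac)
  also note pos
  also have "(P3 \<oplus>\<^bsub>W\<^esub> E1 \<oplus>\<^bsub>W\<^esub> R2 \<oplus>\<^bsub>W\<^esub> P4 \<oplus>\<^bsub>W\<^esub> X3 \<oplus>\<^bsub>W\<^esub> Y) \<ominus>\<^bsub>W\<^esub> (D \<oplus>\<^bsub>W\<^esub> P2 \<oplus>\<^bsub>W\<^esub> X2 \<oplus>\<^bsub>W\<^esub> R4 \<oplus>\<^bsub>W\<^esub> X3) =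
      (fQ (fl (N c) f) i a b \<ominus>\<^bsub>W\<^esub> fl (N c) (fQ f) i a b) \<oplus>\<^bsub>W\<^esub> fl c (fQ (fQ f)) i a b"
    unfolding M1 M2 M3 using Wc by (simp add: W.M.minus_simps W.M.a_ac)
  finally show ?thesis .
qed

lemma restrict_endo: "linear_endo K G \<phi> \<Longrightarrow> restrict \<phi> (carrier G) \<in> carrier E"
proof -
  interpret G: module K G by (rule G_module)
  show "linear_endo K G \<phi> \<Longrightarrow> restrict \<phi> (carrier G) \<in> carrier E"
    by (auto simp: right_endo_algebra_simps linear_endo_def Pi_def)
qed

lemma fl_algebra_hom: "(\<lambda>c. restrict (fl c) (carrier G)) \<in> algebra_hom K A E"
  unfolding algebra_hom_def
proof (intro CollectI conjI ballI ring_hom_memI)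
  fix c assume c: "c \<in> carrier A"
  show "restrict (fl c) (carrier G) \<in> carrier E" by (rule restrict_endo[OF fl_linear[OF c]])
  show "restrict (fl (k \<odot>\<^bsub>A\<^esub> c)) (carrier G) = k \<odot>\<^bsub>E\<^esub> restrict (fl c) (carrier G)" if "k \<in> carrier K" for k
    using c that unfolding right_endo_algebra_simps
    by (intro restrict_ext functional_eqI)
      (simp_all add: fl_ev fl_outside G_simps G_memD(5) A.smult_mult_left)
  fix d assume d: "d \<in> carrier A"
  show "restrict (fl (c \<otimes>\<^bsub>A\<^esub> d)) (carrier G) = restrict (fl c) (carrier G) \<otimes>\<^bsub>E\<^esub> restrict (fl d) (carrier G)"
    using c d fl_closed unfolding right_endo_algebra_simps
    by (intro restrict_ext functional_eqI) (simp_all add: fl_ev fl_outside A.m_assoc)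
  show "restrict (fl (c \<oplus>\<^bsub>A\<^esub> d)) (carrier G) = restrict (fl c) (carrier G) \<oplus>\<^bsub>E\<^esub> restrict (fl d) (carrier G)"
    using c d unfolding right_endo_algebra_simps
    by (intro restrict_ext functional_eqI)
      (simp_all add: fl_ev fl_outside G_simps G_memD(3) A.l_distr)
next
  show "restrict (fl \<one>\<^bsub>A\<^esub>) (carrier G) = \<one>\<^bsub>E\<^esub>"
    unfolding right_endo_algebra_simps
    by (intro restrict_ext functional_eqI) (simp_all add: fl_ev fl_outside G_memD(2))
qed

text \<open>
  The right action of \<open>U\<close> on the families: \<open>fQ_relation\<close> is the relation that the universal property
  of \<open>U\<close> asks for.
\<close>

lemma functional_representation:
  "\<exists>\<rho>\<in>algebra_hom K (nij_operators K A N) E.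
    (\<forall>c\<in>carrier A. \<rho> (nij_emb K A N c) = restrict (fl c) (carrier G)) \<and>
    \<rho> (nij_Q K A N) = restrict fQ (carrier G)"
proof (rule nij_operators_lift[OF nijenhuis module.right_endo_algebra_unital_algebra[OF G_module]
      fl_algebra_hom restrict_endo[OF fQ_linear]])
  interpret G: module K G by (rule G_module)
  interpret E: unital_algebra K E by (rule G.right_endo_algebra_unital_algebra)
  fix c assume c: "c \<in> carrier A"
  let ?h = "\<lambda>c. restrict (fl c) (carrier G)" and ?q = "restrict fQ (carrier G)"
  note hc = restrict_endo[OF fl_linear[OF c]] restrict_endo[OF fl_linear[OF N_linear(1)[OF c]]]
    and qc = restrict_endo[OF fQ_linear]
  have "?q \<otimes>\<^bsub>E\<^esub> ?h c \<otimes>\<^bsub>E\<^esub> ?q \<oplus>\<^bsub>E\<^esub> ?q \<otimes>\<^bsub>E\<^esub> ?h (N c) =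
      ?h (N c) \<otimes>\<^bsub>E\<^esub> ?q \<oplus>\<^bsub>E\<^esub> (?q \<otimes>\<^bsub>E\<^esub> ?q) \<otimes>\<^bsub>E\<^esub> ?h c"
  proof (rule extensionalityI[of _ "carrier G"])
    fix f assume f: "f \<in> carrier G"
    have N: "N c \<in> carrier A" by (rule N_linear(1)[OF c])
    note closed = f c N fQ_closed fl_closed
    have "fQ (fl c (fQ f)) \<oplus>\<^bsub>G\<^esub> fl (N c) (fQ f) = fQ (fl (N c) f) \<oplus>\<^bsub>G\<^esub> fl c (fQ (fQ f))"
    proof (rule functional_eqI; unfold G_simps)
      fix i a b assume "a \<in> carrier A" "b \<in> carrier A"
      note r = fQ_relation[OF f c this]
      note wc = G_memD(1)[OF fQ_closed[OF fl_closed[OF fQ_closed[OF f] c]], of i a b]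
        G_memD(1)[OF fQ_closed[OF fl_closed[OF f N]], of i a b]
        G_memD(1)[OF fl_closed[OF fQ_closed[OF fQ_closed[OF f]] c], of i a b]
        G_memD(1)[OF fl_closed[OF fQ_closed[OF f] N], of i a b]
      show "fQ (fl c (fQ f)) i a b \<oplus>\<^bsub>W\<^esub> fl (N c) (fQ f) i a b =
          fQ (fl (N c) f) i a b \<oplus>\<^bsub>W\<^esub> fl c (fQ (fQ f)) i a b"
        by (subst W.M.add_eq_iff_eq_minus[OF wc(1) W.M.a_closed[OF wc(2,3)] wc(4)])
          (use wc in \<open>simp only: r W.M.minus_simps\<close>)
    qed (simp_all add: fQ_outside fl_outside)
    then show "(?q \<otimes>\<^bsub>E\<^esub> ?h c \<otimes>\<^bsub>E\<^esub> ?q \<oplus>\<^bsub>E\<^esub> ?q \<otimes>\<^bsub>E\<^esub> ?h (N c)) f =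
      (?h (N c) \<otimes>\<^bsub>E\<^esub> ?q \<oplus>\<^bsub>E\<^esub> (?q \<otimes>\<^bsub>E\<^esub> ?q) \<otimes>\<^bsub>E\<^esub> ?h c) f"
      by (simp add: right_endo_algebra_simps(2,5) closed)
  qed (simp_all add: right_endo_algebra_simps(2,5))
  then have "?q \<otimes>\<^bsub>E\<^esub> ?h c \<otimes>\<^bsub>E\<^esub> ?q =
      (?h (N c) \<otimes>\<^bsub>E\<^esub> ?q \<oplus>\<^bsub>E\<^esub> (?q \<otimes>\<^bsub>E\<^esub> ?q) \<otimes>\<^bsub>E\<^esub> ?h c) \<ominus>\<^bsub>E\<^esub> ?q \<otimes>\<^bsub>E\<^esub> ?h (N c)"
    using hc qc by (subst (asm) E.M.add_eq_iff_eq_minus) simp_all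
  then show "?q \<otimes>\<^bsub>E\<^esub> ?h c \<otimes>\<^bsub>E\<^esub> ?q = (?h (N c) \<otimes>\<^bsub>E\<^esub> ?q \<ominus>\<^bsub>E\<^esub> ?q \<otimes>\<^bsub>E\<^esub> ?h (N c)) \<oplus>\<^bsub>E\<^esub> (?q \<otimes>\<^bsub>E\<^esub> ?q) \<otimes>\<^bsub>E\<^esub> ?h c"
    using hc qc by (simp only: E.M.minus_simps E.m_closed)
qed

text \<open>
  Iterating \<open>fQ_one_left\<close>: acting by \<open>Q\<^sup>n\<close> shifts the values on the elements \<open>Q\<^sup>i y\<close> by \<open>n\<close> degrees.
\<close>

lemma fQ_pow:
  assumes f: "f \<in> carrier G" and y: "y \<in> carrier A"
  shows "(fQ ^^ n) f \<in> carrier G" and "(fQ ^^ n) f i \<one>\<^bsub>A\<^esub> y = f (i + n) \<one>\<^bsub>A\<^esub> y"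
proof -
  show c: "(fQ ^^ n) f \<in> carrier G" for n by (induction n) (simp_all add: f fQ_closed)
  show "(fQ ^^ n) f i \<one>\<^bsub>A\<^esub> y = f (i + n) \<one>\<^bsub>A\<^esub> y"
    by (induction n arbitrary: i) (simp_all add: fQ_one_left[OF c y])
qed

text \<open>
  The linear map is \<open>u \<mapsto> (f \<cdot> u)(1)\<close>. To compute it at \<open>a Q\<^sup>n b\<close>, act by \<open>a\<close>, by \<open>Q\<^sup>n\<close> and by \<open>b\<close>; in degree
  zero \<open>b\<close> may be moved to the second argument, where \<open>fQ_pow\<close> applies.
\<close>

lemma functional_evaluation:
  assumes f: "f \<in> carrier G"
  shows "\<exists>p. p \<in> carrier (nij_operators K A N) \<rightarrow> carrier W \<and>
    (\<forall>u\<in>carrier (nij_operators K A N). \<forall>v\<in>carrier (nij_operators K A N).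
      p (u \<oplus>\<^bsub>nij_operators K A N\<^esub> v) = p u \<oplus>\<^bsub>W\<^esub> p v) \<and>
    (\<forall>k\<in>carrier K. \<forall>u\<in>carrier (nij_operators K A N).
      p (k \<odot>\<^bsub>nij_operators K A N\<^esub> u) = k \<odot>\<^bsub>W\<^esub> p u) \<and>
    (\<forall>a\<in>carrier A. \<forall>b\<in>carrier A. \<forall>n. p (nij_emb K A N a \<otimes>\<^bsub>nij_operators K A N\<^esub>
      nij_Q K A N [^]\<^bsub>nij_operators K A N\<^esub> n \<otimes>\<^bsub>nij_operators K A N\<^esub> nij_emb K A N b) = f n a b)"
proof -
  let ?U = "nij_operators K A N" and ?\<iota> = "nij_emb K A N" and ?Q = "nij_Q K A N"
  note U = nij_operators_unital_algebra[OF nijenhuis]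
  interpret U: unital_algebra K ?U by (rule U)
  interpret G: module K G by (rule G_module)
  obtain \<rho> where \<rho>: "\<rho> \<in> algebra_hom K ?U E"
    and "(\<forall>c\<in>carrier A. \<rho> (?\<iota> c) = restrict (fl c) (carrier G)) \<and> \<rho> ?Q = restrict fQ (carrier G)"
    by (rule bexE[OF functional_representation])
  then have \<rho>\<iota>: "\<rho> (?\<iota> c) g = fl c g" and \<rho>Q: "\<rho> ?Q g = fQ g" if "c \<in> carrier A" "g \<in> carrier G" for c g
    using that by simp_all
  note h = algebra_homD[OF \<rho>]
  have \<iota>c: "?\<iota> c \<in> carrier ?U" if "c \<in> carrier A" for c using algebra_homD(1)[OF U(2) that] .
  have \<rho>c: "\<rho> u f \<in> carrier G" if "u \<in> carrier ?U" for u
    using h(1)[OF that] f by (auto simp: right_endo_algebra_simps linear_endo_def)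
  have pow: "\<rho> (?Q [^]\<^bsub>?U\<^esub> (n::nat)) g = (fQ ^^ n) g" if g: "g \<in> carrier G" for n g
  proof (induction n)
    case 0
    show ?case using g by (simp add: h(4) right_endo_algebra_simps)
  next
    case (Suc n)
    then show ?case using g U(3) fQ_pow(1)[OF g A.one_closed, of n]
      by (simp add: h(3) right_endo_algebra_simps(2) \<rho>Q[OF A.one_closed])
  qed
  define p where "p u = \<rho> u f 0 \<one>\<^bsub>A\<^esub> \<one>\<^bsub>A\<^esub>" for u
  have "p \<in> carrier ?U \<rightarrow> carrier W" unfolding p_def by (rule funcsetI) (rule G_memD(1)[OF \<rho>c])
  moreover have "p (u \<oplus>\<^bsub>?U\<^esub> v) = p u \<oplus>\<^bsub>W\<^esub> p v" if "u \<in> carrier ?U" "v \<in> carrier ?U" for u v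
    using that f by (simp add: p_def h(2) right_endo_algebra_simps(5) G_simps)
  moreover have "p (k \<odot>\<^bsub>?U\<^esub> u) = k \<odot>\<^bsub>W\<^esub> p u" if "k \<in> carrier K" "u \<in> carrier ?U" for k u
    using that f by (simp add: p_def h(5) right_endo_algebra_simps(6) G_simps)
  moreover have "p (?\<iota> a \<otimes>\<^bsub>?U\<^esub> ?Q [^]\<^bsub>?U\<^esub> n \<otimes>\<^bsub>?U\<^esub> ?\<iota> b) = f n a b"
    if a: "a \<in> carrier A" and b: "b \<in> carrier A" for a b and n :: nat
  proof -
    let ?g = "fl a f"
    have g: "?g \<in> carrier G" by (rule fl_closed[OF f a])
    have "\<rho> (?\<iota> a \<otimes>\<^bsub>?U\<^esub> ?Q [^]\<^bsub>?U\<^esub> n \<otimes>\<^bsub>?U\<^esub> ?\<iota> b) f = fl b ((fQ ^^ n) ?g)"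
      using f g a b U(3) fQ_pow(1)[OF g A.one_closed, of n]
      by (simp add: h(3) \<iota>c right_endo_algebra_simps(2) pow \<rho>\<iota>)
    then have "p (?\<iota> a \<otimes>\<^bsub>?U\<^esub> ?Q [^]\<^bsub>?U\<^esub> n \<otimes>\<^bsub>?U\<^esub> ?\<iota> b) = (fQ ^^ n) ?g 0 b \<one>\<^bsub>A\<^esub>"
      using b by (simp add: p_def fl_ev)
    also have "\<dots> = (fQ ^^ n) ?g 0 \<one>\<^bsub>A\<^esub> b"
      using G_memD(8)[OF fQ_pow(1)[OF g b] b A.one_closed] b by simp
    also have "\<dots> = f n a b" using fQ_pow(2)[OF g b, of n 0] a b by (simp add: fl_ev)
    finally show ?thesis .
  qed
  ultimately show ?thesis by (intro exI[of _ p] conjI ballI allI)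
qed

end

section \<open>Multiplication of the normal forms\<close>

text \<open>
  The two cancellations that drive the inductions on the exponents of \<open>Q\<close>.
\<close>

lemma (in abelian_group) minus_telescope:
  assumes "x \<in> carrier G" "y \<in> carrier G" "z \<in> carrier G" "w \<in> carrier G"
  shows "(x \<ominus> y) \<oplus> ((y \<ominus> z) \<oplus> w) = (x \<ominus> z) \<oplus> w"
    and "(((x \<ominus> z) \<oplus> y) \<ominus> y) \<oplus> w = (x \<ominus> z) \<oplus> w"
proof -
  have "(x \<oplus> (y \<oplus> w)) \<ominus> (y \<oplus> z) = (x \<oplus> w) \<ominus> z" "(x \<oplus> y \<oplus> w) \<ominus> (z \<oplus> y) = (x \<oplus> w) \<ominus> z"
    using assms by (auto intro!: minus_eq_minusI simp: a_ac)
  then show "(x \<ominus> y) \<oplus> ((y \<ominus> z) \<oplus> w) = (x \<ominus> z) \<oplus> w"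
    and "(((x \<ominus> z) \<oplus> y) \<ominus> y) \<oplus> w = (x \<ominus> z) \<oplus> w"
    using assms by (simp_all add: minus_simps)
qed

context nijenhuis
begin

abbreviation "U \<equiv> nij_operators K A N"
abbreviation "\<iota> \<equiv> nij_emb K A N"
abbreviation "Q \<equiv> nij_Q K A N"

lemmas U_unital_algebra = nij_operators_unital_algebra(1)[OF nijenhuis]
lemmas Q_closed = nij_operators_unital_algebra(3)[OF nijenhuis]
lemmas Q_relation = nij_operators_unital_algebra(4)[OF nijenhuis]
lemmas \<iota> = algebra_homD[OF nij_operators_unital_algebra(2)[OF nijenhuis]]

end

sublocale nijenhuis \<subseteq> U: unital_algebra K U
  by (rule U_unital_algebra)

context nijenhuis
begin

text \<open>
  The zero element satisfies the relation required of \<open>Q\<close>, so the identity of \<open>A\<close> extends to \<open>U\<close>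
  by \<open>Q \<mapsto> 0\<close>.
\<close>

lemma emb_inj: "inj_on \<iota> (carrier A)"
proof -
  obtain \<Phi> where "\<Phi> \<in> algebra_hom K U A" and "(\<forall>a\<in>carrier A. \<Phi> (\<iota> a) = a) \<and> \<Phi> Q = \<zero>\<^bsub>A\<^esub>"
    by (rule bexE[OF nij_operators_lift[OF nijenhuis A.unital_algebra_axioms algebra_hom_id A.M.zero_closed]])
      (simp_all add: N_linear a_minus_def)
  then show ?thesis by (intro inj_on_inverseI[of _ \<Phi>]) simp
qed

lemma N_pow_closed: "a \<in> carrier A \<Longrightarrow> (N ^^ n) a \<in> carrier A"
  by (induction n) (simp_all add: N_linear)

lemma Q_pow_closed: "Q [^]\<^bsub>U\<^esub> (n::nat) \<in> carrier U"
  by (simp add: Q_closed)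

text \<open>
  Rewriting \<open>Q a Q\<close> by the relation leaves \<open>N(a) Q\<^sup>m\<^sup>+\<^sup>1 - Q N(a) Q\<^sup>m + Q (Q a Q\<^sup>m)\<close>; the induction hypothesis
  for the last term produces \<open>Q N(a) Q\<^sup>m\<close> once more, with the opposite sign.
\<close>

lemma Q_emb_Q_pow:
  assumes a: "a \<in> carrier A"
  shows "Q \<otimes>\<^bsub>U\<^esub> \<iota> a \<otimes>\<^bsub>U\<^esub> Q [^]\<^bsub>U\<^esub> (m::nat) =
    (\<iota> (N a) \<otimes>\<^bsub>U\<^esub> Q [^]\<^bsub>U\<^esub> m \<ominus>\<^bsub>U\<^esub> Q [^]\<^bsub>U\<^esub> m \<otimes>\<^bsub>U\<^esub> \<iota> (N a)) \<oplus>\<^bsub>U\<^esub> Q [^]\<^bsub>U\<^esub> Suc m \<otimes>\<^bsub>U\<^esub> \<iota> a"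
proof (induction m)
  case 0
  show ?case using a by (simp add: \<iota> N_linear Q_closed a_minus_def U.M.r_neg)
next
  case (Suc m)
  let ?P = "Q [^]\<^bsub>U\<^esub> m" and ?a = "\<iota> a" and ?b = "\<iota> (N a)"
  have c: "?P \<in> carrier U" "?a \<in> carrier U" "?b \<in> carrier U" "Q \<in> carrier U"
    using a by (simp_all add: \<iota> N_linear Q_closed)
  note sd = U.l_distr U.r_distr U.l_minus U.r_minus a_minus_def U.m_assoc
  have pow: "Q [^]\<^bsub>U\<^esub> Suc k = Q \<otimes>\<^bsub>U\<^esub> Q [^]\<^bsub>U\<^esub> k" for k :: nat by (rule U.nat_pow_Suc2[OF Q_closed])
  have "Q \<otimes>\<^bsub>U\<^esub> ?a \<otimes>\<^bsub>U\<^esub> Q [^]\<^bsub>U\<^esub> Suc m = (Q \<otimes>\<^bsub>U\<^esub> ?a \<otimes>\<^bsub>U\<^esub> Q) \<otimes>\<^bsub>U\<^esub> ?P"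
    using c unfolding pow by (simp only: U.m_assoc U.m_closed)
  also have "\<dots> = (?b \<otimes>\<^bsub>U\<^esub> (Q \<otimes>\<^bsub>U\<^esub> ?P) \<ominus>\<^bsub>U\<^esub> Q \<otimes>\<^bsub>U\<^esub> ?b \<otimes>\<^bsub>U\<^esub> ?P) \<oplus>\<^bsub>U\<^esub> Q \<otimes>\<^bsub>U\<^esub> (Q \<otimes>\<^bsub>U\<^esub> ?a \<otimes>\<^bsub>U\<^esub> ?P)"
    unfolding Q_relation[OF a] using c by (simp add: sd)
  also have "Q \<otimes>\<^bsub>U\<^esub> (Q \<otimes>\<^bsub>U\<^esub> ?a \<otimes>\<^bsub>U\<^esub> ?P) = (Q \<otimes>\<^bsub>U\<^esub> ?b \<otimes>\<^bsub>U\<^esub> ?P \<ominus>\<^bsub>U\<^esub> (Q \<otimes>\<^bsub>U\<^esub> ?P) \<otimes>\<^bsub>U\<^esub> ?b)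
      \<oplus>\<^bsub>U\<^esub> (Q \<otimes>\<^bsub>U\<^esub> Q [^]\<^bsub>U\<^esub> Suc m) \<otimes>\<^bsub>U\<^esub> ?a"
    unfolding Suc.IH using c unfolding pow by (simp add: sd)
  finally show ?case
    using c unfolding pow by (simp add: U.M.minus_telescope(1))
qed

text \<open>
  Multiply the formula for \<open>n\<close> by \<open>Q\<close> from the left and apply \<open>Q_emb_Q_pow\<close> to \<open>N\<^sup>n(a)\<close>: the two terms
  \<open>Q\<^sup>m\<^sup>+\<^sup>1 N\<^sup>n(a)\<close> cancel.
\<close>

lemma Q_pow_emb_Q_pow:
  assumes a: "a \<in> carrier A"
  shows "Q [^]\<^bsub>U\<^esub> (n::nat) \<otimes>\<^bsub>U\<^esub> \<iota> a \<otimes>\<^bsub>U\<^esub> Q [^]\<^bsub>U\<^esub> (m::nat) =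
    (\<iota> ((N ^^ n) a) \<otimes>\<^bsub>U\<^esub> Q [^]\<^bsub>U\<^esub> m \<ominus>\<^bsub>U\<^esub> Q [^]\<^bsub>U\<^esub> m \<otimes>\<^bsub>U\<^esub> \<iota> ((N ^^ n) a))
    \<oplus>\<^bsub>U\<^esub> Q [^]\<^bsub>U\<^esub> (m + n) \<otimes>\<^bsub>U\<^esub> \<iota> a"
proof (induction n)
  case 0
  show ?case using a by (simp add: \<iota> Q_closed a_minus_def U.M.a_assoc U.M.l_neg)
next
  case (Suc n)
  let ?P = "Q [^]\<^bsub>U\<^esub> m" and ?a = "\<iota> a" and ?b = "\<iota> ((N ^^ n) a)" and ?c = "\<iota> ((N ^^ Suc n) a)"
  have c: "?P \<in> carrier U" "?a \<in> carrier U" "?b \<in> carrier U" "?c \<in> carrier U" "Q \<in> carrier U"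
    "Q [^]\<^bsub>U\<^esub> (n::nat) \<in> carrier U" "Q [^]\<^bsub>U\<^esub> (m + n) \<in> carrier U"
    using a N_pow_closed[OF a] N_pow_closed[OF a, of "Suc n"] by (simp_all add: \<iota> Q_closed)
  note sd = U.l_distr U.r_distr U.l_minus U.r_minus a_minus_def U.m_assoc
  have pow: "Q [^]\<^bsub>U\<^esub> Suc k = Q \<otimes>\<^bsub>U\<^esub> Q [^]\<^bsub>U\<^esub> k" for k :: nat by (rule U.nat_pow_Suc2[OF Q_closed])
  have "Q [^]\<^bsub>U\<^esub> Suc n \<otimes>\<^bsub>U\<^esub> ?a \<otimes>\<^bsub>U\<^esub> ?P = Q \<otimes>\<^bsub>U\<^esub> (Q [^]\<^bsub>U\<^esub> n \<otimes>\<^bsub>U\<^esub> ?a \<otimes>\<^bsub>U\<^esub> ?P)"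
    using c unfolding pow by (simp only: U.m_assoc U.m_closed)
  also have "\<dots> = ((Q \<otimes>\<^bsub>U\<^esub> ?b \<otimes>\<^bsub>U\<^esub> ?P) \<ominus>\<^bsub>U\<^esub> (Q \<otimes>\<^bsub>U\<^esub> ?P) \<otimes>\<^bsub>U\<^esub> ?b) \<oplus>\<^bsub>U\<^esub> (Q \<otimes>\<^bsub>U\<^esub> Q [^]\<^bsub>U\<^esub> (m + n)) \<otimes>\<^bsub>U\<^esub> ?a"
    unfolding Suc.IH using c by (simp add: sd)
  also have "Q \<otimes>\<^bsub>U\<^esub> ?b \<otimes>\<^bsub>U\<^esub> ?P = (?c \<otimes>\<^bsub>U\<^esub> ?P \<ominus>\<^bsub>U\<^esub> ?P \<otimes>\<^bsub>U\<^esub> ?c) \<oplus>\<^bsub>U\<^esub> (Q \<otimes>\<^bsub>U\<^esub> ?P) \<otimes>\<^bsub>U\<^esub> ?b"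
    using Q_emb_Q_pow[OF N_pow_closed[OF a, of n], of m] unfolding pow by simp
  also have "((?c \<otimes>\<^bsub>U\<^esub> ?P \<ominus>\<^bsub>U\<^esub> ?P \<otimes>\<^bsub>U\<^esub> ?c) \<oplus>\<^bsub>U\<^esub> (Q \<otimes>\<^bsub>U\<^esub> ?P) \<otimes>\<^bsub>U\<^esub> ?b \<ominus>\<^bsub>U\<^esub> (Q \<otimes>\<^bsub>U\<^esub> ?P) \<otimes>\<^bsub>U\<^esub> ?b)
      \<oplus>\<^bsub>U\<^esub> (Q \<otimes>\<^bsub>U\<^esub> Q [^]\<^bsub>U\<^esub> (m + n)) \<otimes>\<^bsub>U\<^esub> ?a
      = (?c \<otimes>\<^bsub>U\<^esub> ?P \<ominus>\<^bsub>U\<^esub> ?P \<otimes>\<^bsub>U\<^esub> ?c) \<oplus>\<^bsub>U\<^esub> (Q \<otimes>\<^bsub>U\<^esub> Q [^]\<^bsub>U\<^esub> (m + n)) \<otimes>\<^bsub>U\<^esub> ?a"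
    by (rule U.M.minus_telescope(2)) (use c in \<open>simp_all only: U.m_closed\<close>)
  finally show ?case by (simp only: pow add_Suc_right)
qed

lemma normal_form_mult:
  assumes "a1 \<in> carrier A" "a2 \<in> carrier A" "a3 \<in> carrier A" "a4 \<in> carrier A"
  shows "(\<iota> a1 \<otimes>\<^bsub>U\<^esub> Q [^]\<^bsub>U\<^esub> (n::nat) \<otimes>\<^bsub>U\<^esub> \<iota> a2) \<otimes>\<^bsub>U\<^esub> (\<iota> a3 \<otimes>\<^bsub>U\<^esub> Q [^]\<^bsub>U\<^esub> (m::nat) \<otimes>\<^bsub>U\<^esub> \<iota> a4) =
    ((\<iota> (a1 \<otimes>\<^bsub>A\<^esub> (N ^^ n) (a2 \<otimes>\<^bsub>A\<^esub> a3)) \<otimes>\<^bsub>U\<^esub> Q [^]\<^bsub>U\<^esub> m \<otimes>\<^bsub>U\<^esub> \<iota> a4)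
      \<ominus>\<^bsub>U\<^esub> (\<iota> a1 \<otimes>\<^bsub>U\<^esub> Q [^]\<^bsub>U\<^esub> m \<otimes>\<^bsub>U\<^esub> \<iota> ((N ^^ n) (a2 \<otimes>\<^bsub>A\<^esub> a3) \<otimes>\<^bsub>A\<^esub> a4)))
    \<oplus>\<^bsub>U\<^esub> (\<iota> a1 \<otimes>\<^bsub>U\<^esub> Q [^]\<^bsub>U\<^esub> (m + n) \<otimes>\<^bsub>U\<^esub> \<iota> (a2 \<otimes>\<^bsub>A\<^esub> a3 \<otimes>\<^bsub>A\<^esub> a4))"
proof -
  have a: "a2 \<otimes>\<^bsub>A\<^esub> a3 \<in> carrier A" using assms by simp
  note N = N_pow_closed[OF a, of n]
  have c: "\<iota> a1 \<in> carrier U" "\<iota> a2 \<in> carrier U" "\<iota> a3 \<in> carrier U" "\<iota> a4 \<in> carrier U"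
    "\<iota> ((N ^^ n) (a2 \<otimes>\<^bsub>A\<^esub> a3)) \<in> carrier U" "\<iota> (a2 \<otimes>\<^bsub>A\<^esub> a3) \<in> carrier U"
    using assms a N by (simp_all add: \<iota>(1))
  have "(\<iota> a1 \<otimes>\<^bsub>U\<^esub> Q [^]\<^bsub>U\<^esub> n \<otimes>\<^bsub>U\<^esub> \<iota> a2) \<otimes>\<^bsub>U\<^esub> (\<iota> a3 \<otimes>\<^bsub>U\<^esub> Q [^]\<^bsub>U\<^esub> m \<otimes>\<^bsub>U\<^esub> \<iota> a4) =
      \<iota> a1 \<otimes>\<^bsub>U\<^esub> (Q [^]\<^bsub>U\<^esub> n \<otimes>\<^bsub>U\<^esub> \<iota> (a2 \<otimes>\<^bsub>A\<^esub> a3) \<otimes>\<^bsub>U\<^esub> Q [^]\<^bsub>U\<^esub> m) \<otimes>\<^bsub>U\<^esub> \<iota> a4"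
    using c assms Q_pow_closed by (simp only: \<iota>(3) U.m_assoc U.m_closed)
  also have "\<dots> = ((\<iota> a1 \<otimes>\<^bsub>U\<^esub> \<iota> ((N ^^ n) (a2 \<otimes>\<^bsub>A\<^esub> a3)) \<otimes>\<^bsub>U\<^esub> Q [^]\<^bsub>U\<^esub> m \<otimes>\<^bsub>U\<^esub> \<iota> a4)
      \<ominus>\<^bsub>U\<^esub> (\<iota> a1 \<otimes>\<^bsub>U\<^esub> Q [^]\<^bsub>U\<^esub> m \<otimes>\<^bsub>U\<^esub> (\<iota> ((N ^^ n) (a2 \<otimes>\<^bsub>A\<^esub> a3)) \<otimes>\<^bsub>U\<^esub> \<iota> a4)))
    \<oplus>\<^bsub>U\<^esub> (\<iota> a1 \<otimes>\<^bsub>U\<^esub> Q [^]\<^bsub>U\<^esub> (m + n) \<otimes>\<^bsub>U\<^esub> (\<iota> (a2 \<otimes>\<^bsub>A\<^esub> a3) \<otimes>\<^bsub>U\<^esub> \<iota> a4))"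
    unfolding Q_pow_emb_Q_pow[OF a] using c Q_pow_closed
    by (simp add: U.l_distr U.r_distr U.l_minus U.r_minus a_minus_def U.m_assoc)
  finally show ?thesis using assms a N by (simp only: \<iota>(3))
qed

text \<open>
  The commutation rule for \<open>a = 1\<close>, whose left hand side is the last term of its right hand side.
\<close>

lemma emb_N_one_commutes:
  "\<iota> (N \<one>\<^bsub>A\<^esub>) \<otimes>\<^bsub>U\<^esub> Q [^]\<^bsub>U\<^esub> (n::nat) = Q [^]\<^bsub>U\<^esub> n \<otimes>\<^bsub>U\<^esub> \<iota> (N \<one>\<^bsub>A\<^esub>)"
proof -
  let ?z = "\<iota> (N \<one>\<^bsub>A\<^esub>)"
  have c: "?z \<in> carrier U" by (simp add: \<iota> N_linear)
  let ?u = "?z \<otimes>\<^bsub>U\<^esub> Q [^]\<^bsub>U\<^esub> n" and ?v = "Q [^]\<^bsub>U\<^esub> n \<otimes>\<^bsub>U\<^esub> ?z" and ?w = "Q [^]\<^bsub>U\<^esub> Suc n"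
  have cc: "?u \<in> carrier U" "?v \<in> carrier U" "?w \<in> carrier U" using c Q_closed Q_pow_closed by simp_all
  have "?w = (?u \<ominus>\<^bsub>U\<^esub> ?v) \<oplus>\<^bsub>U\<^esub> ?w"
    using Q_emb_Q_pow[OF A.one_closed, of n] Q_closed Q_pow_closed U.nat_pow_Suc2[OF Q_closed, of n]
    by (simp add: \<iota>(4))
  then have "?u \<ominus>\<^bsub>U\<^esub> ?v = \<zero>\<^bsub>U\<^esub>"
    using cc by (metis U.M.minus_closed U.M.add.r_cancel_one')
  then show ?thesis using cc U.M.add_eq_iff_eq_minus[of "\<zero>\<^bsub>U\<^esub>" ?u ?v] by simp
qed

end

section \<open>The direct sum decomposition\<close>

lemma sub_bimoduleI:
  assumes U: "module K U" and "H \<subseteq> carrier U" "\<zero>\<^bsub>U\<^esub> \<in> H"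
    and "\<And>x y. \<lbrakk>x \<in> H; y \<in> H\<rbrakk> \<Longrightarrow> x \<oplus>\<^bsub>U\<^esub> y \<in> H"
    and smult: "\<And>k x. \<lbrakk>k \<in> carrier K; x \<in> H\<rbrakk> \<Longrightarrow> k \<odot>\<^bsub>U\<^esub> x \<in> H"
    and "\<And>a x. \<lbrakk>a \<in> carrier A; x \<in> H\<rbrakk> \<Longrightarrow> \<iota> a \<otimes>\<^bsub>U\<^esub> x \<in> H"
    and "\<And>a x. \<lbrakk>a \<in> carrier A; x \<in> H\<rbrakk> \<Longrightarrow> x \<otimes>\<^bsub>U\<^esub> \<iota> a \<in> H"
  shows "sub_bimodule K A U \<iota> H"
proof -
  interpret U: module K U by (rule U)
  have "\<ominus>\<^bsub>U\<^esub> x \<in> H" if "x \<in> H" for x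
  proof -
    have "(\<ominus>\<^bsub>K\<^esub> \<one>\<^bsub>K\<^esub>) \<odot>\<^bsub>U\<^esub> x = \<ominus>\<^bsub>U\<^esub> x" using that assms(2) by (simp add: U.smult_l_minus subset_iff)
    then show ?thesis using smult[of "\<ominus>\<^bsub>K\<^esub> \<one>\<^bsub>K\<^esub>" x] that by simp
  qed
  then show ?thesis using assms unfolding sub_bimodule_def by (intro conjI ballI U.submoduleI)
qed

lemma sub_bimoduleD:
  assumes U: "module K U" and H: "sub_bimodule K A U \<iota> H"
  shows "H \<subseteq> carrier U" "\<zero>\<^bsub>U\<^esub> \<in> H"
    and "\<lbrakk>x \<in> H; y \<in> H\<rbrakk> \<Longrightarrow> x \<oplus>\<^bsub>U\<^esub> y \<in> H"
    and "\<lbrakk>k \<in> carrier K; x \<in> H\<rbrakk> \<Longrightarrow> k \<odot>\<^bsub>U\<^esub> x \<in> H"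
    and "\<lbrakk>a \<in> carrier A; x \<in> H\<rbrakk> \<Longrightarrow> \<iota> a \<otimes>\<^bsub>U\<^esub> x \<in> H"
    and "\<lbrakk>a \<in> carrier A; x \<in> H\<rbrakk> \<Longrightarrow> x \<otimes>\<^bsub>U\<^esub> \<iota> a \<in> H"
proof -
  interpret U: module K U by (rule U)
  have s: "submodule H K U" using H by (simp add: sub_bimodule_def)
  note e = U.submoduleE[OF s]
  show sub: "H \<subseteq> carrier U" by (rule e(1))
  show "\<lbrakk>x \<in> H; y \<in> H\<rbrakk> \<Longrightarrow> x \<oplus>\<^bsub>U\<^esub> y \<in> H" by (rule e(5))
  show smult: "\<lbrakk>k \<in> carrier K; x \<in> H\<rbrakk> \<Longrightarrow> k \<odot>\<^bsub>U\<^esub> x \<in> H" for k x by (rule e(4))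
  obtain x where "x \<in> H" using e(2) by blast
  then show "\<zero>\<^bsub>U\<^esub> \<in> H" using smult[OF U.R.zero_closed] U.smult_l_null sub by (metis subsetD)
qed (use H in \<open>auto simp: sub_bimodule_def\<close>)

lemma generated_bimodule_least:
  "\<lbrakk>sub_bimodule K A U \<iota> H; u \<in> H\<rbrakk> \<Longrightarrow> generated_bimodule K A U \<iota> u \<subseteq> H"
  by (auto simp: generated_bimodule_def)

lemma generated_bimodule_contains: "u \<in> generated_bimodule K A U \<iota> u"
  by (simp add: generated_bimodule_def)

context nijenhuis
begin

lemma sub_bimodule_carrier: "sub_bimodule K A U \<iota> (carrier U)"
  by (rule sub_bimoduleI[OF U.module_axioms]) (simp_all add: \<iota>(1))

lemma sub_bimodule_generated:
  assumes u: "u \<in> carrier U"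
  shows "sub_bimodule K A U \<iota> (generated_bimodule K A U \<iota> u)"
proof (rule sub_bimoduleI[OF U.module_axioms])
  show "generated_bimodule K A U \<iota> u \<subseteq> carrier U"
    by (rule generated_bimodule_least[OF sub_bimodule_carrier u])
qed (auto simp: generated_bimodule_def intro: sub_bimoduleD(2-6)[OF U.module_axioms])

text \<open>
  The summand \<open>A\<close> is the bimodule generated by \<open>Q\<^sup>0\<close>, so that all summands can be treated alike.
\<close>

lemma nij_summand_eq:
  "nij_summand K A N i = generated_bimodule K A U \<iota> (Q [^]\<^bsub>U\<^esub> i)"
proof (cases "i = 0")
  case True
  have "sub_bimodule K A U \<iota> (\<iota> ` carrier A)"
  proof (rule sub_bimoduleI[OF U.module_axioms])
    show "\<zero>\<^bsub>U\<^esub> \<in> \<iota> ` carrier A"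
      using \<iota>(5)[OF A.R.zero_closed A.one_closed] U.smult_l_null[OF \<iota>(1)[OF A.one_closed]] A.smult_closed
      by (metis A.R.zero_closed A.one_closed imageI)
  qed (auto simp: \<iota>(1) simp flip: \<iota>(2,3,5))
  moreover have "\<one>\<^bsub>U\<^esub> \<in> \<iota> ` carrier A" by (rule image_eqI[of _ _ "\<one>\<^bsub>A\<^esub>"]) (simp_all add: \<iota>(4))
  ultimately have "generated_bimodule K A U \<iota> \<one>\<^bsub>U\<^esub> \<subseteq> \<iota> ` carrier A" by (rule generated_bimodule_least)
  moreover have "\<iota> ` carrier A \<subseteq> generated_bimodule K A U \<iota> \<one>\<^bsub>U\<^esub>"
  proof
    fix u assume "u \<in> \<iota> ` carrier A"
    then obtain a where a: "a \<in> carrier A" "u = \<iota> a" by blast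
    have "\<iota> a \<otimes>\<^bsub>U\<^esub> \<one>\<^bsub>U\<^esub> \<in> generated_bimodule K A U \<iota> \<one>\<^bsub>U\<^esub>"
      by (rule sub_bimoduleD(5)[OF U.module_axioms sub_bimodule_generated[OF U.one_closed] a(1)
            generated_bimodule_contains])
    then show "u \<in> generated_bimodule K A U \<iota> \<one>\<^bsub>U\<^esub>" using a by (simp add: \<iota>(1))
  qed
  ultimately show ?thesis using True by (simp add: nij_summand_def Let_def)
qed (simp add: nij_summand_def Let_def)

abbreviation "S \<equiv> nij_summand K A N"

lemma S_sub_bimodule: "sub_bimodule K A U \<iota> (S i)"
  unfolding nij_summand_eq by (rule sub_bimodule_generated[OF Q_pow_closed])

lemmas S = sub_bimoduleD[OF U.module_axioms S_sub_bimodule]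

lemma S_least: "\<lbrakk>sub_bimodule K A U \<iota> H; Q [^]\<^bsub>U\<^esub> i \<in> H\<rbrakk> \<Longrightarrow> S i \<subseteq> H"
  unfolding nij_summand_eq by (rule generated_bimodule_least)

lemma Q_pow_in_S: "Q [^]\<^bsub>U\<^esub> i \<in> S i"
  unfolding nij_summand_eq by (rule generated_bimodule_contains)

text \<open>
  The sum of all summands, as an inductive set in order to avoid indexed sums in closure proofs.
\<close>

inductive_set S_sums where
  summand: "u \<in> S i \<Longrightarrow> u \<in> S_sums"
| add: "\<lbrakk>u \<in> S_sums; v \<in> S_sums\<rbrakk> \<Longrightarrow> u \<oplus>\<^bsub>U\<^esub> v \<in> S_sums"

lemma S_sums_closed: "u \<in> S_sums \<Longrightarrow> u \<in> carrier U"
  by (induction rule: S_sums.induct) (use S(1) in auto)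

lemma S_sums_sub_bimodule: "sub_bimodule K A U \<iota> S_sums"
proof (rule sub_bimoduleI[OF U.module_axioms])
  show "S_sums \<subseteq> carrier U" using S_sums_closed by blast
  show "\<zero>\<^bsub>U\<^esub> \<in> S_sums" by (rule S_sums.summand[OF S(2)])
  show "u \<oplus>\<^bsub>U\<^esub> v \<in> S_sums" if "u \<in> S_sums" "v \<in> S_sums" for u v using that by (rule S_sums.add)
  show "k \<odot>\<^bsub>U\<^esub> u \<in> S_sums" if "k \<in> carrier K" "u \<in> S_sums" for k u
    using that(2)
    by (induction rule: S_sums.induct)
      (auto intro: S_sums.intros S(4)[OF that(1)] simp: U.smult_r_distr that(1) S_sums_closed)
  show "\<iota> a \<otimes>\<^bsub>U\<^esub> u \<in> S_sums" if "a \<in> carrier A" "u \<in> S_sums" for a u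
    using that(2)
    by (induction rule: S_sums.induct)
      (auto intro: S_sums.intros S(5)[OF that(1)] simp: U.r_distr \<iota>(1)[OF that(1)] S_sums_closed)
  show "u \<otimes>\<^bsub>U\<^esub> \<iota> a \<in> S_sums" if "a \<in> carrier A" "u \<in> S_sums" for a u
    using that(2)
    by (induction rule: S_sums.induct)
      (auto intro: S_sums.intros S(6)[OF that(1)] simp: U.l_distr \<iota>(1)[OF that(1)] S_sums_closed)
qed

lemmas SS = sub_bimoduleD[OF U.module_axioms S_sums_sub_bimodule]

text \<open>
  The elements \<open>h\<close> for which all \<open>Q a h\<close> lie in the sum form a sub-bimodule; the factor \<open>a\<close> is there
  to make it stable under \<open>A\<close> from the left. By the commutation rule it contains \<open>Q\<^sup>i\<close>, hence \<open>A Q\<^sup>i A\<close>.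
\<close>

lemma Q_mult_S_sums:
  assumes "u \<in> S_sums" shows "Q \<otimes>\<^bsub>U\<^esub> u \<in> S_sums"
  using assms
proof (induction rule: S_sums.induct)
  case (summand u i)
  let ?H = "{h \<in> carrier U. \<forall>a\<in>carrier A. Q \<otimes>\<^bsub>U\<^esub> \<iota> a \<otimes>\<^bsub>U\<^esub> h \<in> S_sums}"
  have "sub_bimodule K A U \<iota> ?H"
  proof (rule sub_bimoduleI[OF U.module_axioms])
    show "\<zero>\<^bsub>U\<^esub> \<in> ?H" using SS(2) by (simp add: Q_closed \<iota>(1))
    fix x assume x: "x \<in> ?H"
    show "x \<oplus>\<^bsub>U\<^esub> y \<in> ?H" if "y \<in> ?H" for y
      using x that by (simp add: U.r_distr Q_closed \<iota>(1) SS(3))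
    show "k \<odot>\<^bsub>U\<^esub> x \<in> ?H" if "k \<in> carrier K" for k
      using x that by (simp add: U.smult_mult_right Q_closed \<iota>(1) SS(4))
    fix a assume a: "a \<in> carrier A"
    have "Q \<otimes>\<^bsub>U\<^esub> \<iota> b \<otimes>\<^bsub>U\<^esub> (\<iota> a \<otimes>\<^bsub>U\<^esub> x) = Q \<otimes>\<^bsub>U\<^esub> \<iota> (b \<otimes>\<^bsub>A\<^esub> a) \<otimes>\<^bsub>U\<^esub> x" if "b \<in> carrier A" for b
      using x a that by (simp add: \<iota>(1,3) Q_closed U.m_assoc)
    then show "\<iota> a \<otimes>\<^bsub>U\<^esub> x \<in> ?H" using x a by (simp add: \<iota>(1))
    have "Q \<otimes>\<^bsub>U\<^esub> \<iota> b \<otimes>\<^bsub>U\<^esub> (x \<otimes>\<^bsub>U\<^esub> \<iota> a) = Q \<otimes>\<^bsub>U\<^esub> \<iota> b \<otimes>\<^bsub>U\<^esub> x \<otimes>\<^bsub>U\<^esub> \<iota> a" if "b \<in> carrier A" for b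
      using x a that by (simp add: \<iota>(1) Q_closed U.m_assoc)
    then show "x \<otimes>\<^bsub>U\<^esub> \<iota> a \<in> ?H" using x a by (simp add: \<iota>(1) SS(6))
  qed auto
  moreover have "Q [^]\<^bsub>U\<^esub> i \<in> ?H"
  proof -
    have pw: "Q [^]\<^bsub>U\<^esub> k \<in> S_sums" for k :: nat by (rule S_sums.summand[OF Q_pow_in_S])
    have "Q \<otimes>\<^bsub>U\<^esub> \<iota> a \<otimes>\<^bsub>U\<^esub> Q [^]\<^bsub>U\<^esub> i \<in> S_sums" if a: "a \<in> carrier A" for a
      unfolding Q_emb_Q_pow[OF a] a_minus_def using a pw
      by (intro SS(3) U.submoduleE(3)[of S_sums] SS(5,6))
        (use S_sums_sub_bimodule pw[of "Suc i"] in \<open>auto simp: sub_bimodule_def N_linear(1)\<close>)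
    then show ?thesis by (simp add: Q_pow_closed)
  qed
  ultimately have "u \<in> ?H" using S_least summand by blast
  then have "Q \<otimes>\<^bsub>U\<^esub> \<iota> \<one>\<^bsub>A\<^esub> \<otimes>\<^bsub>U\<^esub> u \<in> S_sums" by blast
  then show ?case by (simp add: \<iota>(4) Q_closed)
next
  case (add u v)
  then show ?case by (simp add: U.r_distr Q_closed S_sums_closed S_sums.add)
qed

text \<open>
  The elements that map the sum into itself by left multiplication form a subalgebra containing
  the generators of \<open>U\<close>, and the sum contains \<open>1\<close>.
\<close>

lemma S_sums_eq: "S_sums = carrier U"
proof
  show "S_sums \<subseteq> carrier U" by (rule SS(1))
  let ?T = "{u \<in> carrier U. \<forall>v\<in>S_sums. u \<otimes>\<^bsub>U\<^esub> v \<in> S_sums}"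
  have "unital_subalgebra K U ?T"
    unfolding unital_subalgebra_def
    by (auto simp: S_sums_closed U.l_distr U.m_assoc U.smult_mult_left SS(3,4))
  then have "?T = carrier U"
    by (rule nij_operators_generated[OF nijenhuis])
      (auto simp: \<iota>(1) SS(5) Q_closed Q_mult_S_sums)
  moreover have "\<one>\<^bsub>U\<^esub> \<in> S_sums" using S_sums.summand[OF Q_pow_in_S[of 0]] by simp
  ultimately show "carrier U \<subseteq> S_sums"
  proof -
    assume T: "?T = carrier U" and one: "\<one>\<^bsub>U\<^esub> \<in> S_sums"
    show ?thesis
    proof
      fix u assume u: "u \<in> carrier U"
      then have "u \<in> ?T" using T by blast
      then have "u \<otimes>\<^bsub>U\<^esub> \<one>\<^bsub>U\<^esub> \<in> S_sums" using one by blast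
      then show "u \<in> S_sums" using u by simp
    qed
  qed
qed

text \<open>
  The evaluation of the family that is \<open>a Q\<^sup>i b\<close> in degree \<open>i\<close> and zero in all other degrees.
  It is balanced because \<open>N(1)\<close> commutes with \<open>Q\<^sup>i\<close>. Its value is known on the elements
  \<open>a Q\<^sup>j b\<close>, which is extended to \<open>A Q\<^sup>j A\<close> by considering the sub-bimodule of all \<open>h\<close> for which it is as
  expected at every \<open>a h b\<close>.
\<close>

lemma summand_projection:
  "\<exists>p. p \<in> carrier U \<rightarrow> carrier U \<and>
    (\<forall>u\<in>carrier U. \<forall>v\<in>carrier U. p (u \<oplus>\<^bsub>U\<^esub> v) = p u \<oplus>\<^bsub>U\<^esub> p v) \<and>
    (\<forall>j. \<forall>u\<in>S j. p u = (if j = i then u else \<zero>\<^bsub>U\<^esub>))"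
proof -
  interpret nijenhuis_module K A N U by unfold_locales
  define f where "f j a b = (if a \<in> carrier A \<and> b \<in> carrier A \<and> j = i
    then \<iota> a \<otimes>\<^bsub>U\<^esub> Q [^]\<^bsub>U\<^esub> i \<otimes>\<^bsub>U\<^esub> \<iota> b else \<zero>\<^bsub>U\<^esub>)" for j a b
  have f: "f \<in> carrier G"
  proof (rule G_memI)
    fix j a b assume a: "a \<in> carrier A" and b: "b \<in> carrier A"
    have z: "N \<one>\<^bsub>A\<^esub> \<in> carrier A" by (simp add: N_linear)
    have "\<iota> (a \<otimes>\<^bsub>A\<^esub> N \<one>\<^bsub>A\<^esub>) \<otimes>\<^bsub>U\<^esub> Q [^]\<^bsub>U\<^esub> i \<otimes>\<^bsub>U\<^esub> \<iota> b
        = \<iota> a \<otimes>\<^bsub>U\<^esub> (\<iota> (N \<one>\<^bsub>A\<^esub>) \<otimes>\<^bsub>U\<^esub> Q [^]\<^bsub>U\<^esub> i) \<otimes>\<^bsub>U\<^esub> \<iota> b"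
      using a b z by (simp add: \<iota>(1,3) Q_pow_closed U.m_assoc)
    also have "\<dots> = \<iota> a \<otimes>\<^bsub>U\<^esub> Q [^]\<^bsub>U\<^esub> i \<otimes>\<^bsub>U\<^esub> \<iota> (N \<one>\<^bsub>A\<^esub> \<otimes>\<^bsub>A\<^esub> b)"
      unfolding emb_N_one_commutes using a b z by (simp add: \<iota>(1,3) Q_pow_closed U.m_assoc)
    finally show "f j (a \<otimes>\<^bsub>A\<^esub> N \<one>\<^bsub>A\<^esub>) b = f j a (N \<one>\<^bsub>A\<^esub> \<otimes>\<^bsub>A\<^esub> b)" using a b z by (simp add: f_def)
  qed (auto simp: f_def \<iota> Q_closed U.l_distr U.r_distr U.smult_mult_left U.smult_mult_right)
  obtain p where pc: "p \<in> carrier U \<rightarrow> carrier U"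
    and padd: "\<And>u v. \<lbrakk>u \<in> carrier U; v \<in> carrier U\<rbrakk> \<Longrightarrow> p (u \<oplus>\<^bsub>U\<^esub> v) = p u \<oplus>\<^bsub>U\<^esub> p v"
    and psm: "\<And>k u. \<lbrakk>k \<in> carrier K; u \<in> carrier U\<rbrakk> \<Longrightarrow> p (k \<odot>\<^bsub>U\<^esub> u) = k \<odot>\<^bsub>U\<^esub> p u"
    and pnf: "\<And>a b n. \<lbrakk>a \<in> carrier A; b \<in> carrier A\<rbrakk> \<Longrightarrow> p (\<iota> a \<otimes>\<^bsub>U\<^esub> Q [^]\<^bsub>U\<^esub> (n::nat) \<otimes>\<^bsub>U\<^esub> \<iota> b) = f n a b"
    using functional_evaluation[OF f] by (elim exE conjE) (metis (no_types, lifting))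
  have "p u = (if j = i then u else \<zero>\<^bsub>U\<^esub>)" if u: "u \<in> S j" for j u
  proof -
    let ?c = "\<lambda>x. if j = i then x else \<zero>\<^bsub>U\<^esub>"
    let ?H = "{h \<in> carrier U. \<forall>a\<in>carrier A. \<forall>b\<in>carrier A. p (\<iota> a \<otimes>\<^bsub>U\<^esub> h \<otimes>\<^bsub>U\<^esub> \<iota> b) = ?c (\<iota> a \<otimes>\<^bsub>U\<^esub> h \<otimes>\<^bsub>U\<^esub> \<iota> b)}"
    have p0: "p \<zero>\<^bsub>U\<^esub> = \<zero>\<^bsub>U\<^esub>"
      using psm[OF A.R.zero_closed U.M.zero_closed] pc by (auto simp: U.smult_l_null Pi_def)
    have "sub_bimodule K A U \<iota> ?H"
    proof (rule sub_bimoduleI[OF U.module_axioms])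
      show "\<zero>\<^bsub>U\<^esub> \<in> ?H" by (simp add: \<iota>(1) p0)
      fix x assume x: "x \<in> ?H"
      show "x \<oplus>\<^bsub>U\<^esub> y \<in> ?H" if "y \<in> ?H" for y
        using x that by (simp add: U.l_distr U.r_distr \<iota>(1) padd)
      show "k \<odot>\<^bsub>U\<^esub> x \<in> ?H" if "k \<in> carrier K" for k
        using x that by (simp add: U.smult_mult_left U.smult_mult_right \<iota>(1) psm)
      fix a assume a: "a \<in> carrier A"
      have "\<iota> b \<otimes>\<^bsub>U\<^esub> (\<iota> a \<otimes>\<^bsub>U\<^esub> x) \<otimes>\<^bsub>U\<^esub> \<iota> c = \<iota> (b \<otimes>\<^bsub>A\<^esub> a) \<otimes>\<^bsub>U\<^esub> x \<otimes>\<^bsub>U\<^esub> \<iota> c"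
        "\<iota> b \<otimes>\<^bsub>U\<^esub> (x \<otimes>\<^bsub>U\<^esub> \<iota> a) \<otimes>\<^bsub>U\<^esub> \<iota> c = \<iota> b \<otimes>\<^bsub>U\<^esub> x \<otimes>\<^bsub>U\<^esub> \<iota> (a \<otimes>\<^bsub>A\<^esub> c)"
        if "b \<in> carrier A" "c \<in> carrier A" for b c
        using x a that by (simp_all add: \<iota>(1,3) U.m_assoc)
      then show "\<iota> a \<otimes>\<^bsub>U\<^esub> x \<in> ?H" "x \<otimes>\<^bsub>U\<^esub> \<iota> a \<in> ?H" using x a by (simp_all add: \<iota>(1))
    qed auto
    moreover have "Q [^]\<^bsub>U\<^esub> j \<in> ?H" by (simp add: Q_pow_closed pnf f_def)
    ultimately have "u \<in> ?H" using S_least u by blast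
    then have "p (\<iota> \<one>\<^bsub>A\<^esub> \<otimes>\<^bsub>U\<^esub> u \<otimes>\<^bsub>U\<^esub> \<iota> \<one>\<^bsub>A\<^esub>) = ?c (\<iota> \<one>\<^bsub>A\<^esub> \<otimes>\<^bsub>U\<^esub> u \<otimes>\<^bsub>U\<^esub> \<iota> \<one>\<^bsub>A\<^esub>)"
      and "u \<in> carrier U" by (blast intro: A.one_closed)+
    then show ?thesis by (simp add: \<iota>(4))
  qed
  then show ?thesis using pc padd by (intro exI[of _ p]) simp
qed

lemma S_decomposition_exists:
  assumes "u \<in> carrier U"
  shows "\<exists>x. (\<forall>i. x i \<in> S i) \<and> finite {i. x i \<noteq> \<zero>\<^bsub>U\<^esub>} \<and> u = (\<Oplus>\<^bsub>U\<^esub>i\<in>{i. x i \<noteq> \<zero>\<^bsub>U\<^esub>}. x i)"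
proof -
  have sup: "(\<Oplus>\<^bsub>U\<^esub>i\<in>{i. x i \<noteq> \<zero>\<^bsub>U\<^esub>}. x i) = (\<Oplus>\<^bsub>U\<^esub>i\<in>T. x i)"
    if "\<forall>i. x i \<in> S i" "finite T" "{i. x i \<noteq> \<zero>\<^bsub>U\<^esub>} \<subseteq> T" for x T
  proof -
    have "x \<in> T \<rightarrow> carrier U" using that(1) S(1) by blast
    then show ?thesis using that(2,3) by (intro U.M.add.finprod_mono_neutral_cong_left) auto
  qed
  have "u \<in> S_sums" using assms by (simp add: S_sums_eq)
  then show ?thesis
  proof (induction rule: S_sums.induct)
    case (summand u i)
    let ?x = "\<lambda>j. if j = i then u else \<zero>\<^bsub>U\<^esub>"
    have x: "\<forall>j. ?x j \<in> S j" using summand S(2) by simp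
    have i: "{j. ?x j \<noteq> \<zero>\<^bsub>U\<^esub>} \<subseteq> {i}" by auto
    have "u \<in> carrier U" using S(1) summand by blast
    then have "u = (\<Oplus>\<^bsub>U\<^esub>j\<in>{i}. ?x j)" by simp
    also have "\<dots> = (\<Oplus>\<^bsub>U\<^esub>j\<in>{j. ?x j \<noteq> \<zero>\<^bsub>U\<^esub>}. ?x j)" using sup[OF x _ i] by simp
    finally have "u = (\<Oplus>\<^bsub>U\<^esub>j\<in>{j. ?x j \<noteq> \<zero>\<^bsub>U\<^esub>}. ?x j)" .
    moreover have "finite {j. ?x j \<noteq> \<zero>\<^bsub>U\<^esub>}" using i by (rule finite_subset) simp
    ultimately show ?case using x by (intro exI[of _ ?x] conjI)
  next
    case (add u v)
    then obtain x y where x: "\<forall>i. x i \<in> S i" "finite {i. x i \<noteq> \<zero>\<^bsub>U\<^esub>}" "u = (\<Oplus>\<^bsub>U\<^esub>i\<in>{i. x i \<noteq> \<zero>\<^bsub>U\<^esub>}. x i)"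
      and y: "\<forall>i. y i \<in> S i" "finite {i. y i \<noteq> \<zero>\<^bsub>U\<^esub>}" "v = (\<Oplus>\<^bsub>U\<^esub>i\<in>{i. y i \<noteq> \<zero>\<^bsub>U\<^esub>}. y i)"
      by metis
    let ?T = "{i. x i \<noteq> \<zero>\<^bsub>U\<^esub>} \<union> {i. y i \<noteq> \<zero>\<^bsub>U\<^esub>}" and ?z = "\<lambda>i. x i \<oplus>\<^bsub>U\<^esub> y i"
    have T: "finite ?T" using x y by blast
    have xy: "x \<in> ?T \<rightarrow> carrier U" "y \<in> ?T \<rightarrow> carrier U" using x(1) y(1) S(1) by blast+
    have z: "\<forall>i. ?z i \<in> S i" using x(1) y(1) S(3) by simp
    have zT: "{i. ?z i \<noteq> \<zero>\<^bsub>U\<^esub>} \<subseteq> ?T" by auto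
    have "u \<oplus>\<^bsub>U\<^esub> v = (\<Oplus>\<^bsub>U\<^esub>i\<in>?T. x i) \<oplus>\<^bsub>U\<^esub> (\<Oplus>\<^bsub>U\<^esub>i\<in>?T. y i)"
      unfolding x(3) y(3) using sup[OF x(1) T] sup[OF y(1) T] by simp
    also have "\<dots> = (\<Oplus>\<^bsub>U\<^esub>i\<in>{i. ?z i \<noteq> \<zero>\<^bsub>U\<^esub>}. ?z i)"
      unfolding sup[OF z T zT] by (rule U.M.finsum_addf[OF xy, symmetric])
    finally show ?case using z finite_subset[OF zT T] by (intro exI[of _ ?z]) blast
  qed
qed

lemma S_decomposition_unique:
  assumes x: "\<forall>i. x i \<in> S i" "finite {i. x i \<noteq> \<zero>\<^bsub>U\<^esub>}"
    and y: "\<forall>i. y i \<in> S i" "finite {i. y i \<noteq> \<zero>\<^bsub>U\<^esub>}"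
    and eq: "(\<Oplus>\<^bsub>U\<^esub>i\<in>{i. x i \<noteq> \<zero>\<^bsub>U\<^esub>}. x i) = (\<Oplus>\<^bsub>U\<^esub>i\<in>{i. y i \<noteq> \<zero>\<^bsub>U\<^esub>}. y i)"
  shows "x = y"
proof
  fix i
  obtain p where pc: "p \<in> carrier U \<rightarrow> carrier U"
    and padd: "\<And>u v. \<lbrakk>u \<in> carrier U; v \<in> carrier U\<rbrakk> \<Longrightarrow> p (u \<oplus>\<^bsub>U\<^esub> v) = p u \<oplus>\<^bsub>U\<^esub> p v"
    and pS: "\<And>j u. u \<in> S j \<Longrightarrow> p u = (if j = i then u else \<zero>\<^bsub>U\<^esub>)"
    using summand_projection[of i] by metis
  have p0: "p \<zero>\<^bsub>U\<^esub> = \<zero>\<^bsub>U\<^esub>" using pS[OF S(2)] by simp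
  have "p (\<Oplus>\<^bsub>U\<^esub>j\<in>T. x j) = (if i \<in> T then x i else \<zero>\<^bsub>U\<^esub>)"
    if x: "\<forall>i. x i \<in> S i" and T: "finite T" for x T
    using T
  proof (induction T rule: finite_induct)
    case empty
    then show ?case by (simp add: p0)
  next
    case (insert j T)
    have xc: "x k \<in> carrier U" for k using x S(1) by blast
    then have "x \<in> T \<rightarrow> carrier U" by blast
    moreover have "p (x j) = (if j = i then x j else \<zero>\<^bsub>U\<^esub>)" using x by (intro pS) blast
    ultimately show ?case using insert xc
      by (cases "j = i") (simp_all add: padd U.M.finsum_closed)
  qed
  then have "p (\<Oplus>\<^bsub>U\<^esub>j\<in>{j. x j \<noteq> \<zero>\<^bsub>U\<^esub>}. x j) = x i" "p (\<Oplus>\<^bsub>U\<^esub>j\<in>{j. y j \<noteq> \<zero>\<^bsub>U\<^esub>}. y j) = y i"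
    using x y by auto
  then show "x i = y i" using eq by simp
qed

lemma direct_sum: "bimodule_direct_sum K A U \<iota> S"
  unfolding bimodule_direct_sum_def
proof (intro conjI allI ballI)
  fix u assume "u \<in> carrier U"
  from S_decomposition_exists[OF this]
  show "\<exists>!x. (\<forall>i. x i \<in> S i) \<and> finite {i. x i \<noteq> \<zero>\<^bsub>U\<^esub>} \<and> u = (\<Oplus>\<^bsub>U\<^esub>i\<in>{i. x i \<noteq> \<zero>\<^bsub>U\<^esub>}. x i)"
    by (elim ex_ex1I) (metis S_decomposition_unique)
qed (rule S_sub_bimodule)

end

theorem theorem3p9:
  fixes K :: "('k, 'r) ring_scheme" and A :: "('k, 'a, 'm) module_scheme" and N :: "'a \<Rightarrow> 'a"
  assumes "nijenhuis_algebra K A N"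
  shows "let U = nij_operators K A N; \<iota> = nij_emb K A N; Q = nij_Q K A N in
    inj_on \<iota> (carrier A) \<and>
    bimodule_direct_sum K A U \<iota> (nij_summand K A N) \<and>
    (\<forall>a\<in>carrier A. \<forall>a1\<in>carrier A. \<forall>a2\<in>carrier A. \<forall>n\<ge>1::nat.
      \<iota> a \<otimes>\<^bsub>U\<^esub> (\<iota> a1 \<otimes>\<^bsub>U\<^esub> Q [^]\<^bsub>U\<^esub> n \<otimes>\<^bsub>U\<^esub> \<iota> a2)
        = \<iota> (a \<otimes>\<^bsub>A\<^esub> a1) \<otimes>\<^bsub>U\<^esub> Q [^]\<^bsub>U\<^esub> n \<otimes>\<^bsub>U\<^esub> \<iota> a2) \<and>
    (\<forall>a\<in>carrier A. \<forall>a1\<in>carrier A. \<forall>a2\<in>carrier A. \<forall>n\<ge>1::nat.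
      (\<iota> a1 \<otimes>\<^bsub>U\<^esub> Q [^]\<^bsub>U\<^esub> n \<otimes>\<^bsub>U\<^esub> \<iota> a2) \<otimes>\<^bsub>U\<^esub> \<iota> a
        = \<iota> a1 \<otimes>\<^bsub>U\<^esub> Q [^]\<^bsub>U\<^esub> n \<otimes>\<^bsub>U\<^esub> \<iota> (a2 \<otimes>\<^bsub>A\<^esub> a)) \<and>
    (\<forall>a1\<in>carrier A. \<forall>a2\<in>carrier A. \<forall>a3\<in>carrier A. \<forall>a4\<in>carrier A. \<forall>n\<ge>1::nat. \<forall>m\<ge>1::nat.
      (\<iota> a1 \<otimes>\<^bsub>U\<^esub> Q [^]\<^bsub>U\<^esub> n \<otimes>\<^bsub>U\<^esub> \<iota> a2) \<otimes>\<^bsub>U\<^esub> (\<iota> a3 \<otimes>\<^bsub>U\<^esub> Q [^]\<^bsub>U\<^esub> m \<otimes>\<^bsub>U\<^esub> \<iota> a4)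
        = ((\<iota> (a1 \<otimes>\<^bsub>A\<^esub> (N ^^ n) (a2 \<otimes>\<^bsub>A\<^esub> a3)) \<otimes>\<^bsub>U\<^esub> Q [^]\<^bsub>U\<^esub> m \<otimes>\<^bsub>U\<^esub> \<iota> a4)
           \<ominus>\<^bsub>U\<^esub> (\<iota> a1 \<otimes>\<^bsub>U\<^esub> Q [^]\<^bsub>U\<^esub> m \<otimes>\<^bsub>U\<^esub> \<iota> ((N ^^ n) (a2 \<otimes>\<^bsub>A\<^esub> a3) \<otimes>\<^bsub>A\<^esub> a4)))
          \<oplus>\<^bsub>U\<^esub> (\<iota> a1 \<otimes>\<^bsub>U\<^esub> Q [^]\<^bsub>U\<^esub> (m + n) \<otimes>\<^bsub>U\<^esub> \<iota> (a2 \<otimes>\<^bsub>A\<^esub> a3 \<otimes>\<^bsub>A\<^esub> a4)))"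
proof -
  interpret nijenhuis K A N
    using assms by (simp add: nijenhuis_def nijenhuis_axioms_def nijenhuis_algebra_def)
  show ?thesis
    unfolding Let_def
    by (intro conjI ballI allI impI emb_inj direct_sum normal_form_mult)
      (simp_all add: \<iota>(1,3) Q_pow_closed U.m_assoc)
qed

end
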